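(* Let $U_1^-=(D_1^-,S_1^-)$ and $U_2^+=(D_2^+,S_2^+)$ be the asymptotic stationary states on the upstream link 1 and the downstream link 2, respectively. Then interior states $U_1(0^-,t)=(D_1(0^-,t),S_1(0^-,t))$ (a traffic state of link 1) and $U_2(0^+,t)=(D_2(0^+,t),S_2(0^+,t))$ (a traffic state of link 2) are admissible if and only if $$U_1(0^-,t)=\begin{cases}(C_1,S_1^-)=U_1^-, & \text{when } S_1^-<D_1^-=C_1,\\ (D_1(0^-,t),S_1(0^-,t))\ \text{ with } S_1(0^-,t)\ge D_1^-, & \text{when } D_1^-\le S_1^-=C_1,\end{cases}$$ and $$U_2(0^+,t)=\begin{cases}(D_2^+,C_2)=U_2^+, & \text{when } D_2^+<S_2^+=C_2,\\ (D_2(0^+,t),S_2(0^+,t))\ \text{ with } D_2(0^+,t)\ge S_2^+, & \text{when } S_2^+\le D_2^+=C_2.\end{cases}$$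
   Context: Setting: the inhomogeneous Lighthill-Whitham-Richards (LWR) model $\partial_t\rho+\partial_x Q(x,\rho)=0$ on the line, where $Q(x,\rho)=Q_1(\rho)$ for $x<0$ (upstream link 1) and $Q(x,\rho)=Q_2(\rho)$ for $x>0$ (downstream link 2); $x=0$ is called a linear boundary. Fundamental diagrams: for $i=1,2$, $Q_i:[0,\rho_{j,i}]\to[0,\infty)$ is a continuous, piecewise continuously differentiable function with $Q_i(0)=Q_i(\rho_{j,i})=0$ that is unimodal: strictly increasing on $[0,\rho_{c,i}]$ and strictly decreasing on $[\rho_{c,i},\rho_{j,i}]$, with capacity $C_i=Q_i(\rho_{c,i})>0$. Concavity is not assumed. Supply-demand representation: the demand and supply of density $\rho$ on link $i$ are $D_i(\rho)=Q_i(\min\{\rho,\rho_{c,i}\})$ and $S_i(\rho)=Q_i(\max\{\rho,\rho_{c,i}\})$. The map $\rho\mapsto(D_i(\rho),S_i(\rho))$ is a bijection from $[0,\rho_{j,i}]$ onto $\{(D,S): D,S\ge 0,\ \max\{D,S\}=C_i\}$; elements of this set are called traffic states of link $i$ and are identified with the corresponding densities. Stationary and interior states: $U_1^-$ is the stationary state on link 1 (a traffic state of link 1) and $U_2^+$ the stationary state on link 2 (a traffic state of link 2). Interior states $U_1(0^-,t)$ and $U_2(0^+,t)$, constant for $t>0$, are states located at the boundary only and occupying infinitesimal space, so they must not propagate into the links. Admissibility: $U_1(0^-,t)$ is admissible if the self-similar entropy solution of the Riemann problem for $\partial_t\rho+\partial_xQ_1(\rho)=0$ with left state $U_1^-$ and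 right state $U_1(0^-,t)$ has no wave of negative speed, i.e. the solution equals $U_1^-$ for all $x/t<0$ (waves of zero speed are allowed). $U_2(0^+,t)$ is admissible if the self-similar entropy solution of the Riemann problem for $\partial_t\rho+\partial_xQ_2(\rho)=0$ with left state $U_2(0^+,t)$ and right state $U_2^+$ has no wave of positive speed, i.e. the solution equals $U_2^+$ for all $x/t>0$ (waves of zero speed are allowed). *)

theory Defs
  imports "HOL-Analysis.Analysis"
begin

section \<open>Fundamental diagrams and traffic states\<close>

text \<open>
  A fundamental diagram is a total function \<open>Q\<close> of which only the values on \<open>{0..rj}\<close> matter;
  \<open>rj\<close> is the jam density and \<open>rc\<close> the critical density. In particular
  the exceptional set in \<^const>\<open>piecewise_C1_differentiable_on\<close> may contain the end points, so
  nothing is required outside \<open>{0..rj}\<close>. Concavity is not assumed.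
\<close>

definition fundamental_diagram :: "(real \<Rightarrow> real) \<Rightarrow> real \<Rightarrow> real \<Rightarrow> bool" where
  "fundamental_diagram Q rj rc \<longleftrightarrow>
     0 \<le> rc \<and> rc \<le> rj \<and>
     Q piecewise_C1_differentiable_on {0..rj} \<and>
     (\<forall>r\<in>{0..rj}. 0 \<le> Q r) \<and> Q 0 = 0 \<and> Q rj = 0 \<and>
     strict_mono_on {0..rc} Q \<and> strict_antimono_on {rc..rj} Q \<and>
     0 < Q rc"

definition capacity :: "(real \<Rightarrow> real) \<Rightarrow> real \<Rightarrow> real" where
  "capacity Q rc = Q rc"

definition demand_of :: "(real \<Rightarrow> real) \<Rightarrow> real \<Rightarrow> real \<Rightarrow> real" where
  "demand_of Q rc r = Q (min r rc)"

definition supply_of :: "(real \<Rightarrow> real) \<Rightarrow> real \<Rightarrow> real \<Rightarrow> real" where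
  "supply_of Q rc r = Q (max r rc)"

definition traffic_states :: "(real \<Rightarrow> real) \<Rightarrow> real \<Rightarrow> (real \<times> real) set" where
  "traffic_states Q rc = {(D, S). 0 \<le> D \<and> 0 \<le> S \<and> max D S = capacity Q rc}"

definition state_of :: "(real \<Rightarrow> real) \<Rightarrow> real \<Rightarrow> real \<Rightarrow> real \<times> real" where
  "state_of Q rc r = (demand_of Q rc r, supply_of Q rc r)"

definition density_of :: "(real \<Rightarrow> real) \<Rightarrow> real \<Rightarrow> real \<Rightarrow> real \<times> real \<Rightarrow> real" where
  "density_of Q rj rc U = the_inv_into {0..rj} (state_of Q rc) U"

lemma bij_betw_state_of:
  assumes fd: "fundamental_diagram Q rj rc"
  shows "bij_betw (state_of Q rc) {0..rj} (traffic_states Q rc)"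
proof -
  have rc: "0 \<le> rc" "rc \<le> rj" and nn: "\<And>r. 0 \<le> r \<Longrightarrow> r \<le> rj \<Longrightarrow> 0 \<le> Q r"
    and z: "Q 0 = 0" "Q rj = 0"
    and cont: "continuous_on {0..rj} Q"
    using fd by (auto simp: fundamental_diagram_def piecewise_C1_differentiable_on_def)
  have inc: "Q x < Q y" if "0 \<le> x" "x < y" "y \<le> rc" for x y
    using fd that by (auto simp: fundamental_diagram_def dest: monotone_onD[where x = x and y = y])
  have dec: "Q y < Q x" if "rc \<le> x" "x < y" "y \<le> rj" for x y
    using fd that by (auto simp: fundamental_diagram_def dest: monotone_onD[where x = x and y = y])
  have inj: "state_of Q rc x \<noteq> state_of Q rc y" if "0 \<le> x" "x < y" "y \<le> rj" for x y
  proof (cases "x < rc")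
    case True
    then show ?thesis using inc[of x "min y rc"] that
      by (auto simp: state_of_def demand_of_def min_def split: if_splits)
  next
    case False
    then show ?thesis using dec[of x y] that
      by (auto simp: state_of_def supply_of_def max_def)
  qed
  have mem: "state_of Q rc r \<in> traffic_states Q rc" if "0 \<le> r" "r \<le> rj" for r
    using that rc nn inc[of r rc] dec[of rc r]
    by (cases r rc rule: linorder_cases)
       (auto simp: state_of_def demand_of_def supply_of_def traffic_states_def capacity_def)
  have sur: "U \<in> state_of Q rc ` {0..rj}" if U: "U \<in> traffic_states Q rc" for U
  proof -
    obtain D S where DS: "U = (D, S)" "0 \<le> D" "0 \<le> S" "D \<le> Q rc" "S \<le> Q rc"
      "D = Q rc \<or> S = Q rc"
      using U by (auto simp: traffic_states_def capacity_def max_def split: if_splits)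
    show ?thesis
    proof (cases "S = Q rc")
      case True
      obtain r where "0 \<le> r" "r \<le> rc" "Q r = D"
        using IVT'[of Q 0 D rc] DS rc z continuous_on_subset[OF cont, of "{0..rc}"] by auto
      then show ?thesis using DS True rc
        by (intro image_eqI[of _ _ r]) (auto simp: state_of_def demand_of_def supply_of_def)
    next
      case False
      obtain r where "rc \<le> r" "r \<le> rj" "Q r = S"
        using IVT2'[of Q rj S rc] DS rc z continuous_on_subset[OF cont, of "{rc..rj}"] by auto
      then show ?thesis using DS False rc
        by (intro image_eqI[of _ _ r]) (auto simp: state_of_def demand_of_def supply_of_def)
    qed
  qed
  show ?thesis
    unfolding bij_betw_def inj_on_def
    using inj mem sur by (auto, metis linorder_neqE_linordered_idom)
qed


section \<open>Entropy solutions of the Cauchy and Riemann problems\<close>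

text \<open>
  Nonnegative compactly supported \<open>C\<^sup>1\<close> test functions \<open>\<phi> x t\<close> on the whole \<open>(x, t)\<close>-plane, with
  partial derivatives \<open>\<phi>x\<close>, \<open>\<phi>t\<close>. They need not vanish at \<open>t = 0\<close>.
\<close>

definition test_function ::
  "(real \<Rightarrow> real \<Rightarrow> real) \<Rightarrow> (real \<Rightarrow> real \<Rightarrow> real) \<Rightarrow> (real \<Rightarrow> real \<Rightarrow> real) \<Rightarrow> bool" where
  "test_function \<phi> \<phi>x \<phi>t \<longleftrightarrow>
     (\<forall>x t. 0 \<le> \<phi> x t) \<and>
     (\<forall>x t. ((\<lambda>y. \<phi> y t) has_real_derivative \<phi>x x t) (at x)) \<and>
     (\<forall>x t. ((\<lambda>s. \<phi> x s) has_real_derivative \<phi>t x t) (at t)) \<and>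
     continuous_on UNIV (\<lambda>(x, t). \<phi>x x t) \<and>
     continuous_on UNIV (\<lambda>(x, t). \<phi>t x t) \<and>
     (\<exists>R. \<forall>x t. R < \<bar>x\<bar> \<or> R < \<bar>t\<bar> \<longrightarrow> \<phi> x t = 0)"

text \<open>
  Kruzhkov's entropy solutions \<open>u x t\<close>, \<open>t > 0\<close>, of \<open>u\<^sub>t + Q(u)\<^sub>x = 0\<close>, \<open>u(\<cdot>, 0) = u0\<close>, with values
  in the domain \<open>{0..rj}\<close> of the flux: for all constants \<open>k\<close>,
  \<open>\<bar>u - k\<bar>\<^sub>t + (sgn (u - k) (Q u - Q k))\<^sub>x \<le> 0\<close> in the sense of distributions, with the initial
  datum incorporated in the weak formulation. The choices \<open>k = 0\<close> and \<open>k = rj\<close>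
  give the weak form of the conservation law. The integrands are bounded with bounded support.
\<close>

definition entropy_solution ::
  "(real \<Rightarrow> real) \<Rightarrow> real \<Rightarrow> (real \<Rightarrow> real) \<Rightarrow> (real \<Rightarrow> real \<Rightarrow> real) \<Rightarrow> bool" where
  "entropy_solution Q rj u0 u \<longleftrightarrow>
     set_borel_measurable lborel (UNIV \<times> {0<..}) (\<lambda>(x, t). u x t) \<and>
     (\<forall>x. \<forall>t>0. u x t \<in> {0..rj}) \<and>
     (\<forall>k\<in>{0..rj}. \<forall>\<phi> \<phi>x \<phi>t. test_function \<phi> \<phi>x \<phi>t \<longrightarrow>
        0 \<le> (LINT (x, t) : UNIV \<times> {0<..} | lborel.
               \<bar>u x t - k\<bar> * \<phi>t x t + sgn (u x t - k) * (Q (u x t) - Q k) * \<phi>x x t)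
             + (LINT x | lborel. \<bar>u0 x - k\<bar> * \<phi> x 0))"

definition riemann_data :: "real \<Rightarrow> real \<Rightarrow> real \<Rightarrow> real" where
  "riemann_data rl rr x = (if x < 0 then rl else rr)"

text \<open>\<open>v\<close> is the profile of a self-similar solution \<open>v (x / t)\<close>.\<close>

definition riemann_solution ::
  "(real \<Rightarrow> real) \<Rightarrow> real \<Rightarrow> real \<Rightarrow> real \<Rightarrow> (real \<Rightarrow> real) \<Rightarrow> bool" where
  "riemann_solution Q rj rl rr v \<longleftrightarrow>
     entropy_solution Q rj (riemann_data rl rr) (\<lambda>x t. v (x / t))"


section \<open>Admissible interior states\<close>

text \<open>
  Entropy solutions are determined only up to null sets, hence the property of \<^emph>\<open>the\<close>
  self-similar solution is stated for almost every \<open>\<xi> = x / t\<close> and for every representative;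
  existence is demanded separately, so that it is not vacuous.
\<close>

definition admissible_upstream ::
  "(real \<Rightarrow> real) \<Rightarrow> real \<Rightarrow> real \<Rightarrow> real \<times> real \<Rightarrow> real \<times> real \<Rightarrow> bool" where
  "admissible_upstream Q rj rc Um U \<longleftrightarrow>
     (\<exists>v. riemann_solution Q rj (density_of Q rj rc Um) (density_of Q rj rc U) v) \<and>
     (\<forall>v. riemann_solution Q rj (density_of Q rj rc Um) (density_of Q rj rc U) v \<longrightarrow>
        (AE \<xi> in lborel. \<xi> < 0 \<longrightarrow> v \<xi> = density_of Q rj rc Um))"

definition admissible_downstream ::
  "(real \<Rightarrow> real) \<Rightarrow> real \<Rightarrow> real \<Rightarrow> real \<times> real \<Rightarrow> real \<times> real \<Rightarrow> bool" where
  "admissible_downstream Q rj rc U Up \<longleftrightarrow>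
     (\<exists>v. riemann_solution Q rj (density_of Q rj rc U) (density_of Q rj rc Up) v) \<and>
     (\<forall>v. riemann_solution Q rj (density_of Q rj rc U) (density_of Q rj rc Up) v \<longrightarrow>
        (AE \<xi> in lborel. \<xi> > 0 \<longrightarrow> v \<xi> = density_of Q rj rc Up))"

end

theory Submission
  imports Defs
begin

text \<open>
  The wave speeds in the self-similar solution from \<open>a\<close> to \<open>b\<close> are the slopes of the lower convex
  hull of \<open>Q\<close> over \<open>[a, b]\<close> if \<open>a \<le> b\<close>, and of the upper concave hull over \<open>[b, a]\<close> if \<open>b \<le> a\<close>.
  They start at the state \<open>a\<close> and increase from there, so no wave has negative speed if and only if \<open>Q a\<close> is
  the minimum, respectively the maximum, of \<open>Q\<close> between the two states. This holds for every
  flux that is continuous on \<open>{0..rj}\<close> (\<open>upstream_stationary_iff\<close>), and for a unimodal flux it is the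
  stated case distinction. The downstream condition is the upstream one for the flux \<open>-Q\<close>
  after the reflection \<open>x \<mapsto> -x\<close>, and \<open>r \<mapsto> rj - r\<close> exchanges the cases
  \<open>a \<le> b\<close> and \<open>b \<le> a\<close>, so that \<open>a \<le> b\<close> may be assumed.

  What an arbitrary entropy solution must satisfy is read off from one inequality. A test function
  \<open>\<alpha> x * \<beta> t\<close> with \<open>\<beta>' \<le> -2 \<beta>\<close> for \<open>t > 0\<close> turns the entropy inequality for a pair
  \<open>\<eta> \<ge> 0\<close>, \<open>q\<close> into
  \<open>2 \<integral>\<integral> \<eta> \<alpha> \<beta> \<le> \<integral>\<integral> q \<alpha>' \<beta> + \<beta> 0 * \<integral> \<eta>0 \<alpha>\<close> (\<open>bump_estimate\<close>). Here \<open>\<alpha>\<close> is a smoothed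
  trapezoid. The derivative of \<open>Q\<close> may be infinite, hence waves need not have bounded speed; but
  \<open>\<bar>q\<bar> \<le> \<epsilon> + C \<eta>\<close> for every \<open>\<epsilon> > 0\<close>, and this suffices to make a ramp of length \<open>M\<close> at distance \<open>M\<close>
  negligible as \<open>M \<rightarrow> \<infinity>\<close>, provided that \<open>\<eta>0\<close> vanishes on its side (\<open>far_field\<close>). Three trapezoids are used:
    \<^item> both ramps far away: a solution stays between \<open>a\<close> and \<open>b\<close> (\<open>maximum_principle\<close>);
    \<^item> plateau on the left half-line: if \<open>Q a\<close> is minimal on \<open>[a, b]\<close>, then \<open>\<bar>u - a\<bar>\<close> has a nonnegative
      flux and vanishes for \<open>x < 0\<close> (\<open>left_half_vanishes\<close>);
    \<^item> plateau on the right half-line and a short ramp on the left of the boundary: if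
      \<open>u = a\<close> for \<open>x < 0\<close>, then the entropy \<open>max 0 (k - u)\<close> enters the right half-line at the rate
      \<open>Q k - Q a\<close>, which therefore cannot be negative (\<open>inflow_nonneg\<close>).

  Existence for \<open>a \<le> b\<close> is by an explicit formula: the profile \<open>v \<xi>\<close> minimizes \<open>Q r - \<xi> * r\<close> over
  \<open>{a..b}\<close> (\<open>minimizing_profile_solution\<close>).
\<close>

section \<open>Test functions and bounded fields\<close>

text \<open>
  The weak inequality \<open>\<eta>\<^sub>t + q\<^sub>x \<le> 0\<close> with initial values \<open>\<eta>0\<close>, detached from the solution that \<open>\<eta>\<close>
  and \<open>q\<close> are functions of, so that half entropies and reflections have the same form as
  Kruzhkov's entropies.
\<close>

definition entropy_ineq ::
  "(real \<Rightarrow> real) \<Rightarrow> (real \<Rightarrow> real \<Rightarrow> real) \<Rightarrow> (real \<Rightarrow> real \<Rightarrow> real) \<Rightarrow> bool" where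
  "entropy_ineq \<eta>0 \<eta> q \<longleftrightarrow>
     (\<forall>\<phi> \<phi>x \<phi>t. test_function \<phi> \<phi>x \<phi>t \<longrightarrow>
        0 \<le> (LINT (x, t) : UNIV \<times> {0<..} | lborel. \<eta> x t * \<phi>t x t + q x t * \<phi>x x t)
             + (LINT x | lborel. \<eta>0 x * \<phi> x 0))"

definition bounded_field :: "(real \<Rightarrow> real \<Rightarrow> real) \<Rightarrow> bool" where
  "bounded_field f \<longleftrightarrow>
     set_borel_measurable lborel (UNIV \<times> {0<..}) (\<lambda>(x, t). f x t) \<and>
     (\<exists>B. \<forall>x. \<forall>t>0. \<bar>f x t\<bar> \<le> B)"

lemma test_function_support:
  assumes "test_function \<phi> \<phi>x \<phi>t"
  shows "\<exists>R>0. \<forall>x t. R \<le> \<bar>x\<bar> \<or> R \<le> \<bar>t\<bar> \<longrightarrow> \<phi> x t = 0 \<and> \<phi>x x t = 0 \<and> \<phi>t x t = 0"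
proof -
  obtain R where R: "\<And>x t. R < \<bar>x\<bar> \<or> R < \<bar>t\<bar> \<Longrightarrow> \<phi> x t = 0"
    using assms unfolding test_function_def by blast
  have dx: "((\<lambda>y. \<phi> y t) has_real_derivative \<phi>x x t) (at x)"
    and dt: "((\<lambda>s. \<phi> x s) has_real_derivative \<phi>t x t) (at t)" for x t
    using assms unfolding test_function_def by auto
  have out: "\<phi>x x t = 0 \<and> \<phi>t x t = 0" if "R < \<bar>x\<bar> \<or> R < \<bar>t\<bar>" for x t
  proof
    have open_out: "open {y::real. R < \<bar>y\<bar>}"
      by (intro open_Collect_less continuous_intros)
    have "\<forall>\<^sub>F y in nhds x. \<phi> y t = 0"
      by (cases "R < \<bar>t\<bar>") (use R that open_out in \<open>auto simp: eventually_nhds intro!: exI[of _ "{y. R < \<bar>y\<bar>}"]\<close>)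
    then have "((\<lambda>y. 0) has_real_derivative \<phi>x x t) (at x)"
      using DERIV_cong_ev[of x x "\<lambda>y. \<phi> y t" "\<lambda>_. 0" "\<phi>x x t" "\<phi>x x t"] dx by auto
    then show "\<phi>x x t = 0" using DERIV_unique DERIV_const by blast
    have "\<forall>\<^sub>F s in nhds t. \<phi> x s = 0"
      by (cases "R < \<bar>x\<bar>") (use R that open_out in \<open>auto simp: eventually_nhds intro!: exI[of _ "{y. R < \<bar>y\<bar>}"]\<close>)
    then have "((\<lambda>y. 0) has_real_derivative \<phi>t x t) (at t)"
      using DERIV_cong_ev[of t t "\<lambda>y. \<phi> x y" "\<lambda>_. 0" "\<phi>t x t" "\<phi>t x t"] dt by auto
    then show "\<phi>t x t = 0" using DERIV_unique DERIV_const by blast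
  qed
  show ?thesis
  proof (intro exI[of _ "\<bar>R\<bar> + 1"] conjI allI impI)
    fix x t assume "\<bar>R\<bar> + 1 \<le> \<bar>x\<bar> \<or> \<bar>R\<bar> + 1 \<le> \<bar>t\<bar>"
    then have "R < \<bar>x\<bar> \<or> R < \<bar>t\<bar>" by linarith
    then show "\<phi> x t = 0" "\<phi>x x t = 0" "\<phi>t x t = 0" using R out by blast+
  qed simp
qed

text \<open>
  Partial derivatives that are continuous give total differentiability. This yields joint continuity and the
  chain rule along the rays \<open>x = t * \<xi>\<close>.
\<close>

lemma test_function_has_derivative:
  assumes "test_function \<phi> \<phi>x \<phi>t"
  shows "((\<lambda>(x, t). \<phi> x t) has_derivative (\<lambda>(h, s). \<phi>x x t * h + \<phi>t x t * s)) (at (x, t))"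
proof -
  have dx: "((\<lambda>y. \<phi> y t) has_real_derivative \<phi>x x t) (at x)"
    and dt: "((\<lambda>s. \<phi> x s) has_real_derivative \<phi>t x t) (at t)"
    and ct: "continuous_on UNIV (\<lambda>(x, t). \<phi>t x t)" for x t
    using assms unfolding test_function_def by auto
  have "((\<lambda>(x, t). \<phi> x t) has_derivative
      (\<lambda>(h, s). \<phi>x x t * h + blinfun_apply (blinfun_scaleR_left (\<phi>t x t)) s)) (at (x, t) within UNIV \<times> UNIV)"
  proof (rule has_derivative_partialsI[where fy = "\<lambda>x t. blinfun_scaleR_left (\<phi>t x t)"])
    show "((\<lambda>x. \<phi> x t) has_derivative (*) (\<phi>x x t)) (at x)"
      using dx[of t x] by (simp add: has_field_derivative_def)
    show "((\<lambda>y. \<phi> x' y) has_derivative blinfun_apply (blinfun_scaleR_left (\<phi>t x' t'))) (at t')" for x' t'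
      using dt[of x' t'] by (simp add: has_field_derivative_def mult.commute[of _ "\<phi>t x' t'"] fun_eq_iff)
    have "isCont (\<lambda>z. blinfun_scaleR_left (case z of (x, t) \<Rightarrow> \<phi>t x t)) (x, t)"
      by (intro bounded_linear.isCont[OF bounded_linear_blinfun_scaleR_left])
        (use ct in \<open>auto simp: continuous_on_eq_continuous_at\<close>)
    then show "continuous (at (x, t) within UNIV \<times> UNIV) (\<lambda>(x, t). blinfun_scaleR_left (\<phi>t x t))"
      by (simp add: case_prod_unfold)
  qed auto
  then show ?thesis by (simp add: mult.commute)
qed

lemma test_function_continuous:
  assumes "test_function \<phi> \<phi>x \<phi>t"
  shows "continuous_on UNIV (\<lambda>(x, t). \<phi> x t)"
proof -
  have "isCont (\<lambda>(x, t). \<phi> x t) z" for z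
    using has_derivative_continuous[OF test_function_has_derivative[OF assms, of "fst z" "snd z"]]
    by (simp add: case_prod_unfold)
  then show ?thesis by (simp add: continuous_on_eq_continuous_at)
qed

lemma bounded_of_compact_support:
  fixes f :: "real \<Rightarrow> real \<Rightarrow> real"
  assumes "continuous_on UNIV (\<lambda>(x, t). f x t)"
    and "\<And>x t. R \<le> \<bar>x\<bar> \<or> R \<le> \<bar>t\<bar> \<Longrightarrow> f x t = 0"
  shows "\<exists>B. \<forall>x t. \<bar>f x t\<bar> \<le> B"
proof -
  have "compact ((\<lambda>(x, t). f x t) ` ({-\<bar>R\<bar>..\<bar>R\<bar>} \<times> {-\<bar>R\<bar>..\<bar>R\<bar>}))"
    by (intro compact_continuous_image continuous_on_subset[OF assms(1)] compact_Times) auto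
  from compact_imp_bounded[OF this]
  obtain B where B: "\<And>z. z \<in> {-\<bar>R\<bar>..\<bar>R\<bar>} \<times> {-\<bar>R\<bar>..\<bar>R\<bar>} \<Longrightarrow> \<bar>case z of (x, t) \<Rightarrow> f x t\<bar> \<le> B"
    unfolding bounded_real by blast
  have "\<bar>f x t\<bar> \<le> \<bar>B\<bar>" for x t
  proof (cases "R \<le> \<bar>x\<bar> \<or> R \<le> \<bar>t\<bar>")
    case True
    then show ?thesis using assms(2)[OF True] by simp
  next
    case False
    then have "(x, t) \<in> {-\<bar>R\<bar>..\<bar>R\<bar>} \<times> {-\<bar>R\<bar>..\<bar>R\<bar>}" by auto
    from B[OF this] have "\<bar>f x t\<bar> \<le> B" by simp
    then show ?thesis by linarith
  qed
  then show ?thesis by blast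
qed

lemma test_function_bounded:
  assumes tf: "test_function \<phi> \<phi>x \<phi>t"
  shows "\<exists>B. \<forall>x t. \<bar>\<phi> x t\<bar> \<le> B \<and> \<bar>\<phi>x x t\<bar> \<le> B \<and> \<bar>\<phi>t x t\<bar> \<le> B"
proof -
  obtain R where R: "\<And>x t. R \<le> \<bar>x\<bar> \<or> R \<le> \<bar>t\<bar> \<Longrightarrow> \<phi> x t = 0 \<and> \<phi>x x t = 0 \<and> \<phi>t x t = 0"
    using test_function_support[OF tf] by metis
  have c: "continuous_on UNIV (\<lambda>(x, t). \<phi>x x t)" "continuous_on UNIV (\<lambda>(x, t). \<phi>t x t)"
    using tf unfolding test_function_def by auto
  obtain B1 where "\<And>x t. \<bar>\<phi> x t\<bar> \<le> B1"
    using bounded_of_compact_support[OF test_function_continuous[OF tf], of R] R by blast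
  moreover obtain B2 where "\<And>x t. \<bar>\<phi>x x t\<bar> \<le> B2"
    using bounded_of_compact_support[OF c(1), of R] R by blast
  moreover obtain B3 where "\<And>x t. \<bar>\<phi>t x t\<bar> \<le> B3"
    using bounded_of_compact_support[OF c(2), of R] R by blast
  ultimately show ?thesis
    by (intro exI[of _ "max B1 (max B2 B3)"]) (simp add: le_max_iff_disj)
qed

lemma test_function_measurable:
  assumes tf: "test_function \<phi> \<phi>x \<phi>t"
  shows "(\<lambda>(x, t). \<phi> x t) \<in> borel_measurable borel" "(\<lambda>(x, t). \<phi>x x t) \<in> borel_measurable borel"
    "(\<lambda>(x, t). \<phi>t x t) \<in> borel_measurable borel"
proof -
  have "continuous_on UNIV (\<lambda>(x, t). \<phi>x x t)" "continuous_on UNIV (\<lambda>(x, t). \<phi>t x t)"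
    using tf unfolding test_function_def by blast+
  with test_function_continuous[OF tf]
  show "(\<lambda>(x, t). \<phi> x t) \<in> borel_measurable borel" "(\<lambda>(x, t). \<phi>x x t) \<in> borel_measurable borel"
    "(\<lambda>(x, t). \<phi>t x t) \<in> borel_measurable borel"
    by (simp_all add: borel_measurable_continuous_onI)
qed

lemma emeasure_lborel_rectangle_finite: "emeasure lborel ({a..b} \<times> {c..d} :: (real \<times> real) set) < \<infinity>"
proof -
  have "({a..b} \<times> {c..d} :: (real \<times> real) set) = cbox (a, c) (b, d)"
    by (simp only: cbox_Pair_eq box_real)
  then show ?thesis by (simp only: emeasure_lborel_cbox_finite)
qed

lemma set_integrable_field_mult:
  assumes "bounded_field f" and g: "(\<lambda>(x, t). g x t) \<in> borel_measurable borel"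
    and gb: "\<And>x t. \<bar>g x t\<bar> \<le> B"
    and gs: "\<And>x t. R \<le> \<bar>x\<bar> \<or> R \<le> \<bar>t\<bar> \<Longrightarrow> g x t = 0"
  shows "set_integrable lborel (UNIV \<times> {0<..}) (\<lambda>(x, t). f x t * g x t)"
proof -
  obtain C where C: "\<And>x t. t > 0 \<Longrightarrow> \<bar>f x t\<bar> \<le> C"
    using assms(1) unfolding bounded_field_def by blast
  have fm: "(\<lambda>z. indicat_real (UNIV \<times> {0<..}) z * (case z of (x, t) \<Rightarrow> f x t)) \<in> borel_measurable borel"
    using assms(1) by (simp add: bounded_field_def set_borel_measurable_def)
  have gm: "(\<lambda>z. case z of (x, t) \<Rightarrow> g x t) \<in> borel_measurable borel" by fact
  have "integrable lborel (\<lambda>z. (indicat_real (UNIV \<times> {0<..}) z * (case z of (x, t) \<Rightarrow> f x t)) * (case z of (x, t) \<Rightarrow> g x t))"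
  proof (rule integrableI_bounded_set[where A = "{-R..R} \<times> {-R..R}" and B = "\<bar>C\<bar> * \<bar>B\<bar>"])
    show "(\<lambda>z. (indicat_real (UNIV \<times> {0<..}) z * (case z of (x, t) \<Rightarrow> f x t)) * (case z of (x, t) \<Rightarrow> g x t))
        \<in> borel_measurable lborel"
      using borel_measurable_times[OF fm gm] by simp
    have "\<bar>(indicat_real (UNIV \<times> {0<..}) z * (case z of (x, t) \<Rightarrow> f x t)) * (case z of (x, t) \<Rightarrow> g x t)\<bar> \<le> \<bar>C\<bar> * \<bar>B\<bar>" for z
    proof -
      obtain x t where z: "z = (x, t)" by force
      have "\<bar>g x t\<bar> \<le> \<bar>B\<bar>" using gb[of x t] by linarith
      moreover have "\<bar>f x t\<bar> \<le> \<bar>C\<bar>" if "t > 0" using C[OF that, of x] by linarith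
      ultimately show ?thesis by (auto simp: z abs_mult indicator_def intro: mult_mono)
    qed
    then show "AE z in lborel. z \<in> {-R..R} \<times> {-R..R} \<longrightarrow>
        norm ((indicat_real (UNIV \<times> {0<..}) z * (case z of (x, t) \<Rightarrow> f x t)) * (case z of (x, t) \<Rightarrow> g x t)) \<le> \<bar>C\<bar> * \<bar>B\<bar>"
      by simp
    have "g x t = 0" if "(x, t) \<notin> {-R..R} \<times> {-R..R}" for x t
      by (rule gs) (use that in auto)
    then show "AE z in lborel. z \<notin> {-R..R} \<times> {-R..R} \<longrightarrow>
        (indicat_real (UNIV \<times> {0<..}) z * (case z of (x, t) \<Rightarrow> f x t)) * (case z of (x, t) \<Rightarrow> g x t) = 0"
      by (intro AE_I2) (auto split: prod.split)
  qed (use emeasure_lborel_rectangle_finite in \<open>auto simp: borel_closed closed_Times\<close>)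
  then show ?thesis
    unfolding set_integrable_def by (simp add: case_prod_unfold mult_ac)
qed

lemma set_integrable_test_function:
  assumes "bounded_field f" and tf: "test_function \<phi> \<phi>x \<phi>t"
  shows "set_integrable lborel (UNIV \<times> {0<..}) (\<lambda>(x, t). f x t * \<phi>x x t)"
    and "set_integrable lborel (UNIV \<times> {0<..}) (\<lambda>(x, t). f x t * \<phi>t x t)"
proof -
  obtain R where R: "\<And>x t. R \<le> \<bar>x\<bar> \<or> R \<le> \<bar>t\<bar> \<Longrightarrow> \<phi> x t = 0 \<and> \<phi>x x t = 0 \<and> \<phi>t x t = 0"
    using test_function_support[OF tf] by metis
  obtain B where B: "\<And>x t. \<bar>\<phi> x t\<bar> \<le> B" "\<And>x t. \<bar>\<phi>x x t\<bar> \<le> B" "\<And>x t. \<bar>\<phi>t x t\<bar> \<le> B"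
    using test_function_bounded[OF tf] by metis
  note m = test_function_measurable[OF tf]
  show "set_integrable lborel (UNIV \<times> {0<..}) (\<lambda>(x, t). f x t * \<phi>x x t)"
    by (rule set_integrable_field_mult[OF assms(1) m(2) B(2)]) (use R in blast)
  show "set_integrable lborel (UNIV \<times> {0<..}) (\<lambda>(x, t). f x t * \<phi>t x t)"
    by (rule set_integrable_field_mult[OF assms(1) m(3) B(3)]) (use R in blast)
qed

lemma integrable_test_function_initial:
  assumes "f \<in> borel_measurable borel" "\<And>x. \<bar>f x\<bar> \<le> C" and tf: "test_function \<phi> \<phi>x \<phi>t"
  shows "integrable lborel (\<lambda>x. f x * \<phi> x t)"
proof -
  obtain R where R: "\<And>x t. R \<le> \<bar>x\<bar> \<or> R \<le> \<bar>t\<bar> \<Longrightarrow> \<phi> x t = 0 \<and> \<phi>x x t = 0 \<and> \<phi>t x t = 0"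
    using test_function_support[OF tf] by metis
  obtain B where B: "\<And>x t. \<bar>\<phi> x t\<bar> \<le> B"
    using test_function_bounded[OF tf] by metis
  have m: "(\<lambda>x. \<phi> x t) \<in> borel_measurable borel"
    using measurable_compose[OF _ test_function_measurable(1)[OF tf], of "\<lambda>x. (x, t)" borel] by simp
  show ?thesis
  proof (rule integrableI_bounded_set[where A = "{-R..R}" and B = "C * B"])
    show "AE x in lborel. x \<in> {-R..R} \<longrightarrow> norm (f x * \<phi> x t) \<le> C * B"
      using assms(2) B by (auto simp: abs_mult intro!: mult_mono order.trans[OF abs_ge_zero])
    show "AE x in lborel. x \<notin> {-R..R} \<longrightarrow> f x * \<phi> x t = 0" using R by (intro AE_I2) force
    show "emeasure lborel {-R..R} < \<infinity>"
      using emeasure_lborel_cbox_finite[of "-R" R] by simp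
  qed (use assms(1) m in auto)
qed

lemma set_Times_Fubini:
  fixes f :: "real \<Rightarrow> real \<Rightarrow> real"
  assumes "set_integrable lborel (UNIV \<times> T) (\<lambda>(x, t). f x t)"
  shows "(LINT (x, t) : UNIV \<times> T | lborel. f x t) = (LINT x | lborel. (LINT t : T | lborel. f x t))"
    and "(LINT (x, t) : UNIV \<times> T | lborel. f x t) = (LINT t : T | lborel. (LINT x | lborel. f x t))"
    and "set_integrable lborel T (\<lambda>t. LINT x | lborel. f x t)"
proof -
  have i: "integrable (lborel \<Otimes>\<^sub>M lborel) (\<lambda>(x, t). indicat_real T t * f x t)"
    using assms unfolding set_integrable_def lborel_prod
    by (rule Bochner_Integration.integrable_cong[THEN iffD1, rotated -1]) (auto simp: indicator_def)
  have e: "(LINT (x, t) : UNIV \<times> T | lborel. f x t)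
      = integral\<^sup>L (lborel \<Otimes>\<^sub>M lborel) (\<lambda>(x, t). indicat_real T t * f x t)"
    unfolding set_lebesgue_integral_def lborel_prod
    by (rule Bochner_Integration.integral_cong) (auto simp: indicator_def)
  show "(LINT (x, t) : UNIV \<times> T | lborel. f x t) = (LINT x | lborel. (LINT t : T | lborel. f x t))"
    unfolding e lborel_pair.integral_fst[OF i, symmetric] by (simp add: set_lebesgue_integral_def)
  show "(LINT (x, t) : UNIV \<times> T | lborel. f x t) = (LINT t : T | lborel. (LINT x | lborel. f x t))"
    unfolding e lborel_pair.integral_snd[OF i, symmetric] by (simp add: set_lebesgue_integral_def)
  show "set_integrable lborel T (\<lambda>t. LINT x | lborel. f x t)"
    using lborel_pair.integrable_snd[OF i] by (simp add: set_integrable_def)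
qed

lemma integral_derivative_half_line:
  fixes F f :: "real \<Rightarrow> real"
  assumes F: "\<And>t. (F has_real_derivative f t) (at t)" and f: "continuous_on UNIV f"
    and 0: "\<And>t. R \<le> t \<Longrightarrow> F t = 0" "\<And>t. R \<le> t \<Longrightarrow> f t = 0"
  shows "(LINT t : {c<..} | lborel. f t) = - F c"
proof -
  define M where "M = max c R"
  have "(LINT t : {c<..} | lborel. f t) = integral\<^sup>L lborel (\<lambda>t. indicator {c..M} t *\<^sub>R f t)"
    unfolding set_lebesgue_integral_def
  proof (rule integral_cong_AE)
    have "f \<in> borel_measurable borel" by (rule borel_measurable_continuous_onI[OF f])
    then show "(\<lambda>t. indicat_real {c<..} t *\<^sub>R f t) \<in> borel_measurable lborel"
      "(\<lambda>t. indicat_real {c..M} t *\<^sub>R f t) \<in> borel_measurable lborel" by simp_all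
    have "AE t in lborel. t \<noteq> c" by (rule AE_lborel_singleton)
    then show "AE t in lborel. indicat_real {c<..} t *\<^sub>R f t = indicat_real {c..M} t *\<^sub>R f t"
      by eventually_elim (auto simp: indicator_def M_def 0(2))
  qed
  also have "\<dots> = F M - F c"
    by (rule integral_FTC_atLeastAtMost)
      (auto simp: M_def has_real_derivative_iff_has_vector_derivative[symmetric]
        intro: has_field_derivative_at_within F continuous_on_subset[OF f])
  also have "F M = 0" by (rule 0) (simp add: M_def)
  finally show ?thesis by simp
qed

lemma integral_derivative_compact_support:
  fixes F f :: "real \<Rightarrow> real"
  assumes F: "\<And>t. (F has_real_derivative f t) (at t)" and f: "continuous_on UNIV f"
    and 0: "\<And>t. R \<le> \<bar>t\<bar> \<Longrightarrow> F t = 0" "\<And>t. R \<le> \<bar>t\<bar> \<Longrightarrow> f t = 0"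
  shows "(LINT t | lborel. f t) = 0"
proof -
  define c where "c = - \<bar>R\<bar> - 1"
  have "(LINT t | lborel. f t) = (LINT t : {c<..} | lborel. f t)"
    unfolding set_lebesgue_integral_def
    by (rule Bochner_Integration.integral_cong) (auto simp: indicator_def c_def intro!: 0(2))
  also have "\<dots> = - F c"
    by (rule integral_derivative_half_line[OF F f, of "\<bar>R\<bar>"]) (rule 0, linarith)+
  also have "F c = 0" by (rule 0) (auto simp: c_def)
  finally show ?thesis by simp
qed

lemma bounded_field_const: "bounded_field (\<lambda>x t. c)"
proof -
  have "UNIV \<times> {0<..} \<in> sets (borel :: (real \<times> real) measure)"
    by (intro borel_open open_Times) auto
  then show ?thesis
    unfolding bounded_field_def set_borel_measurable_def by (auto intro!: exI[of _ "\<bar>c\<bar>"])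
qed

lemma test_function_integral_dt:
  assumes tf: "test_function \<phi> \<phi>x \<phi>t"
  shows "(LINT (x, t) : UNIV \<times> {0<..} | lborel. \<phi>t x t) = - (LINT x | lborel. \<phi> x 0)"
proof -
  have d: "((\<lambda>s. \<phi> x s) has_real_derivative \<phi>t x t) (at t)"
    and c: "continuous_on UNIV (\<lambda>(x, t). \<phi>t x t)" for x t
    using tf unfolding test_function_def by blast+
  obtain R where R: "\<And>x t. R \<le> \<bar>x\<bar> \<or> R \<le> \<bar>t\<bar> \<Longrightarrow> \<phi> x t = 0 \<and> \<phi>x x t = 0 \<and> \<phi>t x t = 0"
    using test_function_support[OF tf] by metis
  have cx: "continuous_on UNIV (\<phi>t x)" for x
    using continuous_on_compose2[OF c, of UNIV "\<lambda>t. (x, t)"] by (simp add: continuous_on_Pair)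
  have "(LINT (x, t) : UNIV \<times> {0<..} | lborel. \<phi>t x t) = (LINT x | lborel. (LINT t : {0<..} | lborel. \<phi>t x t))"
    using set_integrable_test_function(2)[OF bounded_field_const[of 1] tf]
    by (intro set_Times_Fubini) simp
  moreover have "(LINT t : {0<..} | lborel. \<phi>t x t) = - \<phi> x 0" for x
    by (rule integral_derivative_half_line[OF d cx, of "\<bar>R\<bar>"]) (use R[of x] in force)+
  ultimately show ?thesis by simp
qed

lemma test_function_integral_dx:
  assumes tf: "test_function \<phi> \<phi>x \<phi>t"
  shows "(LINT (x, t) : UNIV \<times> {0<..} | lborel. \<phi>x x t) = 0"
proof -
  have d: "((\<lambda>y. \<phi> y t) has_real_derivative \<phi>x x t) (at x)"
    and c: "continuous_on UNIV (\<lambda>(x, t). \<phi>x x t)" for x t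
    using tf unfolding test_function_def by blast+
  obtain R where R: "\<And>x t. R \<le> \<bar>x\<bar> \<or> R \<le> \<bar>t\<bar> \<Longrightarrow> \<phi> x t = 0 \<and> \<phi>x x t = 0 \<and> \<phi>t x t = 0"
    using test_function_support[OF tf] by metis
  have cx: "continuous_on UNIV (\<lambda>x. \<phi>x x t)" for t
    using continuous_on_compose2[OF c, of UNIV "\<lambda>x. (x, t)"] by (simp add: continuous_on_Pair)
  have "(LINT (x, t) : UNIV \<times> {0<..} | lborel. \<phi>x x t) = (LINT t : {0<..} | lborel. (LINT x | lborel. \<phi>x x t))"
    using set_integrable_test_function(1)[OF bounded_field_const[of 1] tf]
    by (intro set_Times_Fubini) simp
  moreover have "(LINT x | lborel. \<phi>x x t) = 0" for t
    by (rule integral_derivative_compact_support[OF d cx, of R]) (use R in blast)+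
  ultimately show ?thesis by simp
qed

lemma bounded_field_compose:
  fixes g :: "real \<Rightarrow> real"
  assumes u: "set_borel_measurable lborel (UNIV \<times> {0<..}) (\<lambda>(x, t). u x t)"
    and ran: "\<And>x t. t > 0 \<Longrightarrow> u x t \<in> S"
    and g: "g \<in> borel_measurable (restrict_space borel S)" and S: "S \<in> sets borel"
    and B: "\<And>r. r \<in> S \<Longrightarrow> \<bar>g r\<bar> \<le> B"
  shows "bounded_field (\<lambda>x t. g (u x t))"
proof -
  let ?H = "UNIV \<times> {0<..} :: (real \<times> real) set"
  have H: "?H \<inter> space lborel \<in> sets lborel" by (auto intro!: borel_open open_Times)
  have "(\<lambda>(x, t). u x t) \<in> borel_measurable (restrict_space lborel ?H)"
    using u borel_measurable_restrict_space_iff[OF H] unfolding set_borel_measurable_def by blast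
  then have "(\<lambda>(x, t). u x t) \<in> measurable (restrict_space lborel ?H) (restrict_space borel S)"
    by (rule measurable_restrict_space2[rotated]) (auto simp: space_restrict_space ran)
  from measurable_compose[OF this g]
  have "(\<lambda>(x, t). g (u x t)) \<in> borel_measurable (restrict_space lborel ?H)"
    by (simp add: case_prod_unfold)
  then have "set_borel_measurable lborel ?H (\<lambda>(x, t). g (u x t))"
    using borel_measurable_restrict_space_iff[OF H] unfolding set_borel_measurable_def by blast
  moreover have "\<forall>x. \<forall>t>0. \<bar>g (u x t)\<bar> \<le> B" using B ran by blast
  ultimately show ?thesis unfolding bounded_field_def by blast
qed

section \<open>Half entropies\<close>

lemma continuous_flux_bounded:
  fixes Q :: "real \<Rightarrow> real"
  assumes "continuous_on {0..rj} Q"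
  shows "\<exists>M\<ge>0. \<forall>r\<in>{0..rj}. \<bar>Q r\<bar> \<le> M"
proof -
  have "bounded (Q ` {0..rj})" by (rule compact_imp_bounded[OF compact_continuous_image[OF assms compact_Icc]])
  then obtain B where "\<forall>y\<in>Q ` {0..rj}. \<bar>y\<bar> \<le> B" unfolding bounded_real by blast
  then have "\<bar>Q r\<bar> \<le> \<bar>B\<bar>" if "r \<in> {0..rj}" for r
    using that by (smt (verit, best) imageI)
  then show ?thesis by (intro exI[of _ "\<bar>B\<bar>"]) simp
qed

lemma entropy_solution_fields:
  fixes Q :: "real \<Rightarrow> real"
  assumes Q: "continuous_on {0..rj} Q" and sol: "entropy_solution Q rj u0 u" and k: "k \<in> {0..rj}"
  shows "bounded_field (\<lambda>x t. \<bar>u x t - k\<bar>)"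
    and "bounded_field (\<lambda>x t. sgn (u x t - k) * (Q (u x t) - Q k))"
    and "bounded_field (\<lambda>x t. max 0 (u x t - k))"
    and "bounded_field (\<lambda>x t. if k < u x t then Q (u x t) - Q k else 0)"
    and "bounded_field (\<lambda>x t. max 0 (k - u x t))"
    and "bounded_field (\<lambda>x t. if u x t < k then Q k - Q (u x t) else 0)"
proof -
  have u: "set_borel_measurable lborel (UNIV \<times> {0<..}) (\<lambda>(x, t). u x t)"
    and ran: "\<And>x t. t > 0 \<Longrightarrow> u x t \<in> {0..rj}"
    using sol unfolding entropy_solution_def by blast+
  obtain M where M: "M \<ge> 0" "\<And>r. r \<in> {0..rj} \<Longrightarrow> \<bar>Q r\<bar> \<le> M"
    using continuous_flux_bounded[OF Q] by blast
  have Qm [measurable]: "Q \<in> borel_measurable (restrict_space borel {0..rj})"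
    using borel_measurable_continuous_on_restrict[OF Q] .
  have id [measurable]: "(\<lambda>r::real. r) \<in> borel_measurable (restrict_space borel {0..rj})"
    by (rule measurable_restrict_space1) simp
  note comp = bounded_field_compose[OF u ran]
  show "bounded_field (\<lambda>x t. \<bar>u x t - k\<bar>)"
    by (rule comp[where g = "\<lambda>r. \<bar>r - k\<bar>" and B = rj]) (use k in auto)
  have "\<bar>Q r - Q k\<bar> \<le> 2 * M" if "r \<in> {0..rj}" for r using M(2)[OF that] M(2)[OF k] by linarith
  note d = this
  show "bounded_field (\<lambda>x t. sgn (u x t - k) * (Q (u x t) - Q k))"
    by (rule comp[where g = "\<lambda>r. sgn (r - k) * (Q r - Q k)" and B = "2 * M"])
      (use d M(1) in \<open>auto simp: sgn_if abs_minus_commute\<close>)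
  show "bounded_field (\<lambda>x t. if k < u x t then Q (u x t) - Q k else 0)"
    by (rule comp[where g = "\<lambda>r. if k < r then Q r - Q k else 0" and B = "2 * M"]) (use d M(1) in auto)
  show "bounded_field (\<lambda>x t. if u x t < k then Q k - Q (u x t) else 0)"
    by (rule comp[where g = "\<lambda>r. if r < k then Q k - Q r else 0" and B = "2 * M"])
      (use d M(1) in \<open>auto simp: abs_minus_commute\<close>)
  show "bounded_field (\<lambda>x t. max 0 (u x t - k))"
    by (rule comp[where g = "\<lambda>r. max 0 (r - k)" and B = rj]) (use k in auto)
  show "bounded_field (\<lambda>x t. max 0 (k - u x t))"
    by (rule comp[where g = "\<lambda>r. max 0 (k - r)" and B = rj]) (use k in auto)
qed

text \<open>
  Constants satisfy the weak equation with equality. They may therefore be subtracted from a sum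
  of two entropy inequalities before it is halved.
\<close>

lemma half_entropy_ineq:
  assumes e1: "entropy_ineq \<eta>1 \<eta> q" and e2: "entropy_ineq \<zeta>1 \<zeta> r"
    and f: "bounded_field \<eta>" "bounded_field q" "bounded_field \<zeta>" "bounded_field r"
      "bounded_field \<theta>" "bounded_field s"
    and m: "\<eta>1 \<in> borel_measurable borel" "\<And>x. \<bar>\<eta>1 x\<bar> \<le> B" "\<zeta>1 \<in> borel_measurable borel" "\<And>x. \<bar>\<zeta>1 x\<bar> \<le> B"
      "\<theta>1 \<in> borel_measurable borel" "\<And>x. \<bar>\<theta>1 x\<bar> \<le> B"
    and sum: "\<And>x t. t > 0 \<Longrightarrow> \<eta> x t + \<zeta> x t = 2 * \<theta> x t + c"
      "\<And>x t. t > 0 \<Longrightarrow> q x t + r x t = 2 * s x t + d"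
      "\<And>x. \<eta>1 x + \<zeta>1 x = 2 * \<theta>1 x + c"
  shows "entropy_ineq \<theta>1 \<theta> s"
  unfolding entropy_ineq_def
proof (intro allI impI)
  fix \<phi> \<phi>x \<phi>t assume tf: "test_function \<phi> \<phi>x \<phi>t"
  let ?H = "UNIV \<times> {0<..} :: (real \<times> real) set"
  let ?I = "\<lambda>a b. LINT (x, t) : ?H | lborel. a x t * \<phi>t x t + b x t * \<phi>x x t"
  let ?J = "\<lambda>a. LINT x | lborel. a x * \<phi> x 0"
  have int: "set_integrable lborel ?H (\<lambda>(x, t). a x t * \<phi>t x t + b x t * \<phi>x x t)"
    if "bounded_field a" "bounded_field b" for a b
    using set_integral_add(1)[OF set_integrable_test_function(2)[OF that(1) tf] set_integrable_test_function(1)[OF that(2) tf]]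
    by (simp add: case_prod_unfold)
  have H: "?H \<in> sets lborel" by (auto intro!: borel_open open_Times)
  have "?I \<eta> q + ?I \<zeta> r = (LINT z : ?H | lborel.
      (case z of (x, t) \<Rightarrow> \<eta> x t * \<phi>t x t + q x t * \<phi>x x t) + (case z of (x, t) \<Rightarrow> \<zeta> x t * \<phi>t x t + r x t * \<phi>x x t))"
    by (rule set_integral_add(2)[symmetric, OF int int]) (rule f)+
  also have "\<dots> = (LINT z : ?H | lborel.
      (case z of (x, t) \<Rightarrow> 2 *\<^sub>R (\<theta> x t * \<phi>t x t + s x t * \<phi>x x t)) + (case z of (x, t) \<Rightarrow> c * \<phi>t x t + d * \<phi>x x t))"
  proof (rule set_lebesgue_integral_cong[OF H], rule allI, rule impI)
    fix z assume "z \<in> ?H"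
    then obtain x t where z: "z = (x, t)" and t: "t > 0" by auto
    have "\<eta> x t * \<phi>t x t + q x t * \<phi>x x t + (\<zeta> x t * \<phi>t x t + r x t * \<phi>x x t)
        = (\<eta> x t + \<zeta> x t) * \<phi>t x t + (q x t + r x t) * \<phi>x x t" by (simp add: algebra_simps)
    also have "\<dots> = 2 *\<^sub>R (\<theta> x t * \<phi>t x t + s x t * \<phi>x x t) + (c * \<phi>t x t + d * \<phi>x x t)"
      using t by (simp add: sum algebra_simps)
    finally show "(case z of (x, t) \<Rightarrow> \<eta> x t * \<phi>t x t + q x t * \<phi>x x t)
          + (case z of (x, t) \<Rightarrow> \<zeta> x t * \<phi>t x t + r x t * \<phi>x x t)
        = (case z of (x, t) \<Rightarrow> 2 *\<^sub>R (\<theta> x t * \<phi>t x t + s x t * \<phi>x x t))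
          + (case z of (x, t) \<Rightarrow> c * \<phi>t x t + d * \<phi>x x t)"
      by (simp only: z prod.case)
  qed
  also have "\<dots> = (LINT z : ?H | lborel. (case z of (x, t) \<Rightarrow> 2 *\<^sub>R (\<theta> x t * \<phi>t x t + s x t * \<phi>x x t))) + ?I (\<lambda>x t. c) (\<lambda>x t. d)"
  proof (rule set_integral_add(2))
    show "set_integrable lborel ?H (\<lambda>z. case z of (x, t) \<Rightarrow> 2 *\<^sub>R (\<theta> x t * \<phi>t x t + s x t * \<phi>x x t))"
      using set_integrable_scaleR_right[OF int[OF f(5,6)], of 2] by (simp add: case_prod_unfold)
  qed (rule int[OF bounded_field_const bounded_field_const])
  also have "(LINT z : ?H | lborel. (case z of (x, t) \<Rightarrow> 2 *\<^sub>R (\<theta> x t * \<phi>t x t + s x t * \<phi>x x t))) = 2 * ?I \<theta> s"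
    using set_integral_scaleR_right[of lborel ?H 2 "\<lambda>(x, t). \<theta> x t * \<phi>t x t + s x t * \<phi>x x t"]
    by (simp add: case_prod_unfold)
  also have "?I (\<lambda>x t. c) (\<lambda>x t. d) = c * (LINT (x, t) : ?H | lborel. \<phi>t x t) + d * (LINT (x, t) : ?H | lborel. \<phi>x x t)"
    using set_integral_add(2)[OF set_integrable_test_function(2)[OF bounded_field_const tf] set_integrable_test_function(1)[OF bounded_field_const tf], of c d]
    by (simp add: case_prod_unfold)
  also have "\<dots> = - c * (LINT x | lborel. \<phi> x 0)"
    by (simp add: test_function_integral_dt[OF tf] test_function_integral_dx[OF tf])
  finally have I: "?I \<eta> q + ?I \<zeta> r = 2 * ?I \<theta> s - c * (LINT x | lborel. \<phi> x 0)" by simp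
  have ini: "integrable lborel (\<lambda>x. \<eta>1 x * \<phi> x 0)" "integrable lborel (\<lambda>x. \<zeta>1 x * \<phi> x 0)"
    "integrable lborel (\<lambda>x. \<theta>1 x * \<phi> x 0)" "integrable lborel (\<lambda>x. c * \<phi> x 0)"
    using integrable_test_function_initial[OF m(1,2) tf] integrable_test_function_initial[OF m(3,4) tf]
      integrable_test_function_initial[OF m(5,6) tf] integrable_test_function_initial[of "\<lambda>_. c" "\<bar>c\<bar>", OF _ _ tf]
    by simp_all
  have "?J \<eta>1 + ?J \<zeta>1 = (LINT x | lborel. (\<eta>1 x + \<zeta>1 x) * \<phi> x 0)"
    using ini by (simp add: distrib_right)
  also have "\<dots> = (LINT x | lborel. 2 * (\<theta>1 x * \<phi> x 0) + c * \<phi> x 0)"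
    by (simp add: sum distrib_right mult.assoc)
  also have "\<dots> = 2 * ?J \<theta>1 + c * (LINT x | lborel. \<phi> x 0)"
    using ini(3,4) by simp
  finally have J: "?J \<eta>1 + ?J \<zeta>1 = 2 * ?J \<theta>1 + c * (LINT x | lborel. \<phi> x 0)" .
  have "0 \<le> ?I \<eta> q + ?J \<eta>1" "0 \<le> ?I \<zeta> r + ?J \<zeta>1"
    using e1 e2 tf unfolding entropy_ineq_def by blast+
  with I J show "0 \<le> ?I \<theta> s + ?J \<theta>1" by linarith
qed

lemma entropy_solution_Kruzhkov:
  assumes "entropy_solution Q rj u0 u" "k \<in> {0..rj}"
  shows "entropy_ineq (\<lambda>x. \<bar>u0 x - k\<bar>) (\<lambda>x t. \<bar>u x t - k\<bar>) (\<lambda>x t. sgn (u x t - k) * (Q (u x t) - Q k))"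
  using assms unfolding entropy_solution_def entropy_ineq_def by blast

text \<open>
  On \<open>{0..rj}\<close> one has \<open>\<bar>u - k\<bar> + \<bar>u - 0\<bar> = 2 * max 0 (u - k) + k\<close> and
  \<open>\<bar>u - k\<bar> + \<bar>u - rj\<bar> = 2 * max 0 (k - u) + (rj - k)\<close>, so that the one-sided entropies are
  half of a sum of two of Kruzhkov's, up to constants. Unlike \<open>\<bar>u - k\<bar>\<close> they
  can vanish for both initial states at once.
\<close>

lemma half_entropies:
  assumes Q: "continuous_on {0..rj} Q" and sol: "entropy_solution Q rj u0 u" and k: "k \<in> {0..rj}"
    and u0: "u0 \<in> borel_measurable borel" "\<And>x. u0 x \<in> {0..rj}"
  shows "entropy_ineq (\<lambda>x. max 0 (u0 x - k)) (\<lambda>x t. max 0 (u x t - k))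
      (\<lambda>x t. if k < u x t then Q (u x t) - Q k else 0)" (is ?upper)
    and "entropy_ineq (\<lambda>x. max 0 (k - u0 x)) (\<lambda>x t. max 0 (k - u x t))
      (\<lambda>x t. if u x t < k then Q k - Q (u x t) else 0)" (is ?lower)
proof -
  have k0: "0 \<in> {0..rj}" "rj \<in> {0..rj}" using k by auto
  note fk = entropy_solution_fields[OF Q sol k]
  have ran: "\<And>x t. t > 0 \<Longrightarrow> u x t \<in> {0..rj}" using sol unfolding entropy_solution_def by blast
  have bd: "\<bar>\<bar>u0 x - c\<bar>\<bar> \<le> rj" "\<bar>max 0 (u0 x - c)\<bar> \<le> rj" "\<bar>max 0 (c - u0 x)\<bar> \<le> rj" if "c \<in> {0..rj}" for x c
    using u0(2)[of x] that by auto
  have ms: "(\<lambda>x. \<bar>u0 x - c\<bar>) \<in> borel_measurable borel" "(\<lambda>x. max 0 (u0 x - c)) \<in> borel_measurable borel"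
    "(\<lambda>x. max 0 (c - u0 x)) \<in> borel_measurable borel" for c
    using u0(1) by simp_all
  have s0: "\<bar>u x t - k\<bar> + \<bar>u x t - 0\<bar> = 2 * max 0 (u x t - k) + k"
    "sgn (u x t - k) * (Q (u x t) - Q k) + sgn (u x t - 0) * (Q (u x t) - Q 0)
      = 2 * (if k < u x t then Q (u x t) - Q k else 0) + (Q k - Q 0)"
    "\<bar>u x t - k\<bar> + \<bar>u x t - rj\<bar> = 2 * max 0 (k - u x t) + (rj - k)"
    "sgn (u x t - k) * (Q (u x t) - Q k) + sgn (u x t - rj) * (Q (u x t) - Q rj)
      = 2 * (if u x t < k then Q k - Q (u x t) else 0) + (Q rj - Q k)" if "t > 0" for x t
    using ran[OF that, of x] k by (auto simp: sgn_if max_def)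
  have i0: "\<bar>u0 x - k\<bar> + \<bar>u0 x - 0\<bar> = 2 * max 0 (u0 x - k) + k"
    "\<bar>u0 x - k\<bar> + \<bar>u0 x - rj\<bar> = 2 * max 0 (k - u0 x) + (rj - k)" for x
    using u0(2)[of x] k by (auto simp: max_def)
  show ?upper
    by (rule half_entropy_ineq[OF entropy_solution_Kruzhkov[OF sol k] entropy_solution_Kruzhkov[OF sol k0(1)]
          fk(1,2) entropy_solution_fields(1,2)[OF Q sol k0(1)] fk(3,4)];
        (rule s0 i0 ms bd k k0 | assumption)+)
  show ?lower
    by (rule half_entropy_ineq[OF entropy_solution_Kruzhkov[OF sol k] entropy_solution_Kruzhkov[OF sol k0(2)]
          fk(1,2) entropy_solution_fields(1,2)[OF Q sol k0(2)] fk(5,6)];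
        (rule s0 i0 ms bd k k0 | assumption)+)
qed

section \<open>Smooth trapezoids and the cutoff in time\<close>

definition bump :: "(real \<Rightarrow> real) \<Rightarrow> (real \<Rightarrow> real) \<Rightarrow> bool" where
  "bump \<alpha> \<alpha>' \<longleftrightarrow> (\<forall>x. 0 \<le> \<alpha> x) \<and> (\<forall>x. (\<alpha> has_real_derivative \<alpha>' x) (at x)) \<and>
     continuous_on UNIV \<alpha>' \<and> (\<exists>R. \<forall>x. R < \<bar>x\<bar> \<longrightarrow> \<alpha> x = 0)"

lemma test_function_product:
  assumes "bump \<alpha> \<alpha>'" "bump \<beta> \<beta>'"
  shows "test_function (\<lambda>x t. \<alpha> x * \<beta> t) (\<lambda>x t. \<alpha>' x * \<beta> t) (\<lambda>x t. \<alpha> x * \<beta>' t)"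
proof -
  have a: "\<And>x. 0 \<le> \<alpha> x" "\<And>x. (\<alpha> has_real_derivative \<alpha>' x) (at x)" "continuous_on UNIV \<alpha>'"
    and b: "\<And>x. 0 \<le> \<beta> x" "\<And>x. (\<beta> has_real_derivative \<beta>' x) (at x)" "continuous_on UNIV \<beta>'"
    using assms unfolding bump_def by blast+
  obtain R1 R2 where R: "\<And>x. R1 < \<bar>x\<bar> \<Longrightarrow> \<alpha> x = 0" "\<And>x. R2 < \<bar>x\<bar> \<Longrightarrow> \<beta> x = 0"
    using assms unfolding bump_def by blast
  have c: "continuous_on UNIV \<alpha>" "continuous_on UNIV \<beta>"
    using a(2) b(2) by (auto intro!: continuous_at_imp_continuous_on DERIV_isCont)
  have c1: "continuous_on UNIV (\<lambda>z::real \<times> real. f (fst z))"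
    and c2: "continuous_on UNIV (\<lambda>z::real \<times> real. f (snd z))" if "continuous_on UNIV f" for f :: "real \<Rightarrow> real"
    by (rule continuous_on_compose2[OF that]; auto intro!: continuous_intros)+
  show ?thesis
    unfolding test_function_def
  proof (intro conjI allI)
    show "((\<lambda>y. \<alpha> y * \<beta> t) has_real_derivative \<alpha>' x * \<beta> t) (at x)" for x t
      using DERIV_cmult_right[OF a(2)] .
    show "((\<lambda>s. \<alpha> x * \<beta> s) has_real_derivative \<alpha> x * \<beta>' t) (at t)" for x t
      using DERIV_cmult[OF b(2)] .
    show "continuous_on UNIV (\<lambda>(x, t). \<alpha>' x * \<beta> t)" "continuous_on UNIV (\<lambda>(x, t). \<alpha> x * \<beta>' t)"
      unfolding case_prod_unfold
      by (intro continuous_on_mult c1 c2 a(3) b(3) c)+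
    show "\<exists>R. \<forall>x t. R < \<bar>x\<bar> \<or> R < \<bar>t\<bar> \<longrightarrow> \<alpha> x * \<beta> t = 0"
      by (intro exI[of _ "max R1 R2"]) (use R in auto)
  qed (use a(1) b(1) in auto)
qed

text \<open>
  The \<open>C\<^sup>1\<close> step whose derivative is the tent of height 2 over \<open>{0..1}\<close>.
\<close>

definition smooth_step :: "real \<Rightarrow> real" where
  "smooth_step y = 2 * ((max 0 y)\<^sup>2 - 2 * (max 0 (y - 1/2))\<^sup>2 + (max 0 (y - 1))\<^sup>2)"

definition smooth_step' :: "real \<Rightarrow> real" where
  "smooth_step' y = 4 * (max 0 y - 2 * max 0 (y - 1/2) + max 0 (y - 1))"

lemma has_real_derivative_max_squared:
  "((\<lambda>x::real. (max 0 x)\<^sup>2) has_real_derivative 2 * max 0 x) (at x)"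
proof (cases x "0::real" rule: linorder_cases)
  case less
  then have "\<forall>\<^sub>F y in nhds x. (max 0 y)\<^sup>2 = 0"
    by (auto simp: eventually_nhds intro!: exI[of _ "{..<0}"])
  then show ?thesis
    using DERIV_cong_ev[of x x "\<lambda>y. (max 0 y)\<^sup>2" "\<lambda>_. 0" 0 0] less by simp
next
  case equal
  have "((\<lambda>h::real. (max 0 h)\<^sup>2 / h) \<longlongrightarrow> 0) (at 0)"
  proof (rule Lim_null_comparison)
    show "\<forall>\<^sub>F h in at 0. norm ((max 0 h)\<^sup>2 / h) \<le> \<bar>h::real\<bar>"
      by (intro always_eventually) (auto simp: max_def power2_eq_square)
    show "((\<lambda>h::real. \<bar>h\<bar>) \<longlongrightarrow> 0) (at 0)"
      using tendsto_rabs[OF tendsto_ident_at[of "0::real" UNIV]] by simp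
  qed
  then show ?thesis unfolding equal DERIV_def by simp
next
  case greater
  then have "\<forall>\<^sub>F y in nhds x. (max 0 y)\<^sup>2 = y\<^sup>2"
    by (auto simp: eventually_nhds intro!: exI[of _ "{0<..}"])
  moreover have "((\<lambda>y. y\<^sup>2) has_real_derivative 2 * x) (at x)"
    by (auto intro!: derivative_eq_intros)
  ultimately show ?thesis
    using DERIV_cong_ev[of x x "\<lambda>y. (max 0 y)\<^sup>2" "\<lambda>y. y\<^sup>2" "2 * x" "2 * x"] greater by simp
qed

lemma smooth_step_deriv: "(smooth_step has_real_derivative smooth_step' y) (at y)"
proof -
  have s: "((\<lambda>y. (max 0 (y - c))\<^sup>2) has_real_derivative 2 * max 0 (y - c)) (at y)" for c :: real
    using DERIV_chain2[OF has_real_derivative_max_squared DERIV_diff[OF DERIV_ident DERIV_const], of c y UNIV]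
    by simp
  show ?thesis
    unfolding smooth_step_def[abs_def] smooth_step'_def
    by (rule derivative_eq_intros has_real_derivative_max_squared s refl)+ (simp add: algebra_simps)
qed

lemma smooth_step'_continuous: "continuous_on UNIV smooth_step'"
  unfolding smooth_step'_def[abs_def] by (intro continuous_intros)

lemma smooth_step_left: "y \<le> 0 \<Longrightarrow> smooth_step y = 0" "y \<le> 0 \<Longrightarrow> smooth_step' y = 0"
  by (simp_all add: smooth_step_def smooth_step'_def max_def)

lemma smooth_step_right: "1 \<le> y \<Longrightarrow> smooth_step y = 1" "1 \<le> y \<Longrightarrow> smooth_step' y = 0"
  by (simp_all add: smooth_step_def smooth_step'_def max_def power2_eq_square algebra_simps)

lemma smooth_step_lower_half:
  assumes "0 \<le> y" "y \<le> 1/2"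
  shows "smooth_step y = 2 * y\<^sup>2" "smooth_step' y = 4 * y"
  using assms by (simp_all add: smooth_step_def smooth_step'_def max_def)

lemma smooth_step_range: "0 \<le> smooth_step y" "smooth_step y \<le> 1"
proof -
  consider "y \<le> 0" | "0 \<le> y" "y \<le> 1/2" | "1/2 \<le> y" "y \<le> 1" | "1 \<le> y" by linarith
  then have "0 \<le> smooth_step y \<and> smooth_step y \<le> 1"
  proof cases
    case 2
    then have "y\<^sup>2 \<le> (1/2)\<^sup>2" by (intro power_mono)
    then show ?thesis using 2 by (simp add: smooth_step_lower_half power2_eq_square)
  next
    case 3
    then have "(1 - y)\<^sup>2 \<le> (1/2)\<^sup>2" by (intro power_mono) auto
    moreover have "smooth_step y = 1 - 2 * (1 - y)\<^sup>2"
      using 3 by (simp add: smooth_step_def max_def power2_eq_square algebra_simps)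
    ultimately show ?thesis by (simp add: power2_eq_square)
  qed (simp_all add: smooth_step_left smooth_step_right)
  then show "0 \<le> smooth_step y" "smooth_step y \<le> 1" by simp_all
qed

lemma smooth_step'_range: "0 \<le> smooth_step' y" "smooth_step' y \<le> 2"
  by (auto simp: smooth_step'_def max_def)

text \<open>
  Ascending ramp of length \<open>l\<close> from \<open>p\<close>, descending ramp of length \<open>m\<close> down to \<open>r\<close>. If
  \<open>p + l \<le> r - m\<close>, the plateau between them has height 1.
\<close>

definition trapezoid :: "real \<Rightarrow> real \<Rightarrow> real \<Rightarrow> real \<Rightarrow> real \<Rightarrow> real" where
  "trapezoid p l r m x = smooth_step ((x - p) / l) * smooth_step ((r - x) / m)"

definition trapezoid' :: "real \<Rightarrow> real \<Rightarrow> real \<Rightarrow> real \<Rightarrow> real \<Rightarrow> real" where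
  "trapezoid' p l r m x = smooth_step' ((x - p) / l) / l * smooth_step ((r - x) / m)
     - smooth_step ((x - p) / l) * (smooth_step' ((r - x) / m) / m)"

lemma trapezoid_deriv: "(trapezoid p l r m has_real_derivative trapezoid' p l r m x) (at x)"
proof -
  have "((\<lambda>x. smooth_step ((x - p) / l)) has_real_derivative smooth_step' ((x - p) / l) * (1 / l)) (at x)"
    by (rule DERIV_chain2[OF smooth_step_deriv DERIV_cdivide]) (auto intro!: derivative_eq_intros)
  moreover have "((\<lambda>x. smooth_step ((r - x) / m)) has_real_derivative smooth_step' ((r - x) / m) * (- 1 / m)) (at x)"
    by (rule DERIV_chain2[OF smooth_step_deriv DERIV_cdivide]) (auto intro!: derivative_eq_intros)
  ultimately show ?thesis
    unfolding trapezoid_def[abs_def] trapezoid'_def by (rule DERIV_cong[OF DERIV_mult]) (simp add: algebra_simps)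
qed

lemma trapezoid_values:
  assumes "0 < l" "0 < m" "p + l \<le> r - m"
  shows "0 \<le> trapezoid p l r m x" "trapezoid p l r m x \<le> 1"
    and "x \<le> p \<or> r \<le> x \<Longrightarrow> trapezoid p l r m x = 0"
    and "p + l \<le> x \<Longrightarrow> x \<le> r - m \<Longrightarrow> trapezoid p l r m x = 1"
  using assms by (auto simp: trapezoid_def smooth_step_left smooth_step_right smooth_step_range mult_le_one field_simps
      intro!: mult_nonneg_nonneg)

lemma trapezoid'_values:
  assumes "0 < l" "0 < m" "p + l \<le> r - m"
  shows "x \<le> p \<or> r \<le> x \<Longrightarrow> trapezoid' p l r m x = 0"
    and "p + l \<le> x \<Longrightarrow> x \<le> r - m \<Longrightarrow> trapezoid' p l r m x = 0"
    and "x \<le> p + l \<Longrightarrow> 0 \<le> trapezoid' p l r m x \<and> trapezoid' p l r m x \<le> 2 / l"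
    and "r - m \<le> x \<Longrightarrow> trapezoid' p l r m x \<le> 0 \<and> - (2 / m) \<le> trapezoid' p l r m x"
proof -
  have L: "1 \<le> (x - p) / l \<longleftrightarrow> p + l \<le> x" "(x - p) / l \<le> 0 \<longleftrightarrow> x \<le> p"
    and R: "1 \<le> (r - x) / m \<longleftrightarrow> x \<le> r - m" "(r - x) / m \<le> 0 \<longleftrightarrow> r \<le> x"
    using assms by (auto simp: field_simps)
  show "x \<le> p \<or> r \<le> x \<Longrightarrow> trapezoid' p l r m x = 0"
    using L R by (auto simp: trapezoid'_def smooth_step_left)
  show "p + l \<le> x \<Longrightarrow> x \<le> r - m \<Longrightarrow> trapezoid' p l r m x = 0"
    using L R by (auto simp: trapezoid'_def smooth_step_right)
  show "0 \<le> trapezoid' p l r m x \<and> trapezoid' p l r m x \<le> 2 / l" if "x \<le> p + l"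
  proof -
    have "1 \<le> (r - x) / m" using that assms R by linarith
    then show ?thesis
      using smooth_step'_range[of "(x - p) / l"] assms
      by (simp add: trapezoid'_def smooth_step_right divide_right_mono)
  qed
  show "trapezoid' p l r m x \<le> 0 \<and> - (2 / m) \<le> trapezoid' p l r m x" if "r - m \<le> x"
  proof -
    have "1 \<le> (x - p) / l" using that assms L by linarith
    then show ?thesis
      using smooth_step'_range[of "(r - x) / m"] assms
      by (simp add: trapezoid'_def smooth_step_right divide_right_mono)
  qed
qed

lemma bump_trapezoid:
  assumes "0 < l" "0 < m" "p + l \<le> r - m"
  shows "bump (trapezoid p l r m) (trapezoid' p l r m)"
  unfolding bump_def
proof (intro conjI allI)
  have c: "continuous_on UNIV (\<lambda>x. f ((x - p) / l))" "continuous_on UNIV (\<lambda>x. f ((r - x) / m))"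
    if "continuous_on UNIV f" for f :: "real \<Rightarrow> real"
    using assms by (auto intro!: continuous_on_compose2[OF that] continuous_intros)
  have s: "continuous_on UNIV smooth_step"
    by (auto intro!: continuous_at_imp_continuous_on DERIV_isCont smooth_step_deriv)
  show "continuous_on UNIV (trapezoid' p l r m)"
    unfolding trapezoid'_def[abs_def]
    using assms by (intro continuous_intros c s smooth_step'_continuous) auto
  show "\<exists>R. \<forall>x. R < \<bar>x\<bar> \<longrightarrow> trapezoid p l r m x = 0"
  proof (intro exI[of _ "\<bar>p\<bar> + \<bar>r\<bar>"] allI impI)
    fix x assume "\<bar>p\<bar> + \<bar>r\<bar> < \<bar>x\<bar>"
    then have "x \<le> p \<or> r \<le> x" by linarith
    then show "trapezoid p l r m x = 0" by (rule trapezoid_values(3)[OF assms])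
  qed
qed (use trapezoid_values(1)[OF assms] trapezoid_deriv in auto)

text \<open>
  For \<open>t > 0\<close> only the descending ramp, over \<open>{-1/2..1/2}\<close>, matters. Its second half is a parabola
  that decays at least as fast as \<open>exp (-2 * t)\<close>; the ascending ramp at negative
  times makes the support compact.
\<close>

definition time_cutoff :: "real \<Rightarrow> real" where
  "time_cutoff = trapezoid (-2) 1 (1/2) 1"

definition time_cutoff' :: "real \<Rightarrow> real" where
  "time_cutoff' = trapezoid' (-2) 1 (1/2) 1"

lemma bump_time_cutoff: "bump time_cutoff time_cutoff'"
  unfolding time_cutoff_def time_cutoff'_def by (rule bump_trapezoid) auto

lemma time_cutoff_range: "0 \<le> time_cutoff t" "time_cutoff t \<le> 1" "1/2 \<le> t \<Longrightarrow> time_cutoff t = 0"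
  unfolding time_cutoff_def by (auto intro!: trapezoid_values)

lemma time_cutoff_eq:
  assumes "0 \<le> t" "t \<le> 1/2"
  shows "time_cutoff t = 2 * (1/2 - t)\<^sup>2"
  using assms smooth_step_lower_half(1)[of "1/2 - t"]
  by (simp add: time_cutoff_def trapezoid_def smooth_step_right)

text \<open>
  On the parabolic end of the step, \<open>\<beta> = 2 y\<^sup>2\<close> and \<open>\<beta>' = -4 y\<close> with \<open>y = 1/2 - t \<le> 1\<close>.
\<close>

lemma time_cutoff_decay:
  assumes "0 < t"
  shows "time_cutoff' t \<le> - 2 * time_cutoff t"
proof (cases "t \<le> 1/2")
  case True
  have "time_cutoff' t = - 4 * (1/2 - t)"
    using assms True smooth_step_lower_half(2)[of "1/2 - t"]
    by (simp add: time_cutoff'_def trapezoid'_def smooth_step_right)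
  moreover have "(1/2 - t)\<^sup>2 \<le> 1 * (1/2 - t)"
    unfolding power2_eq_square using assms True by (intro mult_right_mono) auto
  ultimately show ?thesis using time_cutoff_eq[of t] assms True by simp
next
  case False
  then show ?thesis
    using time_cutoff_range(3)[of t] trapezoid'_values(1)[of 1 1 "-2" "1/2" t] by (simp add: time_cutoff'_def)
qed

lemma time_cutoff_pos: "0 < t \<Longrightarrow> t < 1/2 \<Longrightarrow> 0 < time_cutoff t"
  by (simp add: time_cutoff_eq)

definition cutoff_mass :: real where
  "cutoff_mass = (LINT t : {0<..} | lborel. time_cutoff t)"

lemma time_cutoff_continuous: "continuous_on UNIV time_cutoff"
  using bump_time_cutoff unfolding bump_def
  by (auto intro!: continuous_at_imp_continuous_on DERIV_isCont)

lemma time_cutoff_measurable [measurable]: "time_cutoff \<in> borel_measurable borel"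
  by (rule borel_measurable_continuous_onI[OF time_cutoff_continuous])

lemma cutoff_mass_pos: "0 < cutoff_mass"
proof -
  have i: "set_integrable lborel {0<..} time_cutoff"
    unfolding set_integrable_def
  proof (rule integrableI_bounded_set[where A = "{0..1/2}" and B = 1])
    show "emeasure lborel {0..1/2::real} < \<infinity>"
      using emeasure_lborel_cbox_finite[of "0" "1/2::real"] by simp
    show "AE x in lborel. x \<in> {0..1/2} \<longrightarrow> norm (indicat_real {0<..} x *\<^sub>R time_cutoff x) \<le> 1"
      using time_cutoff_range by (auto simp: indicator_def)
    show "AE x in lborel. x \<notin> {0..1/2} \<longrightarrow> indicat_real {0<..} x *\<^sub>R time_cutoff x = 0"
      using time_cutoff_range(3) by (auto simp: indicator_def)
  qed auto
  have "(LINT t : {0<..1/4::real} | lborel. 1/8) \<le> cutoff_mass"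
    unfolding cutoff_mass_def set_lebesgue_integral_def
  proof (rule integral_mono)
    show "integrable lborel (\<lambda>x. indicat_real {0<..1/4::real} x *\<^sub>R (1/8::real))"
      by (auto simp: integrable_indicator_iff)
    show "integrable lborel (\<lambda>x. indicat_real {0<..} x *\<^sub>R time_cutoff x)"
      using i unfolding set_integrable_def .
    fix t :: real
    have "1/8 \<le> time_cutoff t" if "0 < t" "t \<le> 1/4"
    proof -
      have "(1/4)\<^sup>2 \<le> (1/2 - t)\<^sup>2" using that by (intro power_mono) auto
      then show ?thesis using that by (simp add: time_cutoff_eq power2_eq_square)
    qed
    then show "indicat_real {0<..1/4} t *\<^sub>R (1/8) \<le> indicat_real {0<..} t *\<^sub>R time_cutoff t"
      using time_cutoff_range(1)[of t] by (auto simp: indicator_def)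
  qed
  moreover have "(LINT t : {0<..1/4::real} | lborel. 1/8) = (1/32 :: real)"
    by (simp add: set_lebesgue_integral_def)
  ultimately show ?thesis by simp
qed

section \<open>Integrals weighted by the cutoff in time\<close>

definition weight :: "(real \<Rightarrow> real) \<Rightarrow> bool" where
  "weight w \<longleftrightarrow> w \<in> borel_measurable borel \<and> (\<exists>B. \<forall>x. \<bar>w x\<bar> \<le> B) \<and> (\<exists>R. \<forall>x. R \<le> \<bar>x\<bar> \<longrightarrow> w x = 0)"

definition strip_integral :: "(real \<Rightarrow> real \<Rightarrow> real) \<Rightarrow> (real \<Rightarrow> real) \<Rightarrow> real" where
  "strip_integral f w = (LINT (x, t) : UNIV \<times> {0<..} | lborel. f x t * (w x * time_cutoff t))"

lemma weightI:
  assumes "w \<in> borel_measurable borel" "\<And>x. \<bar>w x\<bar> \<le> B" "\<And>x. R \<le> \<bar>x\<bar> \<Longrightarrow> w x = 0"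
  shows "weight w"
  using assms unfolding weight_def by blast

lemma weightE:
  assumes "weight w"
  obtains B R where "w \<in> borel_measurable borel" "\<And>x. \<bar>w x\<bar> \<le> B" "\<And>x. R \<le> \<bar>x\<bar> \<Longrightarrow> w x = 0"
  using assms unfolding weight_def by blast

lemma weight_indicator: "weight (indicator {a..b})"
  by (rule weightI[where B = 1 and R = "\<bar>a\<bar> + \<bar>b\<bar> + 1"]) (auto simp: indicator_def)

lemma weight_restrict:
  assumes w: "weight w" and S: "S \<in> sets borel"
  shows "weight (\<lambda>x. w x * indicator S x)"
proof (rule weightE[OF w])
  fix B R assume *: "w \<in> borel_measurable borel" "\<And>x. \<bar>w x\<bar> \<le> B" "\<And>x. R \<le> \<bar>x\<bar> \<Longrightarrow> w x = 0"
  have "\<bar>w x * indicator S x\<bar> \<le> \<bar>B\<bar>" for x using *(2)[of x] by (auto simp: indicator_def)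
  then show ?thesis using *(1,3) S by (intro weightI[where B = "\<bar>B\<bar>" and R = R]) auto
qed

lemma weight_cmult:
  assumes w: "weight w"
  shows "weight (\<lambda>x. c * w x)"
proof (rule weightE[OF w])
  fix B R assume *: "w \<in> borel_measurable borel" "\<And>x. \<bar>w x\<bar> \<le> B" "\<And>x. R \<le> \<bar>x\<bar> \<Longrightarrow> w x = 0"
  then show ?thesis
    by (intro weightI[where B = "\<bar>c\<bar> * B" and R = R]) (auto simp: abs_mult intro: mult_left_mono)
qed

lemma weight_add:
  assumes v: "weight v" and w: "weight w"
  shows "weight (\<lambda>x. v x + w x)"
proof (rule weightE[OF v], rule weightE[OF w])
  fix B R C S
  assume *: "v \<in> borel_measurable borel" "\<And>x. \<bar>v x\<bar> \<le> B" "\<And>x. R \<le> \<bar>x\<bar> \<Longrightarrow> v x = 0"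
    "w \<in> borel_measurable borel" "\<And>x. \<bar>w x\<bar> \<le> C" "\<And>x. S \<le> \<bar>x\<bar> \<Longrightarrow> w x = 0"
  have "\<bar>v x + w x\<bar> \<le> B + C" for x using *(2)[of x] *(5)[of x] by linarith
  then show ?thesis using *(1,3,4,6) by (intro weightI[where B = "B + C" and R = "max R S"]) auto
qed

lemma weight_bump:
  assumes "bump \<alpha> \<alpha>'"
  shows "weight \<alpha>" "weight \<alpha>'"
proof -
  have tf: "test_function (\<lambda>x t. \<alpha> x * time_cutoff t) (\<lambda>x t. \<alpha>' x * time_cutoff t) (\<lambda>x t. \<alpha> x * time_cutoff' t)"
    by (rule test_function_product[OF assms bump_time_cutoff])
  have c: "continuous_on UNIV \<alpha>'" "continuous_on UNIV \<alpha>"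
    using assms unfolding bump_def by (auto intro!: continuous_at_imp_continuous_on DERIV_isCont)
  obtain R where R: "\<And>x t. R \<le> \<bar>x\<bar> \<or> R \<le> \<bar>t\<bar> \<Longrightarrow> \<alpha> x * time_cutoff t = 0 \<and> \<alpha>' x * time_cutoff t = 0 \<and> \<alpha> x * time_cutoff' t = 0"
    using test_function_support[OF tf] by metis
  obtain B where B: "\<And>x t. \<bar>\<alpha> x * time_cutoff t\<bar> \<le> B" "\<And>x t. \<bar>\<alpha>' x * time_cutoff t\<bar> \<le> B"
    using test_function_bounded[OF tf] by metis
  \<comment> \<open>Bounds and support of the product pass to its spatial factor at a time where the cutoff is positive.\<close>
  define c where "c = time_cutoff (1/4)"
  have c: "c > 0" unfolding c_def by (rule time_cutoff_pos) auto
  have "\<bar>\<alpha> x\<bar> \<le> B / c" "\<bar>\<alpha>' x\<bar> \<le> B / c" for x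
    using B(1)[of x "1/4"] B(2)[of x "1/4"] c by (auto simp: c_def[symmetric] abs_mult field_simps)
  moreover have "\<alpha> x = 0 \<and> \<alpha>' x = 0" if "R \<le> \<bar>x\<bar>" for x
    using R[of x "1/4"] c that by (simp add: c_def)
  ultimately show "weight \<alpha>" "weight \<alpha>'"
    unfolding weight_def using borel_measurable_continuous_onI[OF \<open>continuous_on UNIV \<alpha>\<close>]
      borel_measurable_continuous_onI[OF \<open>continuous_on UNIV \<alpha>'\<close>] by blast+
qed

lemma set_integrable_weight:
  assumes f: "bounded_field f" and w: "weight w"
  shows "set_integrable lborel (UNIV \<times> {0<..}) (\<lambda>(x, t). f x t * (w x * time_cutoff t))"
proof -
  obtain B R where wm [measurable]: "w \<in> borel_measurable borel"
    and B: "\<And>x. \<bar>w x\<bar> \<le> B" and R: "\<And>x. R \<le> \<bar>x\<bar> \<Longrightarrow> w x = 0"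
    using w unfolding weight_def by blast
  \<comment> \<open>The cutoff is supported in \<open>{-2..1/2}\<close>; any bound from 2 on would do.\<close>
  have time: "time_cutoff t = 0" if "3 \<le> \<bar>t\<bar>" for t
  proof -
    have "t \<le> - 2 \<or> 1/2 \<le> t" using that by linarith
    then show ?thesis unfolding time_cutoff_def by (intro trapezoid_values(3)) auto
  qed
  have "(\<lambda>z::real \<times> real. w (fst z) * time_cutoff (snd z)) \<in> borel_measurable borel"
    unfolding borel_prod[symmetric] by measurable
  then have m: "(\<lambda>(x, t). w x * time_cutoff t) \<in> borel_measurable borel"
    by (simp add: case_prod_unfold)
  show ?thesis
  proof (rule set_integrable_field_mult[OF f m, where B = B and R = "max R 3"])
    show "\<bar>w x * time_cutoff t\<bar> \<le> B" for x t
    proof -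
      have "\<bar>w x\<bar> * time_cutoff t \<le> \<bar>w x\<bar> * 1" by (intro mult_left_mono time_cutoff_range) auto
      then show ?thesis using B[of x] time_cutoff_range(1)[of t] by (simp add: abs_mult)
    qed
    show "w x * time_cutoff t = 0" if "max R 3 \<le> \<bar>x\<bar> \<or> max R 3 \<le> \<bar>t\<bar>" for x t
      using that R[of x] time[of t] by auto
  qed
qed

lemma half_plane_sets: "UNIV \<times> {0<..} \<in> sets (lborel :: (real \<times> real) measure)"
  by (auto intro!: borel_open open_Times)

lemma strip_integral_mono:
  assumes "bounded_field f" "bounded_field g" "weight v" "weight w"
    and "AE (x, t) in lborel. 0 < t \<and> t < 1/2 \<longrightarrow> f x t * v x \<le> g x t * w x"
  shows "strip_integral f v \<le> strip_integral g w"
  unfolding strip_integral_def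
proof (rule set_integral_mono_AE[OF set_integrable_weight set_integrable_weight])
  show "AE z\<in>UNIV \<times> {0<..} in lborel. (case z of (x, t) \<Rightarrow> f x t * (v x * time_cutoff t))
      \<le> (case z of (x, t) \<Rightarrow> g x t * (w x * time_cutoff t))"
    using assms(5)
  proof eventually_elim
    case (elim z)
    obtain x t where z: "z = (x, t)" by force
    have "f x t * v x * time_cutoff t \<le> g x t * w x * time_cutoff t" if "0 < t"
    proof (cases "t < 1/2")
      case True
      then show ?thesis using elim that time_cutoff_range(1) by (auto simp: z intro: mult_right_mono)
    next
      case False
      then show ?thesis by (simp add: time_cutoff_range(3))
    qed
    then show ?case by (auto simp: z mult.assoc)
  qed
qed (use assms in auto)

lemma strip_integral_const:
  assumes w: "weight w"
  shows "strip_integral (\<lambda>x t. c) w = c * (LINT x | lborel. w x) * cutoff_mass"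
proof -
  have "strip_integral (\<lambda>x t. c) w = (LINT x | lborel. (LINT t : {0<..} | lborel. c * (w x * time_cutoff t)))"
    unfolding strip_integral_def by (rule set_Times_Fubini) (rule set_integrable_weight[OF bounded_field_const w])
  also have "\<dots> = (LINT x | lborel. c * w x * cutoff_mass)"
    by (simp add: cutoff_mass_def flip: mult.assoc)
  finally show ?thesis by simp
qed

lemma strip_integral_add:
  assumes "bounded_field f" "bounded_field g" "weight v" "weight w"
  shows "strip_integral f v + strip_integral g w
    = (LINT (x, t) : UNIV \<times> {0<..} | lborel. f x t * (v x * time_cutoff t) + g x t * (w x * time_cutoff t))"
  unfolding strip_integral_def
  by (subst set_integral_add(2)[symmetric, OF set_integrable_weight set_integrable_weight])
    (use assms in \<open>simp_all add: case_prod_unfold\<close>)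

lemma strip_integral_cmult: "strip_integral f (\<lambda>x. c * w x) = c * strip_integral f w"
proof -
  have "strip_integral f (\<lambda>x. c * w x)
      = (LINT z : UNIV \<times> {0<..} | lborel. c *\<^sub>R (case z of (x, t) \<Rightarrow> f x t * (w x * time_cutoff t)))"
    unfolding strip_integral_def set_lebesgue_integral_def
    by (rule Bochner_Integration.integral_cong) (auto simp: mult_ac)
  then show ?thesis unfolding strip_integral_def set_integral_scaleR_right by simp
qed

lemma strip_integral_zero_AE:
  assumes f: "bounded_field f" and w: "weight w"
    and nn: "\<And>x t. 0 < t \<Longrightarrow> 0 \<le> f x t" "\<And>x. 0 \<le> w x" and le: "strip_integral f w \<le> 0"
  shows "AE (x, t) in lborel. 0 < t \<and> t < 1/2 \<and> 0 < w x \<longrightarrow> f x t = 0"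
proof -
  let ?g = "\<lambda>z. indicat_real (UNIV \<times> {0<..}) z *\<^sub>R (case z of (x, t) \<Rightarrow> f x t * (w x * time_cutoff t))"
  have i: "integrable lborel ?g"
    using set_integrable_weight[OF f w] unfolding set_integrable_def .
  have pos: "0 \<le> ?g z" for z
    using nn time_cutoff_range(1) by (auto simp: indicator_def split: prod.split)
  then have "0 \<le> integral\<^sup>L lborel ?g" by (rule Bochner_Integration.integral_nonneg)
  with le have "integral\<^sup>L lborel ?g = 0" unfolding strip_integral_def set_lebesgue_integral_def by simp
  then have "AE z in lborel. ?g z = 0"
    using integral_nonneg_eq_0_iff_AE[OF i] pos by blast
  then show ?thesis
  proof eventually_elim
    case (elim z)
    obtain x t where z: "z = (x, t)" by force
    show ?case using elim time_cutoff_pos[of t] by (auto simp: z indicator_def)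
  qed
qed

text \<open>
  The test function is \<open>\<alpha> x * time_cutoff t\<close>. Because the cutoff decays at a rate of at least 2, the time
  derivative of the entropy bounds the entropy itself.
\<close>

lemma bump_estimate:
  assumes e: "entropy_ineq \<eta>0 \<eta> q" and f: "bounded_field \<eta>" "bounded_field q"
    and nn: "\<And>x t. 0 < t \<Longrightarrow> 0 \<le> \<eta> x t" and a: "bump \<alpha> \<alpha>'"
  shows "2 * strip_integral \<eta> \<alpha> \<le> strip_integral q \<alpha>' + (LINT x | lborel. \<eta>0 x * \<alpha> x) * time_cutoff 0"
proof -
  note tf = test_function_product[OF a bump_time_cutoff]
  note w = weight_bump[OF a]
  have a0: "0 \<le> \<alpha> x" for x using a unfolding bump_def by blast
  have i1: "set_integrable lborel (UNIV \<times> {0<..}) (\<lambda>(x, t). \<eta> x t * (\<alpha> x * time_cutoff' t) + q x t * (\<alpha>' x * time_cutoff t))"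
    using set_integral_add(1)[OF set_integrable_test_function(2)[OF f(1) tf] set_integrable_test_function(1)[OF f(2) tf]]
    by (simp add: case_prod_unfold)
  have i2: "set_integrable lborel (UNIV \<times> {0<..}) (\<lambda>(x, t). \<eta> x t * (-2 * \<alpha> x * time_cutoff t) + q x t * (\<alpha>' x * time_cutoff t))"
    using set_integral_add(1)[OF set_integrable_weight[OF f(1) weight_cmult[OF w(1), of "-2"]] set_integrable_weight[OF f(2) w(2)]]
    by (simp add: case_prod_unfold)
  have "0 \<le> (LINT (x, t) : UNIV \<times> {0<..} | lborel. \<eta> x t * (\<alpha> x * time_cutoff' t) + q x t * (\<alpha>' x * time_cutoff t))
             + (LINT x | lborel. \<eta>0 x * (\<alpha> x * time_cutoff 0))"
    using e tf unfolding entropy_ineq_def by blast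
  also have "(LINT (x, t) : UNIV \<times> {0<..} | lborel. \<eta> x t * (\<alpha> x * time_cutoff' t) + q x t * (\<alpha>' x * time_cutoff t))
      \<le> (LINT (x, t) : UNIV \<times> {0<..} | lborel. \<eta> x t * (-2 * \<alpha> x * time_cutoff t) + q x t * (\<alpha>' x * time_cutoff t))"
  proof (rule set_integral_mono[OF i1 i2])
    fix z :: "real \<times> real" assume "z \<in> UNIV \<times> {0<..}"
    then obtain x t where z: "z = (x, t)" and t: "0 < t" by auto
    have "\<eta> x t * \<alpha> x * time_cutoff' t \<le> \<eta> x t * \<alpha> x * (-2 * time_cutoff t)"
      by (intro mult_left_mono time_cutoff_decay mult_nonneg_nonneg nn a0 t)
    then show "(case z of (x, t) \<Rightarrow> \<eta> x t * (\<alpha> x * time_cutoff' t) + q x t * (\<alpha>' x * time_cutoff t))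
        \<le> (case z of (x, t) \<Rightarrow> \<eta> x t * (-2 * \<alpha> x * time_cutoff t) + q x t * (\<alpha>' x * time_cutoff t))"
      by (simp add: z mult_ac)
  qed
  also have "\<dots> = strip_integral \<eta> (\<lambda>x. -2 * \<alpha> x) + strip_integral q \<alpha>'"
    by (rule strip_integral_add[OF f weight_cmult[OF w(1)] w(2), symmetric])
  also have "strip_integral \<eta> (\<lambda>x. -2 * \<alpha> x) = -2 * strip_integral \<eta> \<alpha>"
    by (rule strip_integral_cmult)
  also have "(LINT x | lborel. \<eta>0 x * (\<alpha> x * time_cutoff 0)) = (LINT x | lborel. \<eta>0 x * \<alpha> x) * time_cutoff 0"
    by (simp flip: mult.assoc)
  finally show ?thesis by simp
qed

section \<open>Reflection in space\<close>

lemma distr_reflect_lborel: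
  "distr lborel borel (\<lambda>z::real \<times> real. (- fst z, snd z)) = lborel"
proof -
  have "(lborel :: (real \<times> real) measure) = distr lborel borel uminus \<Otimes>\<^sub>M distr lborel borel (\<lambda>t. t)"
    by (simp add: lborel_distr_uminus lborel_prod distr_id2)
  also have "\<dots> = distr (lborel \<Otimes>\<^sub>M lborel) (borel \<Otimes>\<^sub>M borel) (\<lambda>(x, t). (- x, t))"
    by (rule pair_measure_distr) (auto simp: distr_id2 sigma_finite_lborel)
  also have "\<dots> = distr lborel borel (\<lambda>z. (- fst z, snd z))"
    by (simp add: lborel_prod borel_prod case_prod_unfold)
  finally show ?thesis by simp
qed

lemma reflect_measurable: "(\<lambda>z::real \<times> real. (- fst z, snd z)) \<in> borel_measurable borel"
  by (intro borel_measurable_continuous_onI continuous_intros)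

lemma half_plane_integral_reflect:
  fixes f :: "real \<Rightarrow> real \<Rightarrow> real"
  assumes "set_integrable lborel (UNIV \<times> {0<..}) (\<lambda>(x, t). f x t)"
  shows "(LINT (x, t) : UNIV \<times> {0<..} | lborel. f (- x) t) = (LINT (x, t) : UNIV \<times> {0<..} | lborel. f x t)"
proof -
  let ?g = "\<lambda>z. indicat_real (UNIV \<times> {0<..}) z *\<^sub>R (case z of (x, t) \<Rightarrow> f x t)"
  have "?g \<in> borel_measurable borel"
    using assms unfolding set_integrable_def by (auto dest: borel_measurable_integrable)
  then have "integral\<^sup>L (distr lborel borel (\<lambda>z::real \<times> real. (- fst z, snd z))) ?g
      = (LINT z | lborel. ?g (- fst z, snd z))"
    using reflect_measurable by (intro integral_distr) auto
  then have "integral\<^sup>L lborel ?g = (LINT z | lborel. ?g (- fst z, snd z))"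
    unfolding distr_reflect_lborel .
  moreover have "(LINT z | lborel. ?g (- fst z, snd z)) = (LINT (x, t) : UNIV \<times> {0<..} | lborel. f (- x) t)"
    unfolding set_lebesgue_integral_def
    by (rule Bochner_Integration.integral_cong) (auto simp: indicator_def)
  ultimately show ?thesis unfolding set_lebesgue_integral_def by simp
qed

lemma set_borel_measurable_reflect:
  fixes f :: "real \<Rightarrow> real \<Rightarrow> real"
  assumes "set_borel_measurable lborel (UNIV \<times> {0<..}) (\<lambda>(x, t). f x t)"
  shows "set_borel_measurable lborel (UNIV \<times> {0<..}) (\<lambda>(x, t). f (- x) t)"
proof -
  let ?g = "\<lambda>z. indicat_real (UNIV \<times> {0<..}) z *\<^sub>R (case z of (x, t) \<Rightarrow> f x t)"
  have "?g \<in> borel_measurable borel"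
    using assms unfolding set_borel_measurable_def by simp
  from measurable_compose[OF reflect_measurable this]
  have "(\<lambda>z. ?g (- fst z, snd z)) \<in> borel_measurable borel" .
  also have "(\<lambda>z. ?g (- fst z, snd z)) = (\<lambda>z. indicat_real (UNIV \<times> {0<..}) z *\<^sub>R (case z of (x, t) \<Rightarrow> f (- x) t))"
    by (auto simp: fun_eq_iff indicator_def)
  finally show ?thesis unfolding set_borel_measurable_def by simp
qed

lemma bounded_field_reflect: "bounded_field f \<Longrightarrow> bounded_field (\<lambda>x t. f (- x) t)"
  unfolding bounded_field_def using set_borel_measurable_reflect by blast

lemma bounded_field_uminus:
  assumes "bounded_field f" shows "bounded_field (\<lambda>x t. - f x t)"
proof -
  have "(\<lambda>z. - (indicat_real (UNIV \<times> {0<..}) z *\<^sub>R (case z of (x, t) \<Rightarrow> f x t))) \<in> borel_measurable lborel"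
    using assms unfolding bounded_field_def set_borel_measurable_def by (intro borel_measurable_uminus) blast
  then have "set_borel_measurable lborel (UNIV \<times> {0<..}) (\<lambda>(x, t). - f x t)"
    unfolding set_borel_measurable_def by (simp add: case_prod_unfold)
  then show ?thesis using assms unfolding bounded_field_def by simp
qed

lemma bounded_field_abs:
  assumes "bounded_field f" shows "bounded_field (\<lambda>x t. \<bar>f x t\<bar>)"
proof -
  have "(\<lambda>z. \<bar>indicat_real (UNIV \<times> {0<..}) z *\<^sub>R (case z of (x, t) \<Rightarrow> f x t)\<bar>) \<in> borel_measurable lborel"
    using assms unfolding bounded_field_def set_borel_measurable_def by (intro borel_measurable_abs) blast
  then have "set_borel_measurable lborel (UNIV \<times> {0<..}) (\<lambda>(x, t). \<bar>f x t\<bar>)"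
    unfolding set_borel_measurable_def by (simp add: case_prod_unfold abs_mult)
  then show ?thesis using assms unfolding bounded_field_def by simp
qed

lemma bounded_field_affine:
  assumes "bounded_field f" shows "bounded_field (\<lambda>x t. c + d * f x t)"
proof -
  obtain B where B: "\<And>x t. 0 < t \<Longrightarrow> \<bar>f x t\<bar> \<le> B" using assms unfolding bounded_field_def by blast
  have "(\<lambda>z. (indicat_real (UNIV \<times> {0<..}) z *\<^sub>R c) + d * (indicat_real (UNIV \<times> {0<..}) z *\<^sub>R (case z of (x, t) \<Rightarrow> f x t)))
      \<in> borel_measurable lborel"
    using assms bounded_field_const[of c] unfolding bounded_field_def set_borel_measurable_def
    by (intro borel_measurable_add borel_measurable_times borel_measurable_const) (auto simp: case_prod_unfold)
  then have "set_borel_measurable lborel (UNIV \<times> {0<..}) (\<lambda>(x, t). c + d * f x t)"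
    unfolding set_borel_measurable_def by (simp add: case_prod_unfold distrib_left mult_ac)
  moreover have "\<bar>c + d * f x t\<bar> \<le> \<bar>c\<bar> + \<bar>d\<bar> * B" if "0 < t" for x t
    using B[OF that, of x] by (intro order.trans[OF abs_triangle_ineq]) (auto simp: abs_mult intro: mult_left_mono)
  ultimately show ?thesis unfolding bounded_field_def by blast
qed

lemma test_function_reflect:
  assumes "test_function \<phi> \<phi>x \<phi>t"
  shows "test_function (\<lambda>x t. \<phi> (- x) t) (\<lambda>x t. - \<phi>x (- x) t) (\<lambda>x t. \<phi>t (- x) t)"
proof -
  have d: "((\<lambda>y. \<phi> y t) has_real_derivative \<phi>x x t) (at x)" for x t
    using assms unfolding test_function_def by blast
  have "((\<lambda>y. \<phi> (- y) t) has_real_derivative \<phi>x (- x) t * (- 1)) (at x)" for x t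
    by (rule DERIV_chain2[OF d]) (auto intro!: derivative_eq_intros)
  then have d': "((\<lambda>y. \<phi> (- y) t) has_real_derivative - \<phi>x (- x) t) (at x)" for x t by simp
  have c: "continuous_on UNIV (\<lambda>(x, t). f (- x) t)" if "continuous_on UNIV (\<lambda>(x, t). f x t)" for f :: "real \<Rightarrow> real \<Rightarrow> real"
    using continuous_on_compose2[OF that, of UNIV "\<lambda>z. (- fst z, snd z)"]
    by (simp add: case_prod_unfold continuous_on_Pair continuous_on_minus continuous_on_fst continuous_on_snd)
  obtain R where R: "\<And>x t. R < \<bar>x\<bar> \<or> R < \<bar>t\<bar> \<Longrightarrow> \<phi> x t = 0"
    using assms unfolding test_function_def by blast
  show ?thesis
    unfolding test_function_def
  proof (intro conjI allI)
    show "continuous_on UNIV (\<lambda>(x, t). - \<phi>x (- x) t)"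
      using continuous_on_minus[OF c[of \<phi>x]] assms unfolding test_function_def by (simp add: case_prod_unfold)
    show "continuous_on UNIV (\<lambda>(x, t). \<phi>t (- x) t)"
      using c[of \<phi>t] assms unfolding test_function_def by blast
    show "\<exists>R. \<forall>x t. R < \<bar>x\<bar> \<or> R < \<bar>t\<bar> \<longrightarrow> \<phi> (- x) t = 0"
      using R by (intro exI[of _ R]) auto
  qed (use assms d' in \<open>auto simp: test_function_def\<close>)
qed

lemma entropy_ineq_reflect:
  assumes e: "entropy_ineq \<eta>0 \<eta> q" and f: "bounded_field \<eta>" "bounded_field q"
  shows "entropy_ineq (\<lambda>x. \<eta>0 (- x)) (\<lambda>x t. \<eta> (- x) t) (\<lambda>x t. - q (- x) t)"
  unfolding entropy_ineq_def
proof (intro allI impI)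
  fix \<phi> \<phi>x \<phi>t assume "test_function \<phi> \<phi>x \<phi>t"
  then have tf: "test_function (\<lambda>x t. \<phi> (- x) t) (\<lambda>x t. - \<phi>x (- x) t) (\<lambda>x t. \<phi>t (- x) t)"
    by (rule test_function_reflect)
  have i: "set_integrable lborel (UNIV \<times> {0<..}) (\<lambda>(x, t). \<eta> x t * \<phi>t (- x) t + q x t * (- \<phi>x (- x) t))"
    using set_integral_add(1)[OF set_integrable_test_function(2)[OF f(1) tf] set_integrable_test_function(1)[OF f(2) tf]]
    by (simp add: case_prod_unfold)
  have "0 \<le> (LINT (x, t) : UNIV \<times> {0<..} | lborel. \<eta> x t * \<phi>t (- x) t + q x t * (- \<phi>x (- x) t))
             + (LINT x | lborel. \<eta>0 x * \<phi> (- x) 0)"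
    using e tf unfolding entropy_ineq_def by blast
  also have "(LINT x | lborel. \<eta>0 x * \<phi> (- x) 0) = (LINT x | lborel. \<eta>0 (- x) * \<phi> x 0)"
    by (subst lborel_integral_real_affine[of "-1" _ 0]) auto
  finally show "0 \<le> (LINT (x, t) : UNIV \<times> {0<..} | lborel. \<eta> (- x) t * \<phi>t x t + - q (- x) t * \<phi>x x t)
             + (LINT x | lborel. \<eta>0 (- x) * \<phi> x 0)"
    using half_plane_integral_reflect[OF i] by simp
qed

lemma strip_integral_reflect:
  assumes "bounded_field f" "weight w"
  shows "strip_integral (\<lambda>x t. f (- x) t) (\<lambda>x. w (- x)) = strip_integral f w"
  unfolding strip_integral_def by (rule half_plane_integral_reflect[OF set_integrable_weight[OF assms]])

section \<open>Consequences of the entropy inequality\<close>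

text \<open>
  A substitute for \<open>\<bar>q\<bar> \<le> C \<eta>\<close>, which expresses finite speed of propagation and fails for
  fluxes that are not Lipschitz continuous.
\<close>

definition dominated_flux :: "(real \<Rightarrow> real \<Rightarrow> real) \<Rightarrow> (real \<Rightarrow> real \<Rightarrow> real) \<Rightarrow> bool" where
  "dominated_flux \<eta> q \<longleftrightarrow> (\<forall>\<epsilon>>0. \<exists>C\<ge>0. \<forall>x. \<forall>t>0. \<bar>q x t\<bar> \<le> \<epsilon> + C * \<eta> x t)"

text \<open>
  Testing with a bump around \<open>{M..2*M}\<close> whose ramps have lengths proportional to \<open>M\<close> bounds the integral
  of \<open>\<eta>\<close> there independently of \<open>M\<close>, since \<open>q\<close> is bounded and a ramp has total slope 1. By
  \<open>\<bar>q\<bar> \<le> \<epsilon>' + C \<eta>\<close> the integral of \<open>\<bar>q\<bar>\<close> is then at most \<open>\<epsilon>'\<close> times a multiple of \<open>M\<close>, plus a constant.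
\<close>

lemma far_field:
  assumes e: "entropy_ineq \<eta>0 \<eta> q" and f: "bounded_field \<eta>" "bounded_field q"
    and nn: "\<And>x t. 0 < t \<Longrightarrow> 0 \<le> \<eta> x t" and dom: "dominated_flux \<eta> q"
    and ini: "\<And>x. 0 < x \<Longrightarrow> \<eta>0 x = 0" and "0 < \<epsilon>"
  shows "\<exists>M0>0. \<forall>M\<ge>M0. strip_integral (\<lambda>x t. \<bar>q x t\<bar>) (indicator {M..2*M}) \<le> \<epsilon> * M"
proof -
  let ?K = cutoff_mass
  obtain B0 where "\<And>x t. 0 < t \<Longrightarrow> \<bar>q x t\<bar> \<le> B0" using f(2) unfolding bounded_field_def by blast
  then have B: "\<bar>q x t\<bar> \<le> \<bar>B0\<bar>" if "0 < t" for x t using that by (meson abs_ge_self order.trans)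
  define B where "B = \<bar>B0\<bar>"
  have B0: "0 \<le> B" by (simp add: B_def)
  have near: "strip_integral \<eta> (indicator {M..2*M}) \<le> 2 * B * ?K" if M: "0 < M" for M
  proof -
    have p: "0 < M/2" "0 < M" "M/2 + M/2 \<le> 3*M - M" using M by auto
    let ?a = "trapezoid (M/2) (M/2) (3*M) M" and ?a' = "trapezoid' (M/2) (M/2) (3*M) M"
    let ?w = "\<lambda>x. (4/M) * indicat_real {M/2..M} x + (2/M) * indicat_real {2*M..3*M} x"
    note ba = bump_trapezoid[OF p]
    have wt: "weight ?w" by (intro weight_add weight_cmult weight_indicator)
    have "strip_integral \<eta> (indicator {M..2*M}) \<le> strip_integral \<eta> ?a"
    proof (rule strip_integral_mono[OF f(1) f(1) weight_indicator weight_bump(1)[OF ba]], rule AE_I2, clarify)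
      fix x t :: real assume t: "0 < t"
      show "\<eta> x t * indicator {M..2*M} x \<le> \<eta> x t * ?a x"
        using trapezoid_values(1,4)[OF p, of x] nn[OF t, of x] by (auto simp: indicator_def)
    qed
    moreover have "(LINT x | lborel. \<eta>0 x * ?a x) = 0"
    proof -
      have "\<eta>0 x * ?a x = 0" for x
      proof (cases "0 < x")
        case False
        then have "x \<le> M/2" using M by linarith
        then show ?thesis using trapezoid_values(3)[OF p, of x] by simp
      qed (simp add: ini)
      then show ?thesis by (simp only: Bochner_Integration.integral_zero)
    qed
    moreover have "strip_integral q ?a' \<le> strip_integral (\<lambda>x t. B) ?w"
    proof (rule strip_integral_mono[OF f(2) bounded_field_const weight_bump(2)[OF ba] wt], rule AE_I2, clarify)
      fix x t :: real assume t: "0 < t"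
      have "\<bar>?a' x\<bar> \<le> ?w x"
      proof -
        consider "x \<le> M/2" | "M/2 \<le> x" "x \<le> M" | "M \<le> x" "x \<le> 2*M" | "2*M \<le> x" "x \<le> 3*M" | "3*M \<le> x"
          by linarith
        then show ?thesis
        proof cases
          case 2
          then show ?thesis using trapezoid'_values(3)[OF p, of x] M by (auto simp: indicator_def)
        next
          case 4
          then show ?thesis using trapezoid'_values(4)[OF p, of x] M by (auto simp: indicator_def)
        qed (use trapezoid'_values(1,2)[OF p, of x] M in auto)
      qed
      then have "\<bar>q x t\<bar> * \<bar>?a' x\<bar> \<le> B * ?w x"
        using B[OF t, of x] by (intro mult_mono) (auto simp: B_def)
      then show "q x t * ?a' x \<le> B * ?w x"
        using abs_ge_self[of "q x t * ?a' x"] unfolding abs_mult by linarith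
    qed
    moreover have "strip_integral (\<lambda>x t. B) ?w = B * (LINT x | lborel. ?w x) * ?K"
      by (rule strip_integral_const[OF wt])
    moreover have "(LINT x | lborel. ?w x) = 4"
      using M by (subst Bochner_Integration.integral_add) (simp_all add: integrable_indicator_iff)
    ultimately show ?thesis using bump_estimate[OF e f nn ba] by simp
  qed
  \<comment> \<open>Half of \<open>\<epsilon> * M\<close> is for the term \<open>\<epsilon>'\<close>; the other half absorbs \<open>C * (2 * B * ?K)\<close> once \<open>M\<close> is large.\<close>
  define \<epsilon>' where "\<epsilon>' = \<epsilon> / (2 * ?K)"
  have K: "0 < ?K" by (rule cutoff_mass_pos)
  have e': "0 < \<epsilon>'" using \<open>0 < \<epsilon>\<close> K by (simp add: \<epsilon>'_def)
  obtain C where C: "0 \<le> C" "\<And>x t. 0 < t \<Longrightarrow> \<bar>q x t\<bar> \<le> \<epsilon>' + C * \<eta> x t"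
    using dom e' unfolding dominated_flux_def by blast
  show ?thesis
  proof (intro exI[of _ "4 * B * C * ?K / \<epsilon> + 1"] conjI allI impI)
    show "0 < 4 * B * C * ?K / \<epsilon> + 1" using B0 C(1) K \<open>0 < \<epsilon>\<close> by (intro add_nonneg_pos divide_nonneg_pos mult_nonneg_nonneg) auto
    fix M assume M: "4 * B * C * ?K / \<epsilon> + 1 \<le> M"
    have "0 < 4 * B * C * ?K / \<epsilon> + 1" by fact
    with M have M0: "0 < M" by linarith
    let ?i = "indicat_real {M..2*M}"
    have "strip_integral (\<lambda>x t. \<bar>q x t\<bar>) ?i \<le> strip_integral (\<lambda>x t. \<epsilon>' + C * \<eta> x t) ?i"
      by (rule strip_integral_mono[OF bounded_field_abs[OF f(2)] bounded_field_affine[OF f(1)] weight_indicator weight_indicator])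
        (use C(2) in \<open>auto simp: indicator_def intro!: AE_I2\<close>)
    also have "\<dots> = strip_integral (\<lambda>x t. \<epsilon>') ?i + strip_integral \<eta> (\<lambda>x. C * ?i x)"
      unfolding strip_integral_add[OF bounded_field_const f(1) weight_indicator weight_cmult[OF weight_indicator]]
      unfolding strip_integral_def by (simp add: algebra_simps)
    also have "\<dots> = \<epsilon>' * M * ?K + C * strip_integral \<eta> ?i"
      using M0 by (simp add: strip_integral_const[OF weight_indicator] strip_integral_cmult)
    also have "\<dots> \<le> \<epsilon>' * M * ?K + C * (2 * B * ?K)"
      by (intro add_left_mono mult_left_mono near M0 C(1))
    also have "\<dots> \<le> \<epsilon> * M"
    proof -
      have "4 * B * C * ?K / \<epsilon> \<le> M" using M by linarith
      then have "4 * B * C * ?K \<le> M * \<epsilon>" using \<open>0 < \<epsilon>\<close> by (simp add: field_simps)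
      moreover have "\<epsilon>' * M * ?K = \<epsilon> * M / 2" using K by (simp add: \<epsilon>'_def)
      moreover have "C * (2 * B * ?K) = 4 * B * C * ?K / 2" by simp
      ultimately show ?thesis by (simp only: mult.commute[of M \<epsilon>])
    qed
    finally show "strip_integral (\<lambda>x t. \<bar>q x t\<bar>) ?i \<le> \<epsilon> * M" .
  qed
qed

lemma dominated_flux_reflect: "dominated_flux \<eta> q \<Longrightarrow> dominated_flux (\<lambda>x t. \<eta> (- x) t) (\<lambda>x t. - q (- x) t)"
  unfolding dominated_flux_def abs_minus_cancel
proof (intro allI impI)
  fix \<epsilon> :: real assume *: "\<forall>\<epsilon>>0. \<exists>C\<ge>0. \<forall>x. \<forall>t>0. \<bar>q x t\<bar> \<le> \<epsilon> + C * \<eta> x t" and "0 < \<epsilon>"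
  then obtain C where "0 \<le> C" "\<forall>x. \<forall>t>0. \<bar>q x t\<bar> \<le> \<epsilon> + C * \<eta> x t" by meson
  then show "\<exists>C\<ge>0. \<forall>x. \<forall>t>0. \<bar>q (- x) t\<bar> \<le> \<epsilon> + C * \<eta> (- x) t" by blast
qed

lemma far_field_left:
  assumes e: "entropy_ineq \<eta>0 \<eta> q" and f: "bounded_field \<eta>" "bounded_field q"
    and nn: "\<And>x t. 0 < t \<Longrightarrow> 0 \<le> \<eta> x t" and dom: "dominated_flux \<eta> q"
    and ini: "\<And>x. x < 0 \<Longrightarrow> \<eta>0 x = 0" and "0 < \<epsilon>"
  shows "\<exists>M0>0. \<forall>M\<ge>M0. strip_integral (\<lambda>x t. \<bar>q x t\<bar>) (indicator {-2*M..-M}) \<le> \<epsilon> * M"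
proof -
  have "\<exists>M0>0. \<forall>M\<ge>M0. strip_integral (\<lambda>x t. \<bar>- q (- x) t\<bar>) (indicator {M..2*M}) \<le> \<epsilon> * M"
    by (rule far_field[OF entropy_ineq_reflect[OF e f]])
      (use bounded_field_reflect f bounded_field_uminus nn dominated_flux_reflect[OF dom] ini \<open>0 < \<epsilon>\<close> in auto)
  moreover have "strip_integral (\<lambda>x t. \<bar>- q (- x) t\<bar>) (indicator {M..2*M})
      = strip_integral (\<lambda>x t. \<bar>q x t\<bar>) (indicator {-2*M..-M})" for M
    using strip_integral_reflect[OF bounded_field_abs[OF f(2)] weight_indicator[of "-2*M" "-M"]]
    by (simp add: strip_integral_def indicator_def minus_le_iff le_minus_iff conj_commute)
  ultimately show ?thesis by simp
qed

text \<open>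
  With both ramps far away and no initial entropy, \<open>bump_estimate\<close> has nothing on the right but
  the two far fields.
\<close>

lemma maximum_principle:
  assumes e: "entropy_ineq \<eta>0 \<eta> q" and f: "bounded_field \<eta>" "bounded_field q"
    and nn: "\<And>x t. 0 < t \<Longrightarrow> 0 \<le> \<eta> x t" and dom: "dominated_flux \<eta> q"
    and ini: "\<And>x. \<eta>0 x = 0"
  shows "AE (x, t) in lborel. 0 < t \<and> t < 1/2 \<longrightarrow> \<eta> x t = 0"
proof -
  have zero: "strip_integral \<eta> (indicator {-N..N}) \<le> 0" if N: "0 < N" for N
  proof (rule field_le_epsilon)
    fix \<epsilon> :: real assume "0 < \<epsilon>"
    then have e2: "0 < \<epsilon>/2" by simp
    obtain M1 where M1: "\<And>M. M1 \<le> M \<Longrightarrow> strip_integral (\<lambda>x t. \<bar>q x t\<bar>) (indicator {M..2*M}) \<le> \<epsilon>/2 * M"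
      using far_field[OF e f nn dom ini e2] by blast
    obtain M2 where M2: "\<And>M. M2 \<le> M \<Longrightarrow> strip_integral (\<lambda>x t. \<bar>q x t\<bar>) (indicator {-2*M..-M}) \<le> \<epsilon>/2 * M"
      using far_field_left[OF e f nn dom ini e2] by blast
    define M where "M = max N (max M1 M2)"
    have M: "0 < M" "N \<le> M" "M1 \<le> M" "M2 \<le> M" using N by (auto simp: M_def)
    have p: "0 < M" "0 < M" "-2*M + M \<le> 2*M - M" using M by auto
    let ?a = "trapezoid (-2*M) M (2*M) M" and ?a' = "trapezoid' (-2*M) M (2*M) M"
    let ?w = "\<lambda>x. (2/M) * (indicat_real {-2*M..-M} x + indicat_real {M..2*M} x)"
    note ba = bump_trapezoid[OF p]
    have wt: "weight ?w" by (intro weight_add weight_cmult weight_indicator)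
    have "strip_integral \<eta> (indicator {-N..N}) \<le> strip_integral \<eta> ?a"
    proof (rule strip_integral_mono[OF f(1) f(1) weight_indicator weight_bump(1)[OF ba]], rule AE_I2, clarify)
      fix x t :: real assume t: "0 < t"
      show "\<eta> x t * indicator {-N..N} x \<le> \<eta> x t * ?a x"
        using trapezoid_values(1,4)[OF p, of x] nn[OF t, of x] M by (auto simp: indicator_def)
    qed
    moreover have "strip_integral q ?a' \<le> strip_integral (\<lambda>x t. \<bar>q x t\<bar>) ?w"
    proof (rule strip_integral_mono[OF f(2) bounded_field_abs[OF f(2)] weight_bump(2)[OF ba] wt], rule AE_I2, clarify)
      fix x t :: real assume t: "0 < t"
      have "\<bar>?a' x\<bar> \<le> ?w x"
      proof -
        consider "x \<le> -2*M" | "-2*M \<le> x" "x \<le> -M" | "-M \<le> x" "x \<le> M" | "M \<le> x" "x \<le> 2*M" | "2*M \<le> x"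
          by linarith
        then show ?thesis
        proof cases
          case 2
          then show ?thesis using trapezoid'_values(3)[OF p, of x] M by (auto simp: indicator_def)
        next
          case 4
          then show ?thesis using trapezoid'_values(4)[OF p, of x] M by (auto simp: indicator_def)
        qed (use trapezoid'_values(1,2)[OF p, of x] M in auto)
      qed
      then have "\<bar>q x t\<bar> * \<bar>?a' x\<bar> \<le> \<bar>q x t\<bar> * ?w x"
        by (intro mult_left_mono) auto
      then show "q x t * ?a' x \<le> \<bar>q x t\<bar> * ?w x"
        using abs_ge_self[of "q x t * ?a' x"] unfolding abs_mult by linarith
    qed
    moreover have "strip_integral (\<lambda>x t. \<bar>q x t\<bar>) ?w = 2/M * (strip_integral (\<lambda>x t. \<bar>q x t\<bar>) (indicator {-2*M..-M})
        + strip_integral (\<lambda>x t. \<bar>q x t\<bar>) (indicator {M..2*M}))"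
      unfolding strip_integral_cmult
        strip_integral_add[OF bounded_field_abs[OF f(2)] bounded_field_abs[OF f(2)] weight_indicator weight_indicator]
      unfolding strip_integral_def by (simp add: algebra_simps)
    moreover have "2/M * (strip_integral (\<lambda>x t. \<bar>q x t\<bar>) (indicator {-2*M..-M})
        + strip_integral (\<lambda>x t. \<bar>q x t\<bar>) (indicator {M..2*M})) \<le> 2/M * (\<epsilon>/2 * M + \<epsilon>/2 * M)"
      using M by (intro mult_left_mono add_mono M1 M2) auto
    moreover have "2/M * (\<epsilon>/2 * M + \<epsilon>/2 * M) = 2 * \<epsilon>" using M by simp
    moreover have "2 * strip_integral \<eta> ?a \<le> strip_integral q ?a'"
      using bump_estimate[OF e f nn ba] by (simp add: ini)
    ultimately show "strip_integral \<eta> (indicator {-N..N}) \<le> 0 + \<epsilon>" by linarith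
  qed
  have "AE z in lborel. \<forall>n::nat. case z of (x, t) \<Rightarrow> 0 < t \<and> t < 1/2 \<and> 0 < indicat_real {-(real n + 1)..real n + 1} x \<longrightarrow> \<eta> x t = 0"
    unfolding AE_all_countable
    by (intro allI strip_integral_zero_AE[OF f(1) weight_indicator nn _ zero]) auto
  then show ?thesis
  proof eventually_elim
    case (elim z)
    obtain x t where z: "z = (x, t)" by force
    obtain n where "\<bar>x\<bar> \<le> real n" using real_arch_simple by blast
    then have "x \<in> {-(real n + 1)..real n + 1}" by auto
    then show ?case using spec[OF elim, of n] by (simp add: z)
  qed
qed

text \<open>
  The trapezoid descends on \<open>{-\<delta>..0}\<close>, where the nonnegative flux only carries entropy out of
  the left half-plane. All that can enter comes from the far field.
\<close>

lemma left_half_vanishes: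
  assumes e: "entropy_ineq \<eta>0 \<eta> q" and f: "bounded_field \<eta>" "bounded_field q"
    and nn: "\<And>x t. 0 < t \<Longrightarrow> 0 \<le> \<eta> x t" and dom: "dominated_flux \<eta> q"
    and ini: "\<And>x. x < 0 \<Longrightarrow> \<eta>0 x = 0"
    and outflow: "AE (x, t) in lborel. 0 < t \<and> t < 1/2 \<and> x < 0 \<longrightarrow> 0 \<le> q x t"
  shows "AE (x, t) in lborel. 0 < t \<and> t < 1/2 \<and> x < 0 \<longrightarrow> \<eta> x t = 0"
proof -
  have zero: "strip_integral \<eta> (indicator {-N..-\<delta>}) \<le> 0" if N: "0 < N" "0 < \<delta>" for N \<delta>
  proof (rule field_le_epsilon)
    fix \<epsilon> :: real assume "0 < \<epsilon>"
    obtain M1 where M1: "\<And>M. M1 \<le> M \<Longrightarrow> strip_integral (\<lambda>x t. \<bar>q x t\<bar>) (indicator {-2*M..-M}) \<le> \<epsilon> * M"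
      using far_field_left[OF e f nn dom ini \<open>0 < \<epsilon>\<close>] by blast
    define M where "M = max N (max M1 \<delta>)"
    have M: "0 < M" "N \<le> M" "M1 \<le> M" "\<delta> \<le> M" using N by (auto simp: M_def)
    have p: "0 < M" "0 < \<delta>" "-2*M + M \<le> 0 - \<delta>" using M N by auto
    let ?a = "trapezoid (-2*M) M 0 \<delta>" and ?a' = "trapezoid' (-2*M) M 0 \<delta>"
    let ?w = "\<lambda>x. (2/M) * indicat_real {-2*M..-M} x"
    note ba = bump_trapezoid[OF p]
    have wt: "weight ?w" by (intro weight_cmult weight_indicator)
    have "strip_integral \<eta> (indicator {-N..-\<delta>}) \<le> strip_integral \<eta> ?a"
    proof (rule strip_integral_mono[OF f(1) f(1) weight_indicator weight_bump(1)[OF ba]], rule AE_I2, clarify)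
      fix x t :: real assume t: "0 < t"
      show "\<eta> x t * indicator {-N..-\<delta>} x \<le> \<eta> x t * ?a x"
        using trapezoid_values(1,4)[OF p, of x] nn[OF t, of x] M by (auto simp: indicator_def)
    qed
    moreover have "strip_integral q ?a' \<le> strip_integral (\<lambda>x t. \<bar>q x t\<bar>) ?w"
    proof (rule strip_integral_mono[OF f(2) bounded_field_abs[OF f(2)] weight_bump(2)[OF ba] wt])
      show "AE (x, t) in lborel. 0 < t \<and> t < 1 / 2 \<longrightarrow> q x t * ?a' x \<le> \<bar>q x t\<bar> * ?w x"
        using outflow
      proof eventually_elim
        case (elim z)
        obtain x t where z: "z = (x, t)" by force
        have "q x t * ?a' x \<le> \<bar>q x t\<bar> * ?w x" if t: "0 < t" "t < 1/2"
        proof -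
          consider "x \<le> -2*M" | "-2*M \<le> x" "x \<le> -M" | "-M \<le> x" "x \<le> -\<delta>" | "-\<delta> \<le> x" "x < 0" | "0 \<le> x"
            by linarith
          then show ?thesis
          proof cases
            case 2
            then have a: "0 \<le> ?a' x" "?a' x \<le> ?w x"
              using trapezoid'_values(3)[OF p, of x] M by (auto simp: indicator_def)
            have "q x t * ?a' x \<le> \<bar>q x t\<bar> * ?a' x" using a(1) by (intro mult_right_mono) auto
            also have "\<dots> \<le> \<bar>q x t\<bar> * ?w x" using a(2) by (intro mult_left_mono) auto
            finally show ?thesis .
          next
            case 4
            then have "0 \<le> q x t" "?a' x \<le> 0"
              using elim t trapezoid'_values(4)[OF p, of x] by (auto simp: z)
            then have "q x t * ?a' x \<le> 0" by (simp add: mult_nonneg_nonpos)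
            also have "0 \<le> \<bar>q x t\<bar> * ?w x" using M by auto
            finally show ?thesis .
          qed (use trapezoid'_values(1,2)[OF p, of x] M in auto)
        qed
        then show ?case by (simp add: z)
      qed
    qed
    moreover have "strip_integral (\<lambda>x t. \<bar>q x t\<bar>) ?w = 2/M * strip_integral (\<lambda>x t. \<bar>q x t\<bar>) (indicator {-2*M..-M})"
      by (rule strip_integral_cmult)
    moreover have "2/M * strip_integral (\<lambda>x t. \<bar>q x t\<bar>) (indicator {-2*M..-M}) \<le> 2/M * (\<epsilon> * M)"
      using M by (intro mult_left_mono M1) auto
    moreover have "2/M * (\<epsilon> * M) = 2 * \<epsilon>" using M by simp
    moreover have "(LINT x | lborel. \<eta>0 x * ?a x) = 0"
    proof -
      have "\<eta>0 x * ?a x = 0" for x using ini[of x] trapezoid_values(3)[OF p, of x] by (cases "x < 0") auto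
      then show ?thesis by (simp only: Bochner_Integration.integral_zero)
    qed
    moreover have "2 * strip_integral \<eta> ?a \<le> strip_integral q ?a' + (LINT x | lborel. \<eta>0 x * ?a x) * time_cutoff 0"
      by (rule bump_estimate[OF e f nn ba])
    ultimately show "strip_integral \<eta> (indicator {-N..-\<delta>}) \<le> 0 + \<epsilon>" by simp
  qed
  have "AE z in lborel. \<forall>n::nat. case z of (x, t) \<Rightarrow>
      0 < t \<and> t < 1/2 \<and> 0 < indicat_real {-(real n + 1)..- (1 / (real n + 1))} x \<longrightarrow> \<eta> x t = 0"
    unfolding AE_all_countable
    by (intro allI strip_integral_zero_AE[OF f(1) weight_indicator nn _ zero]) auto
  then show ?thesis
  proof eventually_elim
    case (elim z)
    obtain x t where z: "z = (x, t)" by force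
    have "\<eta> x t = 0" if x: "x < 0" and t: "0 < t" "t < 1/2"
    proof -
      obtain n where "max (- x) (1 / (- x)) \<le> real n" using real_arch_simple by blast
      then have n: "- x \<le> real n + 1" "1 / (- x) \<le> real n + 1" by auto
      then have "1 \<le> (real n + 1) * (- x)" using x by (simp add: field_simps)
      then have "1 / (real n + 1) \<le> - x" by (simp add: field_simps)
      then have "x \<in> {-(real n + 1)..- (1 / (real n + 1))}" using n by auto
      then show ?thesis using spec[OF elim, of n] t by (simp add: z)
    qed
    then show ?case by (simp add: z)
  qed
qed

text \<open>
  The trapezoid ascends on \<open>{-\<delta>..0}\<close>. There the flux \<open>- c\<close> contributes \<open>- c * cutoff_mass\<close> whatever
  \<open>\<delta>\<close> is, as the total slope of the ramp is 1. For \<open>c > 0\<close> nothing could compensate this loss: the far field is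
  small, and so is the initial entropy, which sits under the short ramp.
\<close>

lemma inflow_nonneg:
  assumes e: "entropy_ineq \<eta>0 \<eta> q" and f: "bounded_field \<eta>" "bounded_field q"
    and nn: "\<And>x t. 0 < t \<Longrightarrow> 0 \<le> \<eta> x t" and dom: "dominated_flux \<eta> q"
    and ini: "\<And>x. 0 < x \<Longrightarrow> \<eta>0 x = 0" and ini_bd: "\<And>x. 0 \<le> \<eta>0 x" "\<And>x. \<eta>0 x \<le> A"
      and ini_m: "\<eta>0 \<in> borel_measurable borel"
    and inflow: "AE (x, t) in lborel. 0 < t \<and> t < 1/2 \<and> x < 0 \<longrightarrow> q x t = - c"
  shows "c \<le> 0"
proof (rule ccontr)
  assume "\<not> c \<le> 0"
  then have c: "0 < c" by simp
  let ?K = cutoff_mass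
  have K: "0 < ?K" by (rule cutoff_mass_pos)
  have A: "0 \<le> A" using ini_bd[of 0] by linarith
  \<comment> \<open>Far field and initial entropy together cost at most \<open>2 * \<epsilon> + A * \<delta> \<le> 3/4 * (c * ?K)\<close>, less than the loss \<open>c * ?K\<close>.\<close>
  define \<epsilon> where "\<epsilon> = c * ?K / 8"
  define \<delta> where "\<delta> = c * ?K / (2 * (A + 1))"
  have ed: "0 < \<epsilon>" "0 < \<delta>" using c K A by (auto simp: \<epsilon>_def \<delta>_def)
  obtain M0 where M0: "0 < M0" "\<And>M. M0 \<le> M \<Longrightarrow> strip_integral (\<lambda>x t. \<bar>q x t\<bar>) (indicator {M..2*M}) \<le> \<epsilon> * M"
    using far_field[OF e f nn dom ini ed(1)] by blast
  define M where "M = M0"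
  have M: "0 < M" "M0 \<le> M" using M0 by (auto simp: M_def)
  have p: "0 < \<delta>" "0 < M" "-\<delta> + \<delta> \<le> 2*M - M" using M ed by auto
  let ?a = "trapezoid (-\<delta>) \<delta> (2*M) M" and ?a' = "trapezoid' (-\<delta>) \<delta> (2*M) M"
  let ?w = "\<lambda>x. (2/M) * indicat_real {M..2*M} x"
  let ?v = "\<lambda>x. ?a' x * indicat_real {-\<delta>..0} x"
  note ba = bump_trapezoid[OF p]
  have wt: "weight ?w" "weight ?v"
    by (intro weight_cmult weight_indicator weight_restrict weight_bump(2)[OF ba]; simp)+
  have "0 \<le> strip_integral \<eta> ?a"
    unfolding strip_integral_def set_lebesgue_integral_def
    by (rule Bochner_Integration.integral_nonneg)
      (use nn trapezoid_values(1)[OF p] time_cutoff_range(1) in \<open>auto simp: indicator_def split: prod.split\<close>)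
  moreover have "strip_integral q ?a' \<le> strip_integral (\<lambda>x t. - c) ?v + strip_integral (\<lambda>x t. \<bar>q x t\<bar>) ?w"
  proof -
    have wr: "weight (\<lambda>x. ?a' x * indicat_real {0<..} x)"
      by (rule weight_restrict[OF weight_bump(2)[OF ba]]) simp
    have qi: "bounded_field (\<lambda>x t. \<bar>q x t\<bar>)" by (rule bounded_field_abs[OF f(2)])
    have "strip_integral q ?a' = strip_integral q ?v + strip_integral q (\<lambda>x. ?a' x * indicat_real {0<..} x)"
      unfolding strip_integral_add[OF f(2) f(2) wt(2) wr]
      unfolding strip_integral_def set_lebesgue_integral_def
    proof (rule Bochner_Integration.integral_cong[OF refl])
      fix z :: "real \<times> real"
      obtain x t where z: "z = (x, t)" by force
      have "?a' x = ?v x + ?a' x * indicat_real {0<..} x"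
        using trapezoid'_values(1)[OF p, of x] by (auto simp: indicator_def)
      then have "q x t * (?a' x * time_cutoff t) = q x t * ((?v x + ?a' x * indicat_real {0<..} x) * time_cutoff t)"
        by presburger
      then show "indicat_real (UNIV \<times> {0<..}) z *\<^sub>R (case z of (x, t) \<Rightarrow> q x t * (?a' x * time_cutoff t))
        = indicat_real (UNIV \<times> {0<..}) z *\<^sub>R (case z of (x, t) \<Rightarrow> q x t * (?v x * time_cutoff t)
            + q x t * (?a' x * indicat_real {0<..} x * time_cutoff t))"
        by (simp only: z prod.case distrib_right distrib_left)
    qed
    moreover have "strip_integral q ?v \<le> strip_integral (\<lambda>x t. - c) ?v"
    proof (rule strip_integral_mono[OF f(2) bounded_field_const wt(2) wt(2)])
      show "AE (x, t) in lborel. 0 < t \<and> t < 1 / 2 \<longrightarrow> q x t * ?v x \<le> - c * ?v x"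
        using inflow
      proof eventually_elim
        case (elim z)
        obtain x t where z: "z = (x, t)" by force
        consider "x < 0" | "x = 0" | "0 < x" by linarith
        then show ?case
        proof cases
          case 2
          then have v: "?v x = 0" using trapezoid'_values(2)[OF p, of 0] M by simp
          show ?thesis unfolding z prod.case v by simp
        qed (use elim in \<open>auto simp: z\<close>)
      qed
    qed
    moreover have "strip_integral q (\<lambda>x. ?a' x * indicat_real {0<..} x) \<le> strip_integral (\<lambda>x t. \<bar>q x t\<bar>) ?w"
    proof (rule strip_integral_mono[OF f(2) qi wr wt(1)], rule AE_I2, clarify)
      fix x t :: real assume t: "0 < t"
      have "\<bar>?a' x * indicat_real {0<..} x\<bar> \<le> ?w x"
      proof -
        consider "x \<le> 0" | "0 < x" "x \<le> M" | "M \<le> x" "x \<le> 2*M" | "2*M \<le> x"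
          by linarith
        then show ?thesis
        proof cases
          case 3
          then show ?thesis using trapezoid'_values(4)[OF p, of x] M by (auto simp: indicator_def)
        qed (use trapezoid'_values(1,2)[OF p, of x] M in auto)
      qed
      then have "\<bar>q x t\<bar> * \<bar>?a' x * indicat_real {0<..} x\<bar> \<le> \<bar>q x t\<bar> * ?w x"
        by (intro mult_left_mono) auto
      then show "q x t * (?a' x * indicat_real {0<..} x) \<le> \<bar>q x t\<bar> * ?w x"
        using abs_ge_self[of "q x t * (?a' x * indicat_real {0<..} x)"] unfolding abs_mult by linarith
    qed
    ultimately show ?thesis by linarith
  qed
  moreover have "strip_integral (\<lambda>x t. - c) ?v = - c * ?K"
  proof -
    have "(LINT x | lborel. ?v x) = (LINT x | lborel. indicat_real {-\<delta>..0} x *\<^sub>R ?a' x)"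
      by (simp add: mult.commute)
    also have "\<dots> = ?a 0 - ?a (-\<delta>)"
      using ba ed unfolding bump_def
      by (intro integral_FTC_atLeastAtMost)
        (auto simp: has_real_derivative_iff_has_vector_derivative[symmetric]
          intro: has_field_derivative_at_within continuous_on_subset)
    also have "\<dots> = 1"
      using trapezoid_values(3)[OF p, of "-\<delta>"] trapezoid_values(4)[OF p, of 0] M by simp
    finally show ?thesis by (simp add: strip_integral_const[OF wt(2)])
  qed
  moreover have "strip_integral (\<lambda>x t. \<bar>q x t\<bar>) ?w \<le> 2 * \<epsilon>"
  proof -
    have "strip_integral (\<lambda>x t. \<bar>q x t\<bar>) ?w = 2/M * strip_integral (\<lambda>x t. \<bar>q x t\<bar>) (indicator {M..2*M})"
      by (rule strip_integral_cmult)
    also have "\<dots> \<le> 2/M * (\<epsilon> * M)"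
      using M by (intro mult_left_mono M0) auto
    finally show ?thesis using M by simp
  qed
  moreover have "(LINT x | lborel. \<eta>0 x * ?a x) * time_cutoff 0 \<le> A * \<delta>"
  proof -
    have le: "\<eta>0 x * ?a x \<le> A * indicat_real {-\<delta>..0} x" for x
    proof (cases "x \<in> {-\<delta>..0}")
      case True
      have "\<eta>0 x * ?a x \<le> A * 1" using ini_bd trapezoid_values[OF p, of x] A by (intro mult_mono) auto
      then show ?thesis using True by simp
    next
      case False
      then have "x < -\<delta> \<or> 0 < x" by auto
      then show ?thesis using ini[of x] trapezoid_values(3)[OF p, of x] False by auto
    qed
    have w: "weight (\<lambda>x. \<eta>0 x * ?a x)"
    proof (rule weightE[OF weight_bump(1)[OF ba]])
      fix B R assume *: "?a \<in> borel_measurable borel" "\<And>x. \<bar>?a x\<bar> \<le> B" "\<And>x. R \<le> \<bar>x\<bar> \<Longrightarrow> ?a x = 0"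
      have "\<bar>\<eta>0 x * ?a x\<bar> \<le> A * B" for x
        unfolding abs_mult using ini_bd *(2) A by (intro mult_mono) auto
      then show ?thesis using *(1,3) ini_m by (intro weightI[where B = "A * B" and R = R]) auto
    qed
    have "(LINT x | lborel. \<eta>0 x * ?a x) \<le> (LINT x | lborel. A * indicat_real {-\<delta>..0} x)"
    proof (rule integral_mono[OF _ _ le])
      show "integrable lborel (\<lambda>x. A * indicat_real {-\<delta>..0} x)"
        using ed by (simp add: integrable_indicator_iff)
      then show "integrable lborel (\<lambda>x. \<eta>0 x * ?a x)"
      proof (rule Bochner_Integration.integrable_bound)
        show "(\<lambda>x. \<eta>0 x * ?a x) \<in> borel_measurable lborel" using w unfolding weight_def by simp
        show "AE x in lborel. norm (\<eta>0 x * ?a x) \<le> norm (A * indicat_real {-\<delta>..0} x)"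
          using le ini_bd(1) trapezoid_values(1)[OF p] A by (intro AE_I2) (simp add: abs_mult)
      qed
    qed
    also have "\<dots> = A * \<delta>" using ed by simp
    finally have "(LINT x | lborel. \<eta>0 x * ?a x) \<le> A * \<delta>" .
    moreover have "0 \<le> (LINT x | lborel. \<eta>0 x * ?a x)"
      using ini_bd(1) trapezoid_values(1)[OF p] by (intro Bochner_Integration.integral_nonneg) auto
    ultimately have "(LINT x | lborel. \<eta>0 x * ?a x) * time_cutoff 0 \<le> (A * \<delta>) * 1"
      using time_cutoff_range by (intro mult_mono) auto
    then show ?thesis by simp
  qed
  moreover have "2 * strip_integral \<eta> ?a \<le> strip_integral q ?a' + (LINT x | lborel. \<eta>0 x * ?a x) * time_cutoff 0"
    by (rule bump_estimate[OF e f nn ba])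
  ultimately have "c * ?K \<le> 2 * \<epsilon> + A * \<delta>" by linarith
  moreover have "2 * \<epsilon> = c * ?K / 4" by (simp add: \<epsilon>_def)
  moreover have "A * \<delta> \<le> c * ?K / 2"
  proof -
    have "A * \<delta> = c * ?K / 2 * (A / (A + 1))" using A by (simp add: \<delta>_def)
    also have "\<dots> \<le> c * ?K / 2 * 1" using A c K by (intro mult_left_mono) auto
    finally show ?thesis by simp
  qed
  moreover have "0 < c * ?K" using c K by simp
  ultimately show False by linarith
qed

section \<open>Existence of self-similar solutions\<close>

text \<open>
  The state at which the lower convex hull of \<open>Q\<close> over \<open>{a..b}\<close> has slope \<open>\<xi>\<close>. Where the hull has an edge
  of slope \<open>\<xi>\<close>, several states qualify and any of them will do; such \<open>\<xi>\<close> are the shock speeds.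
\<close>

definition minimizing_profile :: "(real \<Rightarrow> real) \<Rightarrow> real \<Rightarrow> real \<Rightarrow> (real \<Rightarrow> real) \<Rightarrow> bool" where
  "minimizing_profile Q a b v \<longleftrightarrow>
     (\<forall>\<xi>. v \<xi> \<in> {a..b} \<and> (\<forall>r\<in>{a..b}. Q (v \<xi>) - \<xi> * v \<xi> \<le> Q r - \<xi> * r))"

lemma minimizing_profile_exists:
  assumes Q: "continuous_on {0..rj} Q" and ab: "0 \<le> a" "a \<le> b" "b \<le> rj"
  shows "\<exists>v. minimizing_profile Q a b v"
proof -
  have "\<exists>r\<in>{a..b}. \<forall>s\<in>{a..b}. Q r - \<xi> * r \<le> Q s - \<xi> * s" for \<xi>
    by (rule continuous_attains_inf) (use ab in \<open>auto intro!: continuous_intros continuous_on_subset[OF Q]\<close>)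
  then show ?thesis unfolding minimizing_profile_def by metis
qed

lemma minimizing_profile_mono:
  assumes "minimizing_profile Q a b v"
  shows "mono v"
proof (rule monoI)
  fix x y :: real assume "x \<le> y"
  have "Q (v x) - x * v x \<le> Q (v y) - x * v y" "Q (v y) - y * v y \<le> Q (v x) - y * v x"
    using assms unfolding minimizing_profile_def by blast+
  then have "(y - x) * (v x - v y) \<le> 0" by (simp add: algebra_simps)
  then show "v x \<le> v y"
    using \<open>x \<le> y\<close> by (cases "x = y") (auto simp: mult_le_0_iff)
qed

text \<open>
  The entropy flux relative to the moving ray \<open>x = \<xi> * t\<close>.
  In terms of \<open>\<xi>\<close>, the entropy inequality reads \<open>drift' \<le> - \<bar>v - k\<bar>\<close>.
\<close>

definition drift :: "(real \<Rightarrow> real) \<Rightarrow> (real \<Rightarrow> real) \<Rightarrow> real \<Rightarrow> real \<Rightarrow> real" where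
  "drift Q v k \<xi> = sgn (v \<xi> - k) * (Q (v \<xi>) - Q k) - \<xi> * \<bar>v \<xi> - k\<bar>"

text \<open>
  On either side of the level \<open>k\<close>, \<open>drift\<close> is \<open>\<plusminus> (g \<xi> - (Q k - \<xi> * k))\<close> with \<open>g \<xi>\<close> the
  minimum of \<open>Q r - \<xi> * r\<close>, which is concave in \<open>\<xi>\<close>, and the bound is the supergradient inequality for \<open>g\<close>, obtained by comparing each minimizer with the
  other one. When the level is crossed, \<open>k\<close> itself competes in the minimization, which makes
  \<open>drift\<close> nonnegative before and nonpositive after.
\<close>

lemma drift_decrease:
  assumes v: "minimizing_profile Q a b v" and d: "0 < \<delta>"
  shows "\<delta> * max 0 (max (v \<xi> - k) (k - v (\<xi> + \<delta>))) \<le> drift Q v k \<xi> - drift Q v k (\<xi> + \<delta>)"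
proof -
  have vin: "v \<xi> \<in> {a..b}" "v (\<xi> + \<delta>) \<in> {a..b}"
    and min1: "\<And>r. r \<in> {a..b} \<Longrightarrow> Q (v \<xi>) - \<xi> * v \<xi> \<le> Q r - \<xi> * r"
    and min2: "\<And>r. r \<in> {a..b} \<Longrightarrow> Q (v (\<xi> + \<delta>)) - (\<xi> + \<delta>) * v (\<xi> + \<delta>) \<le> Q r - (\<xi> + \<delta>) * r"
    using v unfolding minimizing_profile_def by blast+
  have mono: "v \<xi> \<le> v (\<xi> + \<delta>)"
    using monoD[OF minimizing_profile_mono[OF v], of \<xi> "\<xi> + \<delta>"] d by simp
  consider "k < v \<xi>" | "v (\<xi> + \<delta>) < k" | "v \<xi> \<le> k" "k \<le> v (\<xi> + \<delta>)" by linarith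
  then show ?thesis
  proof cases
    case 1
    then show ?thesis
      using mono min2[OF vin(1)] by (simp add: drift_def algebra_simps)
  next
    case 2
    then show ?thesis
      using mono min1[OF vin(2)] by (simp add: drift_def algebra_simps)
  next
    case 3
    then have k: "k \<in> {a..b}" using vin by auto
    have "0 \<le> drift Q v k \<xi>"
      using 3 min1[OF k] by (cases "v \<xi> = k") (auto simp: drift_def algebra_simps)
    moreover have "drift Q v k (\<xi> + \<delta>) \<le> 0"
      using 3 min2[OF k] by (cases "v (\<xi> + \<delta>) = k") (auto simp: drift_def algebra_simps)
    ultimately show ?thesis using 3 by simp
  qed
qed

lemma minimizing_profile_measurable:
  assumes "minimizing_profile Q a b v"
  shows "v \<in> borel_measurable borel"
  by (rule borel_measurable_mono[OF minimizing_profile_mono[OF assms]])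

lemma minimizing_profile_range:
  assumes "minimizing_profile Q a b v" "0 \<le> a" "b \<le> rj"
  shows "v \<xi> \<in> {0..rj}"
proof -
  have "v \<xi> \<in> {a..b}" using assms(1) unfolding minimizing_profile_def by blast
  then show ?thesis using assms(2,3) by auto
qed

lemma minimizing_profile_flux_measurable:
  assumes Q: "continuous_on {0..rj} Q" and ab: "0 \<le> a" "b \<le> rj" and v: "minimizing_profile Q a b v"
  shows "(\<lambda>\<xi>. Q (v \<xi>)) \<in> borel_measurable borel"
proof -
  have "v \<in> measurable borel (restrict_space borel {0..rj})"
    by (rule measurable_restrict_space2)
      (use minimizing_profile_range[OF v ab] minimizing_profile_measurable[OF v] in auto)
  from measurable_compose[OF this borel_measurable_continuous_on_restrict[OF Q]] show ?thesis .
qed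

lemma integrable_local:
  fixes f g :: "real \<Rightarrow> real"
  assumes "f \<in> borel_measurable borel" "g \<in> borel_measurable borel"
    and "\<And>x. \<bar>x\<bar> \<le> R \<Longrightarrow> \<bar>f x\<bar> \<le> A" "\<And>x. \<bar>g x\<bar> \<le> B" "\<And>x. R \<le> \<bar>x\<bar> \<Longrightarrow> g x = 0"
  shows "integrable lborel (\<lambda>x. f x * g x)"
proof (rule integrableI_bounded_set[where A = "{-\<bar>R\<bar>..\<bar>R\<bar>}" and B = "\<bar>A\<bar> * \<bar>B\<bar>"])
  show "emeasure lborel {-\<bar>R\<bar>..\<bar>R\<bar>} < \<infinity>" by simp
  have "\<bar>f x * g x\<bar> \<le> \<bar>A\<bar> * \<bar>B\<bar>" for x
  proof (cases "\<bar>x\<bar> \<le> R")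
    case True
    then have "\<bar>f x\<bar> \<le> \<bar>A\<bar>" using assms(3)[of x] by linarith
    moreover have "\<bar>g x\<bar> \<le> \<bar>B\<bar>" using assms(4)[of x] by linarith
    ultimately show ?thesis unfolding abs_mult by (intro mult_mono) auto
  qed (simp add: assms(5))
  then show "AE x in lborel. x \<in> {-\<bar>R\<bar>..\<bar>R\<bar>} \<longrightarrow> norm (f x * g x) \<le> \<bar>A\<bar> * \<bar>B\<bar>" by simp
  have "f x * g x = 0" if "x \<notin> {-\<bar>R\<bar>..\<bar>R\<bar>}" for x
    using that assms(5)[of x] by force
  then show "AE x in lborel. x \<notin> {-\<bar>R\<bar>..\<bar>R\<bar>} \<longrightarrow> f x * g x = 0" by simp
qed (use assms in auto)

text \<open>
  The weak form of \<open>drift' \<le> - \<bar>v - k\<bar>\<close>. Moving difference quotients from \<open>\<psi>\<close> to \<open>drift\<close> reduces it to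
  \<open>drift_decrease\<close>; in the limit \<open>v (\<xi> + \<delta>)\<close> tends to \<open>v \<xi>\<close> for almost every \<open>\<xi>\<close>, since a monotone
  function has only countably many discontinuities.
\<close>

lemma profile_inequality:
  assumes Q: "continuous_on {0..rj} Q" and ab: "0 \<le> a" "a \<le> b" "b \<le> rj" and k: "k \<in> {0..rj}"
    and v: "minimizing_profile Q a b v"
    and \<psi>: "\<And>\<xi>. (\<psi> has_real_derivative \<psi>' \<xi>) (at \<xi>)" "continuous_on UNIV \<psi>'" "\<And>\<xi>. 0 \<le> \<psi> \<xi>"
    and X: "\<And>\<xi>. \<bar>\<psi>' \<xi>\<bar> \<le> X" "\<And>\<xi>. \<bar>\<psi> \<xi>\<bar> \<le> X"
    and N: "0 < N" "\<And>\<xi>. N \<le> \<bar>\<xi>\<bar> \<Longrightarrow> \<psi> \<xi> = 0" "\<And>\<xi>. N \<le> \<bar>\<xi>\<bar> \<Longrightarrow> \<psi>' \<xi> = 0"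
  shows "(LINT \<xi> | lborel. \<bar>v \<xi> - k\<bar> * \<psi> \<xi>) \<le> (LINT \<xi> | lborel. drift Q v k \<xi> * \<psi>' \<xi>)"
proof -
  let ?F = "drift Q v k"
  note vin = minimizing_profile_range[OF v ab(1,3)]
  note vm [measurable] = minimizing_profile_measurable[OF v]
  obtain M where M: "0 \<le> M" "\<And>r. r \<in> {0..rj} \<Longrightarrow> \<bar>Q r\<bar> \<le> M"
    using continuous_flux_bounded[OF Q] by blast
  note Qv [measurable] = minimizing_profile_flux_measurable[OF Q ab(1,3) v]
  have Fm [measurable]: "?F \<in> borel_measurable borel"
    unfolding drift_def[abs_def] by measurable
  define A where "A = 2 * M + (N + 1) * rj"
  have FA: "\<bar>?F \<xi>\<bar> \<le> A" if "\<bar>\<xi>\<bar> \<le> N + 1" for \<xi>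
  proof -
    have "\<bar>sgn (v \<xi> - k) * (Q (v \<xi>) - Q k)\<bar> \<le> 2 * M"
      using M(2)[OF vin[of \<xi>]] M(2)[OF k] M(1) by (auto simp: sgn_if)
    moreover have "\<bar>\<xi> * \<bar>v \<xi> - k\<bar>\<bar> \<le> (N + 1) * rj"
      unfolding abs_mult using that N vin[of \<xi>] k by (intro mult_mono) auto
    ultimately show ?thesis unfolding drift_def A_def by linarith
  qed
  have A0: "0 \<le> A" using FA[of 0] N by simp
  have \<psi>m [measurable]: "\<psi> \<in> borel_measurable borel" "\<psi>' \<in> borel_measurable borel"
    using \<psi> by (auto intro!: borel_measurable_continuous_onI continuous_at_imp_continuous_on DERIV_isCont)
  define \<delta> where "\<delta> n = 1 / (real n + 1)" for n :: nat
  have \<delta>: "0 < \<delta> n" "\<delta> n \<le> 1" for n by (auto simp: \<delta>_def)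
  have \<delta>lim: "\<delta> \<longlonglongrightarrow> 0"
    unfolding \<delta>_def using LIMSEQ_inverse_real_of_nat by (simp add: inverse_eq_divide add.commute)
  have quot: "\<bar>\<psi> \<xi> - \<psi> (\<xi> - d)\<bar> \<le> X * d" if "0 < d" for \<xi> d
  proof -
    have "\<xi> - d < \<xi>" using that by simp
    from MVT2[OF this \<psi>(1)]
    obtain z where "\<psi> \<xi> - \<psi> (\<xi> - d) = (\<xi> - (\<xi> - d)) * \<psi>' z" by blast
    then show ?thesis using X(1)[of z] that by (simp add: abs_mult mult.commute mult_left_mono)
  qed
  have lim1: "(\<lambda>n. LINT \<xi> | lborel. ?F \<xi> * ((\<psi> \<xi> - \<psi> (\<xi> - \<delta> n)) / \<delta> n)) \<longlonglongrightarrow> (LINT \<xi> | lborel. ?F \<xi> * \<psi>' \<xi>)"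
  proof (rule integral_dominated_convergence[where w = "\<lambda>\<xi>. (A * X) * indicator {-(N+1)..N+1} \<xi>"])
    show "integrable lborel (\<lambda>\<xi>. (A * X) * indicator {-(N+1)..N+1} \<xi>)"
      using N by (simp add: integrable_indicator_iff)
    show "AE \<xi> in lborel. (\<lambda>n. ?F \<xi> * ((\<psi> \<xi> - \<psi> (\<xi> - \<delta> n)) / \<delta> n)) \<longlonglongrightarrow> ?F \<xi> * \<psi>' \<xi>"
    proof (intro AE_I2 tendsto_mult tendsto_const)
      fix \<xi> :: real
      have "((\<lambda>h. (\<psi> (\<xi> + h) - \<psi> \<xi>) / h) \<longlongrightarrow> \<psi>' \<xi>) (at 0)" using \<psi>(1)[of \<xi>] unfolding DERIV_def .
      moreover have "filterlim (\<lambda>n. - \<delta> n) (at 0) sequentially"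
        unfolding filterlim_at using tendsto_minus[OF \<delta>lim] \<delta>(1) by (auto simp: less_le)
      ultimately have "(\<lambda>n. (\<psi> (\<xi> + - \<delta> n) - \<psi> \<xi>) / (- \<delta> n)) \<longlonglongrightarrow> \<psi>' \<xi>"
        by (rule filterlim_compose)
      moreover have "(\<psi> (\<xi> + - \<delta> n) - \<psi> \<xi>) / (- \<delta> n) = (\<psi> \<xi> - \<psi> (\<xi> - \<delta> n)) / \<delta> n" for n
        by (simp add: minus_divide_left flip: minus_divide_right)
      ultimately show "(\<lambda>n. (\<psi> \<xi> - \<psi> (\<xi> - \<delta> n)) / \<delta> n) \<longlonglongrightarrow> \<psi>' \<xi>" by simp
    qed
    show "AE \<xi> in lborel. norm (?F \<xi> * ((\<psi> \<xi> - \<psi> (\<xi> - \<delta> n)) / \<delta> n)) \<le> (A * X) * indicator {-(N+1)..N+1} \<xi>" for n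
    proof (rule AE_I2)
      fix \<xi> :: real
      show "norm (?F \<xi> * ((\<psi> \<xi> - \<psi> (\<xi> - \<delta> n)) / \<delta> n)) \<le> (A * X) * indicator {-(N+1)..N+1} \<xi>"
      proof (cases "\<bar>\<xi>\<bar> \<le> N + 1")
        case True
        have "\<bar>(\<psi> \<xi> - \<psi> (\<xi> - \<delta> n)) / \<delta> n\<bar> \<le> X"
          using quot[OF \<delta>(1), of \<xi> n] \<delta>(1)[of n] by (simp add: pos_divide_le_eq)
        then have "\<bar>?F \<xi>\<bar> * \<bar>(\<psi> \<xi> - \<psi> (\<xi> - \<delta> n)) / \<delta> n\<bar> \<le> A * X"
          using FA[OF True] A0 by (intro mult_mono) auto
        moreover have "\<xi> \<in> {-(N+1)..N+1}" using True by auto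
        ultimately show ?thesis unfolding real_norm_def abs_mult by simp
      next
        case False
        then have "N \<le> \<bar>\<xi>\<bar>" "N \<le> \<bar>\<xi> - \<delta> n\<bar>" using \<delta>[of n] by linarith+
        then show ?thesis using N(2) A0 X(1)[of 0] by (simp add: indicator_def)
      qed
    qed
  qed measurable
  \<comment> \<open>The lower bound of \<open>drift_decrease\<close> equals \<open>\<bar>v \<xi> - k\<bar>\<close> in the limit, wherever \<open>v\<close> is continuous.\<close>
  let ?m = "\<lambda>n \<xi>. max 0 (max (v \<xi> - k) (k - v (\<xi> + \<delta> n)))"
  have mb: "\<bar>?m n \<xi>\<bar> \<le> rj" for n \<xi>
    using vin[of \<xi>] vin[of "\<xi> + \<delta> n"] k by auto
  have lim2: "(\<lambda>n. LINT \<xi> | lborel. ?m n \<xi> * \<psi> \<xi>) \<longlonglongrightarrow> (LINT \<xi> | lborel. \<bar>v \<xi> - k\<bar> * \<psi> \<xi>)"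
  proof (rule integral_dominated_convergence[where w = "\<lambda>\<xi>. rj * \<psi> \<xi>"])
    show "integrable lborel (\<lambda>\<xi>. rj * \<psi> \<xi>)"
      by (rule integrable_local[where R = N and A = rj and B = X]) (use X N \<psi>m k in auto)
    show "AE \<xi> in lborel. norm (?m n \<xi> * \<psi> \<xi>) \<le> rj * \<psi> \<xi>" for n
      unfolding real_norm_def abs_mult using mb \<psi>(3) by (intro AE_I2 mult_mono) (auto intro: order.trans)
    have "{\<xi>. \<not> isCont v \<xi>} \<in> null_sets lborel"
      by (rule countable_imp_null_set_lborel[OF mono_ctble_discont[OF minimizing_profile_mono[OF v]]])
    then have "AE \<xi> in lborel. isCont v \<xi>"
      using AE_not_in by force
    then show "AE \<xi> in lborel. (\<lambda>n. ?m n \<xi> * \<psi> \<xi>) \<longlonglongrightarrow> \<bar>v \<xi> - k\<bar> * \<psi> \<xi>"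
    proof eventually_elim
      case (elim \<xi>)
      have "(\<lambda>n. \<xi> + \<delta> n) \<longlonglongrightarrow> \<xi> + 0" by (intro tendsto_intros \<delta>lim)
      then have "(\<lambda>n. v (\<xi> + \<delta> n)) \<longlonglongrightarrow> v \<xi>"
        using isCont_tendsto_compose[OF elim] by simp
      then have "(\<lambda>n. ?m n \<xi> * \<psi> \<xi>) \<longlonglongrightarrow> max 0 (max (v \<xi> - k) (k - v \<xi>)) * \<psi> \<xi>"
        by (intro tendsto_intros)
      moreover have "max 0 (max (v \<xi> - k) (k - v \<xi>)) = \<bar>v \<xi> - k\<bar>" by (auto simp: max_def)
      ultimately show ?case by simp
    qed
  qed measurable
  have le: "(LINT \<xi> | lborel. ?m n \<xi> * \<psi> \<xi>) \<le> (LINT \<xi> | lborel. ?F \<xi> * ((\<psi> \<xi> - \<psi> (\<xi> - \<delta> n)) / \<delta> n))" for n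
  proof -
    have i1: "integrable lborel (\<lambda>\<xi>. ?F \<xi> * \<psi> \<xi>)"
      by (rule integrable_local[where R = N and A = A and B = X]) (use FA X N in auto)
    have i2: "integrable lborel (\<lambda>\<xi>. ?F (\<xi> + \<delta> n) * \<psi> \<xi>)"
    proof (rule integrable_local[where R = N and A = A and B = X])
      show "\<bar>?F (\<xi> + \<delta> n)\<bar> \<le> A" if "\<bar>\<xi>\<bar> \<le> N" for \<xi>
        by (rule FA) (use that \<delta>[of n] in linarith)
    qed (use X N in auto)
    have i3: "integrable lborel (\<lambda>\<xi>. ?F \<xi> * \<psi> (\<xi> - \<delta> n))"
    proof (rule integrable_local[where R = "N + 1" and A = A and B = X])
      show "\<psi> (\<xi> - \<delta> n) = 0" if "N + 1 \<le> \<bar>\<xi>\<bar>" for \<xi>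
        by (rule N) (use that \<delta>[of n] in linarith)
    qed (use X FA in auto)
    have shift: "(LINT \<xi> | lborel. ?F \<xi> * \<psi> (\<xi> - \<delta> n)) = (LINT \<xi> | lborel. ?F (\<xi> + \<delta> n) * \<psi> \<xi>)"
      by (subst lborel_integral_real_affine[of 1 _ "\<delta> n"]) (simp_all add: add.commute)
    have "(LINT \<xi> | lborel. ?m n \<xi> * \<psi> \<xi>) \<le> (LINT \<xi> | lborel. (?F \<xi> * \<psi> \<xi> - ?F (\<xi> + \<delta> n) * \<psi> \<xi>) / \<delta> n)"
    proof (rule integral_mono)
      show "integrable lborel (\<lambda>\<xi>. ?m n \<xi> * \<psi> \<xi>)"
        by (rule integrable_local[where R = N and A = rj and B = X]) (use mb X N in auto)
      show "integrable lborel (\<lambda>\<xi>. (?F \<xi> * \<psi> \<xi> - ?F (\<xi> + \<delta> n) * \<psi> \<xi>) / \<delta> n)"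
        using i1 i2 by simp
      show "?m n \<xi> * \<psi> \<xi> \<le> (?F \<xi> * \<psi> \<xi> - ?F (\<xi> + \<delta> n) * \<psi> \<xi>) / \<delta> n" for \<xi>
      proof -
        have "\<delta> n * ?m n \<xi> * \<psi> \<xi> \<le> (?F \<xi> - ?F (\<xi> + \<delta> n)) * \<psi> \<xi>"
          by (intro mult_right_mono drift_decrease[OF v \<delta>(1)] \<psi>)
        then show ?thesis using \<delta>(1)[of n] by (simp add: field_simps)
      qed
    qed
    also have "\<dots> = ((LINT \<xi> | lborel. ?F \<xi> * \<psi> \<xi>) - (LINT \<xi> | lborel. ?F \<xi> * \<psi> (\<xi> - \<delta> n))) / \<delta> n"
      using i1 i2 shift by simp
    also have "\<dots> = (LINT \<xi> | lborel. (?F \<xi> * \<psi> \<xi> - ?F \<xi> * \<psi> (\<xi> - \<delta> n)) / \<delta> n)"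
      using i1 i3 by simp
    also have "\<dots> = (LINT \<xi> | lborel. ?F \<xi> * ((\<psi> \<xi> - \<psi> (\<xi> - \<delta> n)) / \<delta> n))"
      by (simp add: right_diff_distrib)
    finally show ?thesis .
  qed
  show ?thesis by (rule LIMSEQ_le[OF lim2 lim1]) (use le in auto)
qed

text \<open>
  For large \<open>\<bar>\<xi>\<bar>\<close> the linear term dominates and pushes the minimizer to an end point.
\<close>

lemma minimizing_profile_bounds:
  assumes v: "minimizing_profile Q a b v" and "a \<le> b" and M: "\<And>r. r \<in> {a..b} \<Longrightarrow> \<bar>Q r\<bar> \<le> M"
  shows "0 < \<xi> \<Longrightarrow> \<bar>v \<xi> - b\<bar> \<le> 2 * M / \<xi>" and "\<xi> < 0 \<Longrightarrow> \<bar>v \<xi> - a\<bar> \<le> 2 * M / (- \<xi>)"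
proof -
  have vin: "v \<xi> \<in> {a..b}" and le: "\<And>r. r \<in> {a..b} \<Longrightarrow> Q (v \<xi>) - \<xi> * v \<xi> \<le> Q r - \<xi> * r"
    using v unfolding minimizing_profile_def by blast+
  have ab: "a \<in> {a..b}" "b \<in> {a..b}" using \<open>a \<le> b\<close> by auto
  show "\<bar>v \<xi> - b\<bar> \<le> 2 * M / \<xi>" if "0 < \<xi>"
  proof -
    have "\<xi> * (b - v \<xi>) \<le> 2 * M"
      using le[OF ab(2)] M[OF vin] M[OF ab(2)] unfolding right_diff_distrib by linarith
    then show ?thesis using vin that by (simp add: pos_le_divide_eq mult.commute)
  qed
  show "\<bar>v \<xi> - a\<bar> \<le> 2 * M / (- \<xi>)" if "\<xi> < 0"
  proof -
    have "- \<xi> * (v \<xi> - a) \<le> 2 * M"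
      using le[OF ab(1)] M[OF vin] M[OF ab(1)] unfolding right_diff_distrib by (simp add: algebra_simps)
    then have "v \<xi> - a \<le> 2 * M / (- \<xi>)" using that by (simp add: pos_le_divide_eq mult.commute del: divide_minus_right)
    then show ?thesis using vin by simp
  qed
qed

lemma minimizing_profile_trace:
  assumes v: "minimizing_profile Q a b v" and "a \<le> b" and M: "\<And>r. r \<in> {a..b} \<Longrightarrow> \<bar>Q r\<bar> \<le> M" and x: "x \<noteq> 0"
  shows "(\<lambda>n. v (x / (1 / (real n + 1)))) \<longlonglongrightarrow> riemann_data a b x"
proof (rule LIM_zero_cancel, rule Lim_null_comparison)
  have "(\<lambda>n. 2 * M / \<bar>x\<bar> * inverse (real (Suc n))) \<longlonglongrightarrow> 2 * M / \<bar>x\<bar> * 0"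
    by (intro tendsto_intros LIMSEQ_inverse_real_of_nat)
  then show "(\<lambda>n. 2 * M / \<bar>x\<bar> * inverse (real (Suc n))) \<longlonglongrightarrow> 0" by simp
  show "\<forall>\<^sub>F n in sequentially. norm (v (x / (1 / (real n + 1))) - riemann_data a b x) \<le> 2 * M / \<bar>x\<bar> * inverse (real (Suc n))"
  proof (rule always_eventually, rule allI)
    fix n
    have e: "x / (1 / (real n + 1)) = x * (real n + 1)" by simp
    show "norm (v (x / (1 / (real n + 1))) - riemann_data a b x) \<le> 2 * M / \<bar>x\<bar> * inverse (real (Suc n))"
    proof (cases "0 < x")
      case True
      then show ?thesis
        using minimizing_profile_bounds(1)[OF v \<open>a \<le> b\<close> M, of "x * (real n + 1)"]
        by (simp add: e riemann_data_def divide_inverse mult_ac add.commute)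
    next
      case False
      then have "x < 0" using x by simp
      then have "x * (real n + 1) < 0" by (simp add: mult_neg_pos)
      with \<open>x < 0\<close> show ?thesis
        using minimizing_profile_bounds(2)[OF v \<open>a \<le> b\<close> M, of "x * (real n + 1)"]
        by (simp add: e riemann_data_def divide_inverse mult_ac add.commute)
    qed
  qed
qed

text \<open>
  In the variables \<open>\<xi> = x / t\<close> and \<open>t\<close>, the inequality \<open>profile_inequality\<close> at fixed time \<open>t\<close> replaces
  the integrand by \<open>\<bar>v \<xi> - k\<bar>\<close> times the time derivative \<open>D\<close> of \<open>t * \<phi> (t * \<xi>) t\<close>. Integrating over
  \<open>t > \<epsilon>\<close> first leaves the boundary term at \<open>t = \<epsilon>\<close>. The change of variables is singular at
  \<open>t = 0\<close>, hence the restriction to \<open>t > \<epsilon>\<close>.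
\<close>

lemma profile_entropy_after:
  assumes Q: "continuous_on {0..rj} Q" and ab: "0 \<le> a" "a \<le> b" "b \<le> rj" and k: "k \<in> {0..rj}"
    and v: "minimizing_profile Q a b v" and tf: "test_function \<phi> \<phi>x \<phi>t" and e: "0 < \<epsilon>"
    and int: "set_integrable lborel (UNIV \<times> {\<epsilon><..})
      (\<lambda>(x, t). \<bar>v (x / t) - k\<bar> * \<phi>t x t + sgn (v (x / t) - k) * (Q (v (x / t)) - Q k) * \<phi>x x t)"
  shows "- (LINT x | lborel. \<bar>v (x / \<epsilon>) - k\<bar> * \<phi> x \<epsilon>) \<le>
    (LINT (x, t) : UNIV \<times> {\<epsilon><..} | lborel.
      \<bar>v (x / t) - k\<bar> * \<phi>t x t + sgn (v (x / t) - k) * (Q (v (x / t)) - Q k) * \<phi>x x t)"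
proof -
  let ?\<eta> = "\<lambda>\<xi>. \<bar>v \<xi> - k\<bar>" and ?q = "\<lambda>\<xi>. sgn (v \<xi> - k) * (Q (v \<xi>) - Q k)"
  note vin = minimizing_profile_range[OF v ab(1,3)]
  note vm [measurable] = minimizing_profile_measurable[OF v]
  obtain M where M: "0 \<le> M" "\<And>r. r \<in> {0..rj} \<Longrightarrow> \<bar>Q r\<bar> \<le> M"
    using continuous_flux_bounded[OF Q] by blast
  note Qv [measurable] = minimizing_profile_flux_measurable[OF Q ab(1,3) v]
  have \<eta>m [measurable]: "?\<eta> \<in> borel_measurable borel" and qm [measurable]: "?q \<in> borel_measurable borel"
    by measurable
  have \<eta>b: "\<bar>?\<eta> \<xi>\<bar> \<le> rj" for \<xi> using vin[of \<xi>] k by auto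
  have qb: "\<bar>?q \<xi>\<bar> \<le> 2 * M" for \<xi>
    using M(2)[OF vin[of \<xi>]] M(2)[OF k] M(1) by (auto simp: sgn_if)
  obtain R where R: "R > 0" "\<And>x t. R \<le> \<bar>x\<bar> \<or> R \<le> \<bar>t\<bar> \<Longrightarrow> \<phi> x t = 0 \<and> \<phi>x x t = 0 \<and> \<phi>t x t = 0"
    using test_function_support[OF tf] by metis
  obtain B where B: "\<And>x t. \<bar>\<phi> x t\<bar> \<le> B" "\<And>x t. \<bar>\<phi>x x t\<bar> \<le> B" "\<And>x t. \<bar>\<phi>t x t\<bar> \<le> B"
    using test_function_bounded[OF tf] by metis
  have cx: "continuous_on UNIV (\<lambda>(x, t). \<phi>x x t)" and ct: "continuous_on UNIV (\<lambda>(x, t). \<phi>t x t)"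
    and nn: "\<And>x t. 0 \<le> \<phi> x t"
    and dx: "\<And>x t. ((\<lambda>y. \<phi> y t) has_real_derivative \<phi>x x t) (at x)"
    using tf unfolding test_function_def by blast+
  have comp: "continuous_on UNIV (\<lambda>z. f (g z) (h z))"
    if "continuous_on UNIV (\<lambda>(x, t). f x t)" "continuous_on UNIV g" "continuous_on UNIV h"
    for f :: "real \<Rightarrow> real \<Rightarrow> real" and g h :: "'z::topological_space \<Rightarrow> real"
    using continuous_on_compose2[OF that(1), of UNIV "\<lambda>z. (g z, h z)"] that(2,3) by (simp add: continuous_on_Pair)
  define D where "D \<xi> t = \<phi> (t * \<xi>) t + t * (\<phi>t (t * \<xi>) t + \<xi> * \<phi>x (t * \<xi>) t)" for \<xi> t
  have Dc: "continuous_on UNIV (\<lambda>z. D (fst z) (snd z))"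
  proof -
    have s: "continuous_on UNIV (\<lambda>z::real \<times> real. snd z * fst z)" "continuous_on UNIV (\<lambda>z::real \<times> real. snd z)"
      "continuous_on UNIV (\<lambda>z::real \<times> real. fst z)"
      by (intro continuous_intros)+
    show ?thesis
      unfolding D_def
      by (intro continuous_on_add continuous_on_mult s comp[OF cx s(1,2)] comp[OF ct s(1,2)]
          comp[OF test_function_continuous[OF tf] s(1,2)])
  qed
  have Dd: "((\<lambda>t. t * \<phi> (t * \<xi>) t) has_real_derivative D \<xi> t) (at t)" for \<xi> t
  proof -
    have "((\<lambda>t. (t * \<xi>, t)) has_derivative (\<lambda>h. (h * \<xi>, h))) (at t)"
      by (auto intro!: derivative_eq_intros)
    note chain = has_derivative_compose[OF this test_function_has_derivative[OF tf]]
    have eq: "(*) (\<phi>t (t * \<xi>) t + \<xi> * \<phi>x (t * \<xi>) t)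
        = (\<lambda>h. \<phi>x (t * \<xi>) t * (h * \<xi>) + \<phi>t (t * \<xi>) t * h)"
      by (simp add: fun_eq_iff algebra_simps)
    from chain have "((\<lambda>t. \<phi> (t * \<xi>) t) has_real_derivative (\<phi>t (t * \<xi>) t + \<xi> * \<phi>x (t * \<xi>) t)) (at t)"
      unfolding has_field_derivative_def eq by simp
    from DERIV_mult[OF DERIV_ident this] show ?thesis by (simp add: D_def algebra_simps)
  qed
  have D0: "D \<xi> t = 0" if "R \<le> t" for \<xi> t
    using R(2)[of "t * \<xi>" t] that R(1) by (simp add: D_def)
  have intD: "set_integrable lborel (UNIV \<times> {\<epsilon><..}) (\<lambda>(\<xi>, t). ?\<eta> \<xi> * D \<xi> t)"
    unfolding set_integrable_def
  proof (rule integrableI_bounded_set[where A = "{-R/\<epsilon>..R/\<epsilon>} \<times> {0..R}" and B = "rj * (B + R * (B + R / \<epsilon> * B))"])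
    have "(\<lambda>z::real \<times> real. ?\<eta> (fst z)) \<in> borel_measurable borel"
      unfolding borel_prod[symmetric] by measurable
    then have "(\<lambda>z. ?\<eta> (fst z) * D (fst z) (snd z)) \<in> borel_measurable borel"
      by (intro borel_measurable_times borel_measurable_continuous_onI[OF Dc])
    moreover have "UNIV \<times> {\<epsilon><..} \<in> sets (borel :: (real \<times> real) measure)"
      by (intro borel_open open_Times) auto
    ultimately show "(\<lambda>z. indicat_real (UNIV \<times> {\<epsilon><..}) z *\<^sub>R (case z of (\<xi>, t) \<Rightarrow> ?\<eta> \<xi> * D \<xi> t)) \<in> borel_measurable lborel"
      by (simp add: case_prod_unfold)
    show "{-R/\<epsilon>..R/\<epsilon>} \<times> {0..R} \<in> sets lborel" by (simp add: borel_closed closed_Times)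
    show "emeasure lborel ({-R/\<epsilon>..R/\<epsilon>} \<times> {0..R}) < \<infinity>" by (rule emeasure_lborel_rectangle_finite)
    show "AE z in lborel. z \<in> {-R/\<epsilon>..R/\<epsilon>} \<times> {0..R} \<longrightarrow>
        norm (indicat_real (UNIV \<times> {\<epsilon><..}) z *\<^sub>R (case z of (\<xi>, t) \<Rightarrow> ?\<eta> \<xi> * D \<xi> t)) \<le> rj * (B + R * (B + R / \<epsilon> * B))"
    proof (intro AE_I2 impI)
      fix z :: "real \<times> real" assume z: "z \<in> {-R/\<epsilon>..R/\<epsilon>} \<times> {0..R}"
      obtain \<xi> t where zz: "z = (\<xi>, t)" by force
      have t: "0 \<le> t" "t \<le> R" "\<bar>\<xi>\<bar> \<le> R / \<epsilon>" using z zz by auto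
      have B0: "0 \<le> B" using B(1)[of 0 0] by linarith
      have 1: "\<bar>\<xi> * \<phi>x (t * \<xi>) t\<bar> \<le> R / \<epsilon> * B" unfolding abs_mult using t B B0 R(1) e by (intro mult_mono) auto
      have "\<bar>\<phi>t (t * \<xi>) t + \<xi> * \<phi>x (t * \<xi>) t\<bar> \<le> B + R / \<epsilon> * B"
        using 1 B(3)[of "t * \<xi>" t] by linarith
      then have "\<bar>t * (\<phi>t (t * \<xi>) t + \<xi> * \<phi>x (t * \<xi>) t)\<bar> \<le> R * (B + R / \<epsilon> * B)"
        unfolding abs_mult using t R(1) by (intro mult_mono) auto
      then have "\<bar>D \<xi> t\<bar> \<le> B + R * (B + R / \<epsilon> * B)"
        unfolding D_def using B(1)[of "t * \<xi>" t] by linarith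
      then have "\<bar>?\<eta> \<xi> * D \<xi> t\<bar> \<le> rj * (B + R * (B + R / \<epsilon> * B))"
        unfolding abs_mult using \<eta>b[of \<xi>] by (intro mult_mono) auto
      then show "norm (indicat_real (UNIV \<times> {\<epsilon><..}) z *\<^sub>R (case z of (\<xi>, t) \<Rightarrow> ?\<eta> \<xi> * D \<xi> t)) \<le> rj * (B + R * (B + R / \<epsilon> * B))"
        using abs_ge_zero[of "?\<eta> \<xi> * D \<xi> t"] by (auto simp: zz indicator_def)
    qed
    have zero: "?\<eta> \<xi> * D \<xi> t = 0" if "(\<xi>, t) \<notin> {-R/\<epsilon>..R/\<epsilon>} \<times> {0..R}" "\<epsilon> < t" for \<xi> t
    proof (cases "R \<le> t")
      case False
      then have "\<not> \<bar>\<xi>\<bar> \<le> R / \<epsilon>" using that e by (auto simp: abs_le_iff)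
      then have "R < \<epsilon> * \<bar>\<xi>\<bar>" using e by (simp add: field_simps)
      also have "\<dots> \<le> t * \<bar>\<xi>\<bar>" using that(2) by (intro mult_right_mono) auto
      finally have "R \<le> \<bar>t * \<xi>\<bar>" using that(2) e by (simp add: abs_mult)
      then show ?thesis using R(2)[of "t * \<xi>" t] by (simp add: D_def)
    qed (simp add: D0)
    show "AE z in lborel. z \<notin> {-R/\<epsilon>..R/\<epsilon>} \<times> {0..R} \<longrightarrow>
        indicat_real (UNIV \<times> {\<epsilon><..}) z *\<^sub>R (case z of (\<xi>, t) \<Rightarrow> ?\<eta> \<xi> * D \<xi> t) = 0"
    proof (intro AE_I2 impI)
      fix z :: "real \<times> real" assume z: "z \<notin> {-R/\<epsilon>..R/\<epsilon>} \<times> {0..R}"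
      obtain \<xi> t where zz: "z = (\<xi>, t)" by force
      show "indicat_real (UNIV \<times> {\<epsilon><..}) z *\<^sub>R (case z of (\<xi>, t) \<Rightarrow> ?\<eta> \<xi> * D \<xi> t) = 0"
        using zero[OF z[unfolded zz]] unfolding zz prod.case by (cases "\<epsilon> < t") simp_all
    qed
  qed
  \<comment> \<open>After substituting \<open>x = t * \<xi>\<close>, the summand \<open>\<xi> * \<eta>\<close> by which \<open>drift\<close> differs from \<open>q\<close> supplies the \<open>\<xi> * \<phi>x\<close> in \<open>D\<close>.\<close>
  have slice: "(LINT \<xi> | lborel. ?\<eta> \<xi> * D \<xi> t) \<le> (LINT x | lborel. ?\<eta> (x / t) * \<phi>t x t + ?q (x / t) * \<phi>x x t)"
    if t: "\<epsilon> < t" for t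
  proof -
    have t0: "0 < t" using t e by linarith
    let ?\<psi> = "\<lambda>\<xi>. \<phi> (t * \<xi>) t" and ?\<psi>x = "\<lambda>\<xi>. \<phi>x (t * \<xi>) t" and ?\<psi>t = "\<lambda>\<xi>. \<phi>t (t * \<xi>) t"
    have supp: "?\<psi> \<xi> = 0 \<and> ?\<psi>x \<xi> = 0 \<and> ?\<psi>t \<xi> = 0" if "R / t \<le> \<bar>\<xi>\<bar>" for \<xi>
    proof -
      have "R \<le> \<bar>t * \<xi>\<bar>" using that t0 by (simp add: abs_mult field_simps)
      then show ?thesis using R(2) by blast
    qed
    have c1: "continuous_on UNIV ?\<psi>x" "continuous_on UNIV ?\<psi>t" "continuous_on UNIV ?\<psi>"
      by (rule comp[OF cx] comp[OF ct] comp[OF test_function_continuous[OF tf]]; intro continuous_intros)+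
    note m1 [measurable] = c1[THEN borel_measurable_continuous_onI]
    have "(LINT \<xi> | lborel. ?\<eta> \<xi> * ?\<psi> \<xi>) \<le> (LINT \<xi> | lborel. drift Q v k \<xi> * (t * ?\<psi>x \<xi>))"
    proof (rule profile_inequality[OF Q ab k v, where X = "B + t * B" and N = "R / t"])
      show "(?\<psi> has_real_derivative t * ?\<psi>x \<xi>) (at \<xi>)" for \<xi>
        using DERIV_chain2[OF dx DERIV_cmult[OF DERIV_ident], of t t \<xi> UNIV] by (simp add: mult.commute)
      show "continuous_on UNIV (\<lambda>\<xi>. t * ?\<psi>x \<xi>)" by (intro continuous_intros c1)
      have B0: "0 \<le> B" using B(1)[of 0 0] by linarith
      show "\<bar>t * ?\<psi>x \<xi>\<bar> \<le> B + t * B" for \<xi>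
      proof -
        have "\<bar>t\<bar> * \<bar>?\<psi>x \<xi>\<bar> \<le> t * B" using t0 B(2) by (intro mult_mono) auto
        then show ?thesis unfolding abs_mult using B0 by linarith
      qed
      show "\<bar>?\<psi> \<xi>\<bar> \<le> B + t * B" for \<xi>
        using B(1)[of "t * \<xi>" t] mult_nonneg_nonneg[of t B] t0 B0 by linarith
    qed (use nn supp R(1) t0 in auto)
    moreover have il: "integrable lborel (\<lambda>\<xi>. ?\<eta> \<xi> * ?\<psi> \<xi>)" "integrable lborel (\<lambda>\<xi>. ?\<eta> \<xi> * ?\<psi>t \<xi>)"
      "integrable lborel (\<lambda>\<xi>. ?q \<xi> * ?\<psi>x \<xi>)"
      using integrable_local[OF \<eta>m m1(3) \<eta>b B(1), of "R / t"] integrable_local[OF \<eta>m m1(2) \<eta>b B(3), of "R / t"]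
        integrable_local[OF qm m1(1) qb B(2), of "R / t"] supp by blast+
    moreover have i4: "integrable lborel (\<lambda>\<xi>. (\<xi> * ?\<eta> \<xi>) * ?\<psi>x \<xi>)"
    proof (rule integrable_local[where R = "R / t" and B = B and A = "R / t * rj"])
      show "\<bar>\<xi> * ?\<eta> \<xi>\<bar> \<le> R / t * rj" if "\<bar>\<xi>\<bar> \<le> R / t" for \<xi>
        unfolding abs_mult using that \<eta>b[of \<xi>] by (intro mult_mono) auto
    qed (use supp B in auto)
    moreover have "(LINT \<xi> | lborel. drift Q v k \<xi> * (t * ?\<psi>x \<xi>))
        = t * (LINT \<xi> | lborel. ?q \<xi> * ?\<psi>x \<xi>) - t * (LINT \<xi> | lborel. (\<xi> * ?\<eta> \<xi>) * ?\<psi>x \<xi>)"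
    proof -
      have "(LINT \<xi> | lborel. drift Q v k \<xi> * (t * ?\<psi>x \<xi>))
          = (LINT \<xi> | lborel. t * (?q \<xi> * ?\<psi>x \<xi>) - t * ((\<xi> * ?\<eta> \<xi>) * ?\<psi>x \<xi>))"
        by (rule Bochner_Integration.integral_cong) (auto simp: drift_def algebra_simps)
      then show ?thesis using il(3) i4 by simp
    qed
    moreover have "(LINT \<xi> | lborel. ?\<eta> \<xi> * D \<xi> t) = (LINT \<xi> | lborel. ?\<eta> \<xi> * ?\<psi> \<xi>)
        + t * (LINT \<xi> | lborel. ?\<eta> \<xi> * ?\<psi>t \<xi>) + t * (LINT \<xi> | lborel. (\<xi> * ?\<eta> \<xi>) * ?\<psi>x \<xi>)"
    proof -
      have "(LINT \<xi> | lborel. ?\<eta> \<xi> * D \<xi> t) = (LINT \<xi> | lborel. (?\<eta> \<xi> * ?\<psi> \<xi> + t * (?\<eta> \<xi> * ?\<psi>t \<xi>)) + t * ((\<xi> * ?\<eta> \<xi>) * ?\<psi>x \<xi>))"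
        by (rule Bochner_Integration.integral_cong) (auto simp: D_def algebra_simps)
      then show ?thesis using il(1,2) i4 by simp
    qed
    moreover have "(LINT x | lborel. ?\<eta> (x / t) * \<phi>t x t + ?q (x / t) * \<phi>x x t)
        = t * (LINT \<xi> | lborel. ?\<eta> \<xi> * ?\<psi>t \<xi>) + t * (LINT \<xi> | lborel. ?q \<xi> * ?\<psi>x \<xi>)"
    proof -
      have "(LINT x | lborel. ?\<eta> (x / t) * \<phi>t x t + ?q (x / t) * \<phi>x x t)
          = \<bar>t\<bar> *\<^sub>R (LINT \<xi> | lborel. ?\<eta> ((0 + t * \<xi>) / t) * \<phi>t (0 + t * \<xi>) t + ?q ((0 + t * \<xi>) / t) * \<phi>x (0 + t * \<xi>) t)"
        using t0 by (intro lborel_integral_real_affine) simp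
      also have "\<dots> = t * (LINT \<xi> | lborel. ?\<eta> \<xi> * ?\<psi>t \<xi> + ?q \<xi> * ?\<psi>x \<xi>)"
        using t0 by simp
      finally show ?thesis using il(2,3) by (simp add: distrib_left)
    qed
    ultimately show ?thesis by linarith
  qed
  have "- (LINT x | lborel. ?\<eta> (x / \<epsilon>) * \<phi> x \<epsilon>) = (LINT \<xi> | lborel. - (\<epsilon> * (?\<eta> \<xi> * \<phi> (\<epsilon> * \<xi>) \<epsilon>)))"
    using e by (subst lborel_integral_real_affine[of \<epsilon> _ 0]) simp_all
  also have "\<dots> = (LINT \<xi> | lborel. (LINT t : {\<epsilon><..} | lborel. ?\<eta> \<xi> * D \<xi> t))"
  proof (rule Bochner_Integration.integral_cong[OF refl])
    fix \<xi> :: real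
    have "(LINT t : {\<epsilon><..} | lborel. D \<xi> t) = - (\<epsilon> * \<phi> (\<epsilon> * \<xi>) \<epsilon>)"
    proof (rule integral_derivative_half_line[OF Dd])
      have "continuous_on UNIV (\<lambda>t. (\<xi>, t))" by (intro continuous_intros)
      from continuous_on_compose2[OF Dc this] show "continuous_on UNIV (D \<xi>)" by simp
      show "t * \<phi> (t * \<xi>) t = 0" if "R \<le> t" for t using R(2)[of "t * \<xi>" t] that R(1) by simp
    qed (rule D0)
    then show "- (\<epsilon> * (?\<eta> \<xi> * \<phi> (\<epsilon> * \<xi>) \<epsilon>)) = (LINT t : {\<epsilon><..} | lborel. ?\<eta> \<xi> * D \<xi> t)" by simp
  qed
  also have "\<dots> = (LINT t : {\<epsilon><..} | lborel. (LINT \<xi> | lborel. ?\<eta> \<xi> * D \<xi> t))"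
    using set_Times_Fubini(1,2)[OF intD] by simp
  also have "\<dots> \<le> (LINT t : {\<epsilon><..} | lborel. (LINT x | lborel. ?\<eta> (x / t) * \<phi>t x t + ?q (x / t) * \<phi>x x t))"
    by (rule set_integral_mono[OF set_Times_Fubini(3)[OF intD] set_Times_Fubini(3)[OF int]]) (use slice in auto)
  also have "\<dots> = (LINT (x, t) : UNIV \<times> {\<epsilon><..} | lborel. ?\<eta> (x / t) * \<phi>t x t + ?q (x / t) * \<phi>x x t)"
    using set_Times_Fubini(2)[OF int] by simp
  finally show ?thesis .
qed

lemma minimizing_profile_solution:
  assumes Q: "continuous_on {0..rj} Q" and ab: "0 \<le> a" "a \<le> b" "b \<le> rj" and v: "minimizing_profile Q a b v"
  shows "riemann_solution Q rj a b v"
  unfolding riemann_solution_def entropy_solution_def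
proof (intro conjI allI ballI impI)
  note vin = minimizing_profile_range[OF v ab(1,3)]
  show "v (x / t) \<in> {0..rj}" for x t by (rule vin)
  note vm [measurable] = minimizing_profile_measurable[OF v]
  have H: "UNIV \<times> {0<..} \<in> sets (borel :: (real \<times> real) measure)"
    using half_plane_sets by simp
  have "(\<lambda>z::real \<times> real. v (fst z / snd z)) \<in> borel_measurable borel"
    unfolding borel_prod[symmetric] by measurable
  then show sm: "set_borel_measurable lborel (UNIV \<times> {0<..}) (\<lambda>(x, t). v (x / t))"
    unfolding set_borel_measurable_def using H by (simp add: case_prod_unfold)
  fix k \<phi> \<phi>x \<phi>t assume k: "k \<in> {0..rj}" and tf: "test_function \<phi> \<phi>x \<phi>t"
  obtain M where M: "0 \<le> M" "\<And>r. r \<in> {0..rj} \<Longrightarrow> \<bar>Q r\<bar> \<le> M"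
    using continuous_flux_bounded[OF Q] by blast
  have Mab: "\<bar>Q r\<bar> \<le> M" if "r \<in> {a..b}" for r using M(2) that ab by auto
  let ?G = "\<lambda>(x, t). \<bar>v (x / t) - k\<bar> * \<phi>t x t + sgn (v (x / t) - k) * (Q (v (x / t)) - Q k) * \<phi>x x t"
  let ?H = "\<lambda>n::nat. UNIV \<times> {1 / (real n + 1)<..} :: (real \<times> real) set"
  have Qm: "Q \<in> borel_measurable (restrict_space borel {0..rj})"
    using borel_measurable_continuous_on_restrict[OF Q] .
  have id: "(\<lambda>r::real. r) \<in> borel_measurable (restrict_space borel {0..rj})"
    by (rule measurable_restrict_space1) simp
  have f1: "bounded_field (\<lambda>x t. \<bar>v (x / t) - k\<bar>)"
    by (rule bounded_field_compose[OF sm, of "{0..rj}" "\<lambda>r. \<bar>r - k\<bar>" rj]) (use vin k id in auto)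
  have "\<bar>sgn (r - k) * (Q r - Q k)\<bar> \<le> 2 * M" if "r \<in> {0..rj}" for r
    using M(2)[OF that] M(2)[OF k] M(1) by (auto simp: sgn_if)
  then have f2: "bounded_field (\<lambda>x t. sgn (v (x / t) - k) * (Q (v (x / t)) - Q k))"
    by (intro bounded_field_compose[OF sm, of "{0..rj}" "\<lambda>r. sgn (r - k) * (Q r - Q k)" "2 * M"])
      (use vin Qm id in \<open>auto intro!: borel_measurable_times borel_measurable_diff\<close>)
  have int: "set_integrable lborel (UNIV \<times> {0<..}) ?G"
    using set_integral_add(1)[OF set_integrable_test_function(2)[OF f1 tf] set_integrable_test_function(1)[OF f2 tf]]
    by (simp add: case_prod_unfold)
  have un: "(\<Union>n. ?H n) = UNIV \<times> {0<..}"
  proof (intro equalityI subsetI)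
    fix z :: "real \<times> real" assume "z \<in> UNIV \<times> {0<..}"
    then obtain x t where z: "z = (x, t)" "0 < t" by auto
    obtain n where "inverse (real (Suc n)) < t" using reals_Archimedean[OF z(2)] by blast
    then have "1 / (real n + 1) < t" by (simp add: inverse_eq_divide add.commute)
    then show "z \<in> (\<Union>n. ?H n)" using z by auto
  next
    fix z assume "z \<in> (\<Union>n. ?H n)"
    then obtain n x t where z: "z = (x, t)" "1 / (real n + 1) < t" by auto
    have "0 < 1 / (real n + 1)" by simp
    with z(2) have "0 < t" by (rule order.strict_trans[rotated])
    then show "z \<in> UNIV \<times> {0<..}" by (simp add: z)
  qed
  have Hs: "?H n \<in> sets lborel" for n
    by (auto intro!: borel_open open_Times)
  have intn: "set_integrable lborel (?H n) ?G" for n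
    by (rule set_integrable_subset[OF int Hs]) (auto intro: order.strict_trans[of 0 "1 / (real n + 1)"])
  have lim1: "(\<lambda>n. set_lebesgue_integral lborel (?H n) ?G) \<longlonglongrightarrow> set_lebesgue_integral lborel (UNIV \<times> {0<..}) ?G"
    unfolding un[symmetric]
  proof (rule set_integral_cont_up[OF Hs])
    show "incseq ?H"
      unfolding incseq_def
    proof (intro allI impI Sigma_mono subset_refl)
      fix m n :: nat assume "m \<le> n"
      then have "1 / (real n + 1) \<le> 1 / (real m + 1)" by (intro divide_left_mono) auto
      then show "{1 / (real m + 1)<..} \<subseteq> {1 / (real n + 1)<..}" by auto
    qed
    show "set_integrable lborel (\<Union>n. ?H n) ?G" unfolding un by (rule int)
  qed
  let ?B = "\<lambda>n::nat. LINT x | lborel. \<bar>v (x / (1 / (real n + 1))) - k\<bar> * \<phi> x (1 / (real n + 1))"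
  obtain R where R: "R > 0" "\<And>x t. R \<le> \<bar>x\<bar> \<or> R \<le> \<bar>t\<bar> \<Longrightarrow> \<phi> x t = 0 \<and> \<phi>x x t = 0 \<and> \<phi>t x t = 0"
    using test_function_support[OF tf] by metis
  obtain B where B: "\<And>x t. \<bar>\<phi> x t\<bar> \<le> B"
    using test_function_bounded[OF tf] by metis
  have \<phi>c: "continuous_on UNIV (\<lambda>(x, t). \<phi> x t)" by (rule test_function_continuous[OF tf])
  have \<phi>m: "(\<lambda>x. \<phi> x t) \<in> borel_measurable borel" for t
    using measurable_compose[OF _ test_function_measurable(1)[OF tf], of "\<lambda>x. (x, t)" borel] by simp
  have um: "(riemann_data a b) \<in> borel_measurable borel" unfolding riemann_data_def[abs_def] by measurable
  have lim2: "?B \<longlonglongrightarrow> (LINT x | lborel. \<bar>riemann_data a b x - k\<bar> * \<phi> x 0)"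
  proof (rule integral_dominated_convergence[where w = "\<lambda>x. (rj * B) * indicator {-R..R} x"])
    show "integrable lborel (\<lambda>x. (rj * B) * indicator {-R..R} x)"
      using R(1) by (simp add: integrable_indicator_iff)
    show "AE x in lborel. norm (\<bar>v (x / (1 / (real n + 1))) - k\<bar> * \<phi> x (1 / (real n + 1))) \<le> (rj * B) * indicator {-R..R} x" for n
    proof (rule AE_I2)
      fix x
      show "norm (\<bar>v (x / (1 / (real n + 1))) - k\<bar> * \<phi> x (1 / (real n + 1))) \<le> (rj * B) * indicator {-R..R} x"
      proof (cases "x \<in> {-R..R}")
        case True
        have "\<bar>\<bar>v (x / (1 / (real n + 1))) - k\<bar>\<bar> \<le> rj" using vin[of "x / (1 / (real n + 1))"] k by auto
        then have "\<bar>\<bar>v (x / (1 / (real n + 1))) - k\<bar>\<bar> * \<bar>\<phi> x (1 / (real n + 1))\<bar> \<le> rj * B"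
          using B k by (intro mult_mono) auto
        then show ?thesis using True unfolding real_norm_def abs_mult by simp
      next
        case False
        then have "R \<le> \<bar>x\<bar>" by auto
        then show ?thesis using R(2)[of x] False by simp
      qed
    qed
    have "AE x in lborel. x \<noteq> (0::real)" by (rule AE_lborel_singleton)
    then show "AE x in lborel. (\<lambda>n. \<bar>v (x / (1 / (real n + 1))) - k\<bar> * \<phi> x (1 / (real n + 1)))
        \<longlonglongrightarrow> \<bar>riemann_data a b x - k\<bar> * \<phi> x 0"
    proof eventually_elim
      case (elim x)
      have "(\<lambda>n. (x, 1 / (real n + 1))) \<longlonglongrightarrow> (x, 0)"
        using LIMSEQ_inverse_real_of_nat by (intro tendsto_Pair tendsto_const) (simp add: inverse_eq_divide add.commute)
      moreover have "isCont (\<lambda>(x, t). \<phi> x t) (x, 0)" using \<phi>c by (simp add: continuous_on_eq_continuous_at)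
      ultimately have "(\<lambda>n. \<phi> x (1 / (real n + 1))) \<longlonglongrightarrow> \<phi> x 0"
        using isCont_tendsto_compose[of "(x, 0)" "\<lambda>(x, t). \<phi> x t"] by fastforce
      then show ?case
        by (intro tendsto_intros minimizing_profile_trace[OF v ab(2) Mab elim])
    qed
    show "(\<lambda>x. \<bar>riemann_data a b x - k\<bar> * \<phi> x 0) \<in> borel_measurable lborel"
      using um \<phi>m by simp
    show "(\<lambda>x. \<bar>v (x / (1 / (real n + 1))) - k\<bar> * \<phi> x (1 / (real n + 1))) \<in> borel_measurable lborel" for n
    proof -
      have [measurable]: "(\<lambda>x. \<phi> x (1 / (real n + 1))) \<in> borel_measurable borel" by (rule \<phi>m)
      show ?thesis by measurable
    qed
  qed
  have "0 \<le> set_lebesgue_integral lborel (?H n) ?G + ?B n" for n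
    using profile_entropy_after[OF Q ab k v tf _ intn[of n]] by simp
  then show "0 \<le> set_lebesgue_integral lborel (UNIV \<times> {0<..}) ?G + (LINT x | lborel. \<bar>riemann_data a b x - k\<bar> * \<phi> x 0)"
    by (intro LIMSEQ_le_const[OF tendsto_add[OF lim1 lim2]]) auto
qed

section \<open>Waves of nonnegative speed\<close>

lemma riemann_data_measurable: "riemann_data rl rr \<in> borel_measurable borel"
  unfolding riemann_data_def[abs_def] by measurable

lemma riemann_data_range: "rl \<in> S \<Longrightarrow> rr \<in> S \<Longrightarrow> riemann_data rl rr x \<in> S"
  by (simp add: riemann_data_def)

lemma riemann_solution_measurable:
  assumes "riemann_solution Q rj rl rr v"
  shows "v \<in> borel_measurable borel"
proof -
  have "(\<lambda>z. indicat_real (UNIV \<times> {0<..}) z *\<^sub>R (case z of (x, t) \<Rightarrow> v (x / t))) \<in> borel_measurable borel"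
    using assms unfolding riemann_solution_def entropy_solution_def set_borel_measurable_def by simp
  from measurable_compose[OF _ this, of "\<lambda>x. (x, 1)" borel] show ?thesis by simp
qed

text \<open>
  For each fixed \<open>t > 0\<close> the map \<open>x \<mapsto> x / t\<close> preserves null sets. The entropy estimates only see
  the times \<open>t < 1/2\<close>, but by similarity one time suffices.
\<close>

lemma similarity_AE:
  fixes v :: "real \<Rightarrow> real"
  assumes v [measurable]: "v \<in> borel_measurable borel"
  shows "(AE \<xi> in lborel. \<xi> < 0 \<longrightarrow> v \<xi> = a) \<longleftrightarrow>
    (AE (x, t) in lborel. 0 < t \<and> t < 1/2 \<and> x < 0 \<longrightarrow> v (x / t) = a)"
proof -
  define P where "P x t \<longleftrightarrow> (0 < t \<and> t < 1/2 \<and> x < 0 \<longrightarrow> v (x / t) = a)" for x t :: real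
  have m: "{z \<in> space (lborel \<Otimes>\<^sub>M lborel). P (fst z) (snd z)} \<in> sets (lborel \<Otimes>\<^sub>M lborel)"
    unfolding P_def by measurable
  have "(AE (x, t) in lborel. 0 < t \<and> t < 1/2 \<and> x < 0 \<longrightarrow> v (x / t) = a)
      \<longleftrightarrow> (AE z in lborel \<Otimes>\<^sub>M lborel. P (fst z) (snd z))"
    unfolding lborel_prod P_def case_prod_unfold ..
  also have "\<dots> \<longleftrightarrow> (AE x in lborel. AE t in lborel. P x t)"
    by (rule lborel_pair.AE_pair_iff[OF m, symmetric])
  also have "\<dots> \<longleftrightarrow> (AE t in lborel. AE x in lborel. P x t)"
    by (rule lborel_pair.AE_commute[OF m])
  also have "\<dots> \<longleftrightarrow> (AE \<xi> in lborel. \<xi> < 0 \<longrightarrow> v \<xi> = a)"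
  proof
    assume *: "AE \<xi> in lborel. \<xi> < 0 \<longrightarrow> v \<xi> = a"
    have "AE x in lborel. P x t" for t
    proof (cases "0 < t")
      case True
      then have "AE x in lborel. 0 + (1 / t) * x < 0 \<longrightarrow> v (0 + (1 / t) * x) = a"
        by (intro AE_borel_affine[OF _ _ *]) simp_all
      then show ?thesis
        by eventually_elim (use True in \<open>auto simp: P_def divide_neg_pos\<close>)
    qed (simp add: P_def)
    then show "AE t in lborel. AE x in lborel. P x t" by simp
  next
    assume *: "AE t in lborel. AE x in lborel. P x t"
    have "\<exists>t. 0 < t \<and> t < 1/2 \<and> (AE x in lborel. P x t)"
    proof (rule ccontr)
      assume no: "\<not> ?thesis"
      have "AE t in lborel. t \<notin> {0<..<1/2::real}"
        using * by eventually_elim (use no in auto)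
      then have "{0<..<1/2::real} \<in> null_sets lborel"
        by (subst AE_iff_null_sets) auto
      then show False by (simp add: null_sets_def)
    qed
    then obtain t where t: "0 < t" "t < 1/2" and ae: "AE x in lborel. P x t" by blast
    have "Measurable.pred borel (\<lambda>x. P x t)" unfolding P_def by measurable
    from AE_borel_affine[OF _ this ae, of t 0] t
    have "AE \<xi> in lborel. P (0 + t * \<xi>) t" by simp
    then show "AE \<xi> in lborel. \<xi> < 0 \<longrightarrow> v \<xi> = a"
      by eventually_elim (use t in \<open>auto simp: P_def mult_pos_neg\<close>)
  qed
  finally show ?thesis by simp
qed

text \<open>
  Uniform continuity handles close arguments, boundedness the others.
\<close>

lemma flux_modulus:
  fixes Q :: "real \<Rightarrow> real"
  assumes Q: "continuous_on {0..rj} Q" and e: "0 < \<epsilon>"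
  shows "\<exists>C\<ge>0. \<forall>r\<in>{0..rj}. \<forall>s\<in>{0..rj}. \<bar>Q r - Q s\<bar> \<le> \<epsilon> + C * \<bar>r - s\<bar>"
proof -
  obtain M where M: "0 \<le> M" "\<And>r. r \<in> {0..rj} \<Longrightarrow> \<bar>Q r\<bar> \<le> M"
    using continuous_flux_bounded[OF Q] by blast
  have "uniformly_continuous_on {0..rj} Q" by (rule compact_uniformly_continuous[OF Q compact_Icc])
  then obtain d where d: "0 < d" "\<And>r s. r \<in> {0..rj} \<Longrightarrow> s \<in> {0..rj} \<Longrightarrow> dist s r < d \<Longrightarrow> dist (Q s) (Q r) < \<epsilon>"
    using e unfolding uniformly_continuous_on_def by metis
  have "\<bar>Q r - Q s\<bar> \<le> \<epsilon> + 2 * M / d * \<bar>r - s\<bar>" if rs: "r \<in> {0..rj}" "s \<in> {0..rj}" for r s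
  proof (cases "\<bar>r - s\<bar> < d")
    case True
    then have "\<bar>Q r - Q s\<bar> < \<epsilon>" using d(2)[OF rs(2,1)] by (simp add: dist_real_def)
    moreover have "0 \<le> 2 * M / d * \<bar>r - s\<bar>" using M(1) d(1) by simp
    ultimately show ?thesis by linarith
  next
    case False
    have "\<bar>Q r - Q s\<bar> \<le> 2 * M" using M(2)[OF rs(1)] M(2)[OF rs(2)] by linarith
    also have "\<dots> = 2 * M / d * d" using d(1) by simp
    also have "\<dots> \<le> 2 * M / d * \<bar>r - s\<bar>" using False M(1) d(1) by (intro mult_left_mono) auto
    finally show ?thesis using e by linarith
  qed
  then show ?thesis using M(1) d(1) by (intro exI[of _ "2 * M / d"]) auto
qed

lemma entropy_solution_dominated_flux:
  fixes Q :: "real \<Rightarrow> real"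
  assumes Q: "continuous_on {0..rj} Q" and sol: "entropy_solution Q rj u0 u" and k: "k \<in> {0..rj}"
  shows "dominated_flux (\<lambda>x t. \<bar>u x t - k\<bar>) (\<lambda>x t. sgn (u x t - k) * (Q (u x t) - Q k))"
    and "dominated_flux (\<lambda>x t. max 0 (u x t - k)) (\<lambda>x t. if k < u x t then Q (u x t) - Q k else 0)"
    and "dominated_flux (\<lambda>x t. max 0 (k - u x t)) (\<lambda>x t. if u x t < k then Q k - Q (u x t) else 0)"
proof -
  have ran: "\<And>x t. t > 0 \<Longrightarrow> u x t \<in> {0..rj}" using sol unfolding entropy_solution_def by blast
  have *: "\<exists>C\<ge>0. \<forall>x. \<forall>t>0. \<bar>Q (u x t) - Q k\<bar> \<le> \<epsilon> + C * \<bar>u x t - k\<bar>" if "0 < \<epsilon>" for \<epsilon>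
    using flux_modulus[OF Q that] ran k by metis
  have dom: "dominated_flux \<eta> q"
    if le: "\<And>x t. 0 < t \<Longrightarrow> q x t = 0 \<and> 0 \<le> \<eta> x t \<or> \<bar>q x t\<bar> = \<bar>Q (u x t) - Q k\<bar> \<and> \<eta> x t = \<bar>u x t - k\<bar>"
    for \<eta> q
    unfolding dominated_flux_def
  proof (intro allI impI)
    fix \<epsilon> :: real assume e: "0 < \<epsilon>"
    obtain C where C: "0 \<le> C" "\<And>x t. 0 < t \<Longrightarrow> \<bar>Q (u x t) - Q k\<bar> \<le> \<epsilon> + C * \<bar>u x t - k\<bar>"
      using *[OF e] by blast
    have "\<bar>q x t\<bar> \<le> \<epsilon> + C * \<eta> x t" if "0 < t" for x t
      using le[OF that, of x] C(2)[OF that, of x] C(1) e by auto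
    then show "\<exists>C\<ge>0. \<forall>x. \<forall>t>0. \<bar>q x t\<bar> \<le> \<epsilon> + C * \<eta> x t" using C(1) by blast
  qed
  show "dominated_flux (\<lambda>x t. \<bar>u x t - k\<bar>) (\<lambda>x t. sgn (u x t - k) * (Q (u x t) - Q k))"
    by (rule dom) (auto simp: abs_mult sgn_if)
  show "dominated_flux (\<lambda>x t. max 0 (u x t - k)) (\<lambda>x t. if k < u x t then Q (u x t) - Q k else 0)"
    by (rule dom) auto
  show "dominated_flux (\<lambda>x t. max 0 (k - u x t)) (\<lambda>x t. if u x t < k then Q k - Q (u x t) else 0)"
    by (rule dom) auto
qed

definition upstream_stationary :: "(real \<Rightarrow> real) \<Rightarrow> real \<Rightarrow> real \<Rightarrow> real \<Rightarrow> bool" where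
  "upstream_stationary Q rj a b \<longleftrightarrow> (\<exists>v. riemann_solution Q rj a b v) \<and>
     (\<forall>v. riemann_solution Q rj a b v \<longrightarrow> (AE \<xi> in lborel. \<xi> < 0 \<longrightarrow> v \<xi> = a))"

lemma riemann_solution_between:
  fixes Q :: "real \<Rightarrow> real"
  assumes Q: "continuous_on {0..rj} Q" and ab: "0 \<le> a" "a \<le> b" "b \<le> rj" and v: "riemann_solution Q rj a b v"
  shows "AE (x, t) in lborel. 0 < t \<and> t < 1/2 \<longrightarrow> v (x / t) \<in> {a..b}"
proof -
  let ?u = "\<lambda>x t. v (x / t)"
  have sol: "entropy_solution Q rj (riemann_data a b) ?u" using v unfolding riemann_solution_def .
  have a: "a \<in> {0..rj}" and b: "b \<in> {0..rj}" using ab by auto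
  note half = half_entropies[OF Q sol _ riemann_data_measurable riemann_data_range[OF a b]]
  have "AE (x, t) in lborel. 0 < t \<and> t < 1/2 \<longrightarrow> max 0 (?u x t - b) = 0"
    by (rule maximum_principle[OF half(1)[OF b] entropy_solution_fields(3,4)[OF Q sol b] _
          entropy_solution_dominated_flux(2)[OF Q sol b]])
      (use ab in \<open>auto simp: riemann_data_def\<close>)
  moreover have "AE (x, t) in lborel. 0 < t \<and> t < 1/2 \<longrightarrow> max 0 (a - ?u x t) = 0"
    by (rule maximum_principle[OF half(2)[OF a] entropy_solution_fields(5,6)[OF Q sol a] _
          entropy_solution_dominated_flux(3)[OF Q sol a]])
      (use ab in \<open>auto simp: riemann_data_def\<close>)
  ultimately show ?thesis
    by eventually_elim (auto simp: max_def split: if_splits)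
qed

text \<open>
  If the left state persists, \<open>inflow_nonneg\<close> applied to the entropy \<open>max 0 (k - u)\<close>, which vanishes initially on the
  right because \<open>k \<le> b\<close>, gives \<open>Q a \<le> Q k\<close>. Conversely, the solution takes values in
  \<open>{a..b}\<close> only, where minimality of \<open>Q a\<close> makes the flux of \<open>\<bar>u - a\<bar>\<close> nonnegative.
\<close>

lemma upstream_stationary_iff_ordered:
  fixes Q :: "real \<Rightarrow> real"
  assumes Q: "continuous_on {0..rj} Q" and ab: "0 \<le> a" "a \<le> b" "b \<le> rj"
  shows "upstream_stationary Q rj a b \<longleftrightarrow> (\<forall>k\<in>{a..b}. Q a \<le> Q k)"
proof
  have a: "a \<in> {0..rj}" and b: "b \<in> {0..rj}" using ab by auto
  {
    assume st: "upstream_stationary Q rj a b"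
    then obtain v where v: "riemann_solution Q rj a b v" unfolding upstream_stationary_def by blast
    let ?u = "\<lambda>x t. v (x / t)"
    have sol: "entropy_solution Q rj (riemann_data a b) ?u" using v unfolding riemann_solution_def .
    have "AE \<xi> in lborel. \<xi> < 0 \<longrightarrow> v \<xi> = a" using st v unfolding upstream_stationary_def by blast
    then have ae: "AE (x, t) in lborel. 0 < t \<and> t < 1/2 \<and> x < 0 \<longrightarrow> ?u x t = a"
      using similarity_AE[OF riemann_solution_measurable[OF v]] by blast
    show "\<forall>k\<in>{a..b}. Q a \<le> Q k"
    proof
      fix k assume k: "k \<in> {a..b}"
      then have k0: "k \<in> {0..rj}" using ab by auto
      show "Q a \<le> Q k"
      proof (cases "a < k")
        case True
        have "Q a - Q k \<le> 0"
        proof (rule inflow_nonneg[OF half_entropies(2)[OF Q sol k0 riemann_data_measurable riemann_data_range[OF a b]]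
              entropy_solution_fields(5,6)[OF Q sol k0] _ entropy_solution_dominated_flux(3)[OF Q sol k0], where A = rj])
          show "AE (x, t) in lborel. 0 < t \<and> t < 1/2 \<and> x < 0 \<longrightarrow>
              (if ?u x t < k then Q k - Q (?u x t) else 0) = - (Q a - Q k)"
            using ae by eventually_elim (use True in auto)
          show "(\<lambda>x. max 0 (k - riemann_data a b x)) \<in> borel_measurable borel"
            using riemann_data_measurable by simp
        qed (use k k0 ab in \<open>auto simp: riemann_data_def\<close>)
        then show ?thesis by simp
      qed (use k in auto)
    qed
  }
  assume min: "\<forall>k\<in>{a..b}. Q a \<le> Q k"
  show "upstream_stationary Q rj a b"
    unfolding upstream_stationary_def
  proof (intro conjI allI impI)
    show "\<exists>v. riemann_solution Q rj a b v"
      using minimizing_profile_exists[OF Q ab] minimizing_profile_solution[OF Q ab] by blast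
    fix v assume v: "riemann_solution Q rj a b v"
    let ?u = "\<lambda>x t. v (x / t)"
    have sol: "entropy_solution Q rj (riemann_data a b) ?u" using v unfolding riemann_solution_def .
    have "AE (x, t) in lborel. 0 < t \<and> t < 1/2 \<and> x < 0 \<longrightarrow> \<bar>?u x t - a\<bar> = 0"
    proof (rule left_half_vanishes[OF entropy_solution_Kruzhkov[OF sol a] entropy_solution_fields(1,2)[OF Q sol a] _
          entropy_solution_dominated_flux(1)[OF Q sol a]])
      show "AE (x, t) in lborel. 0 < t \<and> t < 1/2 \<and> x < 0 \<longrightarrow> 0 \<le> sgn (?u x t - a) * (Q (?u x t) - Q a)"
        using riemann_solution_between[OF Q ab v]
      proof eventually_elim
        case (elim z)
        then show ?case using min by (cases z) (auto simp: sgn_if)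
      qed
    qed (auto simp: riemann_data_def)
    then show "AE \<xi> in lborel. \<xi> < 0 \<longrightarrow> v \<xi> = a"
      unfolding similarity_AE[OF riemann_solution_measurable[OF v]] by simp
  qed
qed

lemma entropy_solution_field:
  assumes "entropy_solution Q rj u0 u"
  shows "bounded_field u"
proof -
  have "\<forall>x. \<forall>t>0. \<bar>u x t\<bar> \<le> rj" using assms unfolding entropy_solution_def by fastforce
  then show ?thesis using assms unfolding entropy_solution_def bounded_field_def by blast
qed

text \<open>
  If \<open>u\<close> solves the equation with flux \<open>Q\<close>, then \<open>rj - u\<close> does so with flux \<open>- Q (rj - r)\<close>, and the constants \<open>k\<close>
  and \<open>rj - k\<close> correspond to each other. The orders of the two states are opposite, the speeds are the same.
\<close>

lemma riemann_solution_complement: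
  assumes "riemann_solution Q rj a b v"
  shows "riemann_solution (\<lambda>r. - Q (rj - r)) rj (rj - a) (rj - b) (\<lambda>\<xi>. rj - v \<xi>)"
proof -
  let ?u = "\<lambda>x t. v (x / t)"
  have sol: "entropy_solution Q rj (riemann_data a b) ?u" using assms unfolding riemann_solution_def .
  have "bounded_field (\<lambda>x t. rj + (-1) * ?u x t)"
    by (rule bounded_field_affine[OF entropy_solution_field[OF sol]])
  then have m: "set_borel_measurable lborel (UNIV \<times> {0<..}) (\<lambda>(x, t). rj - ?u x t)"
    unfolding bounded_field_def by simp
  have ran: "?u x t \<in> {0..rj}" if "0 < t" for x t using sol that unfolding entropy_solution_def by blast
  have K: "entropy_ineq (\<lambda>x. \<bar>riemann_data (rj - a) (rj - b) x - k\<bar>) (\<lambda>x t. \<bar>rj - ?u x t - k\<bar>)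
      (\<lambda>x t. sgn (rj - ?u x t - k) * (- Q (rj - (rj - ?u x t)) - - Q (rj - k)))" if k: "k \<in> {0..rj}" for k
  proof -
    have "rj - k \<in> {0..rj}" using k by auto
    from entropy_solution_Kruzhkov[OF sol this]
    have "entropy_ineq (\<lambda>x. \<bar>riemann_data a b x - (rj - k)\<bar>) (\<lambda>x t. \<bar>?u x t - (rj - k)\<bar>)
      (\<lambda>x t. sgn (?u x t - (rj - k)) * (Q (?u x t) - Q (rj - k)))" .
    moreover have "(\<lambda>x. \<bar>riemann_data a b x - (rj - k)\<bar>) = (\<lambda>x. \<bar>riemann_data (rj - a) (rj - b) x - k\<bar>)"
      by (auto simp: riemann_data_def fun_eq_iff)
    moreover have "(\<lambda>x t. \<bar>?u x t - (rj - k)\<bar>) = (\<lambda>x t. \<bar>rj - ?u x t - k\<bar>)"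
      by (auto simp: fun_eq_iff)
    moreover have "(\<lambda>x t. sgn (?u x t - (rj - k)) * (Q (?u x t) - Q (rj - k)))
        = (\<lambda>x t. sgn (rj - ?u x t - k) * (- Q (rj - (rj - ?u x t)) - - Q (rj - k)))"
      by (auto simp: fun_eq_iff sgn_if algebra_simps)
    ultimately show ?thesis by simp
  qed
  show ?thesis
    unfolding riemann_solution_def entropy_solution_def
    using m ran K unfolding entropy_ineq_def by auto
qed

lemma upstream_stationary_complement:
  "upstream_stationary Q rj a b \<longleftrightarrow> upstream_stationary (\<lambda>r. - Q (rj - r)) rj (rj - a) (rj - b)"
proof -
  have imp: "upstream_stationary (\<lambda>r. - P (rj - r)) rj (rj - c) (rj - d)" if st: "upstream_stationary P rj c d" for P c d
    unfolding upstream_stationary_def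
  proof (intro conjI allI impI)
    show "\<exists>v. riemann_solution (\<lambda>r. - P (rj - r)) rj (rj - c) (rj - d) v"
      using st riemann_solution_complement unfolding upstream_stationary_def by blast
    fix v assume "riemann_solution (\<lambda>r. - P (rj - r)) rj (rj - c) (rj - d) v"
    from riemann_solution_complement[OF this]
    have "riemann_solution P rj c d (\<lambda>\<xi>. rj - v \<xi>)" by simp
    then have "AE \<xi> in lborel. \<xi> < 0 \<longrightarrow> rj - v \<xi> = c" using st unfolding upstream_stationary_def by blast
    then show "AE \<xi> in lborel. \<xi> < 0 \<longrightarrow> v \<xi> = rj - c" by eventually_elim auto
  qed
  show ?thesis using imp[of Q a b] imp[of "\<lambda>r. - Q (rj - r)" "rj - a" "rj - b"] by auto
qed

lemma upstream_stationary_iff: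
  fixes Q :: "real \<Rightarrow> real"
  assumes Q: "continuous_on {0..rj} Q" and a: "a \<in> {0..rj}" and b: "b \<in> {0..rj}"
  shows "upstream_stationary Q rj a b \<longleftrightarrow>
    (a \<le> b \<and> (\<forall>k\<in>{a..b}. Q a \<le> Q k)) \<or> (b \<le> a \<and> (\<forall>k\<in>{b..a}. Q k \<le> Q a))"
proof (cases "a \<le> b")
  case True
  then show ?thesis using upstream_stationary_iff_ordered[OF Q, of a b] a b by auto
next
  case False
  have Q': "continuous_on {0..rj} (\<lambda>r. - Q (rj - r))"
    by (intro continuous_intros continuous_on_compose2[OF Q]) auto
  have "upstream_stationary Q rj a b \<longleftrightarrow> (\<forall>k\<in>{rj - a..rj - b}. - Q (rj - (rj - a)) \<le> - Q (rj - k))"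
    unfolding upstream_stationary_complement[of Q]
    by (rule upstream_stationary_iff_ordered[OF Q']) (use False a b in auto)
  also have "\<dots> \<longleftrightarrow> (\<forall>k\<in>{b..a}. Q k \<le> Q a)"
  proof
    assume *: "\<forall>k\<in>{rj - a..rj - b}. - Q (rj - (rj - a)) \<le> - Q (rj - k)"
    show "\<forall>k\<in>{b..a}. Q k \<le> Q a"
    proof
      fix k assume "k \<in> {b..a}"
      then have "rj - k \<in> {rj - a..rj - b}" by auto
      from bspec[OF * this] show "Q k \<le> Q a" by simp
    qed
  qed auto
  finally show ?thesis using False by auto
qed

text \<open>
  The reflection \<open>x \<mapsto> -x\<close> reverses the flux and exchanges the initial states, except at
  \<open>x = 0\<close>, which is a null set.
\<close>

lemma riemann_solution_reflect:
  fixes Q :: "real \<Rightarrow> real"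
  assumes Q: "continuous_on {0..rj} Q" and v: "riemann_solution Q rj rl rr v"
  shows "riemann_solution (\<lambda>r. - Q r) rj rr rl (\<lambda>\<xi>. v (- \<xi>))"
proof -
  let ?u = "\<lambda>x t. v (x / t)"
  have sol: "entropy_solution Q rj (riemann_data rl rr) ?u" using v unfolding riemann_solution_def .
  have m: "set_borel_measurable lborel (UNIV \<times> {0<..}) (\<lambda>(x, t). ?u (- x) t)"
    by (rule set_borel_measurable_reflect) (use sol in \<open>simp add: entropy_solution_def\<close>)
  have ran: "?u x t \<in> {0..rj}" if "0 < t" for x t using sol that unfolding entropy_solution_def by blast
  have K: "0 \<le> (LINT (x, t) : UNIV \<times> {0<..} | lborel.
        \<bar>v (- (x / t)) - k\<bar> * \<phi>t x t + sgn (v (- (x / t)) - k) * (- Q (v (- (x / t))) - - Q k) * \<phi>x x t)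
      + (LINT x | lborel. \<bar>riemann_data rr rl x - k\<bar> * \<phi> x 0)"
    if k: "k \<in> {0..rj}" and tf: "test_function \<phi> \<phi>x \<phi>t" for k \<phi> \<phi>x \<phi>t
  proof -
    have "entropy_ineq (\<lambda>x. \<bar>riemann_data rl rr (- x) - k\<bar>) (\<lambda>x t. \<bar>?u (- x) t - k\<bar>)
        (\<lambda>x t. - (sgn (?u (- x) t - k) * (Q (?u (- x) t) - Q k)))"
      by (rule entropy_ineq_reflect[OF entropy_solution_Kruzhkov[OF sol k] entropy_solution_fields(1,2)[OF Q sol k]])
    then have "0 \<le> (LINT (x, t) : UNIV \<times> {0<..} | lborel.
        \<bar>?u (- x) t - k\<bar> * \<phi>t x t + - (sgn (?u (- x) t - k) * (Q (?u (- x) t) - Q k)) * \<phi>x x t)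
      + (LINT x | lborel. \<bar>riemann_data rl rr (- x) - k\<bar> * \<phi> x 0)"
      using tf unfolding entropy_ineq_def by blast
    moreover have "(LINT x | lborel. \<bar>riemann_data rl rr (- x) - k\<bar> * \<phi> x 0)
        = (LINT x | lborel. \<bar>riemann_data rr rl x - k\<bar> * \<phi> x 0)"
    proof (rule integral_cong_AE)
      have [measurable]: "(\<lambda>x. \<phi> x 0) \<in> borel_measurable borel"
        using measurable_compose[OF _ test_function_measurable(1)[OF tf], of "\<lambda>x. (x, 0)" borel] by simp
      note [measurable] = riemann_data_measurable
      show "(\<lambda>x. \<bar>riemann_data rl rr (- x) - k\<bar> * \<phi> x 0) \<in> borel_measurable lborel"
        "(\<lambda>x. \<bar>riemann_data rr rl x - k\<bar> * \<phi> x 0) \<in> borel_measurable lborel" by measurable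
      have "AE x in lborel. x \<noteq> (0::real)" by (rule AE_lborel_singleton)
      then show "AE x in lborel. \<bar>riemann_data rl rr (- x) - k\<bar> * \<phi> x 0 = \<bar>riemann_data rr rl x - k\<bar> * \<phi> x 0"
        by eventually_elim (auto simp: riemann_data_def)
    qed
    moreover have "- (sgn (?u (- x) t - k) * (Q (?u (- x) t) - Q k))
        = sgn (v (- (x / t)) - k) * (- Q (v (- (x / t))) - - Q k)" for x t
      by (simp add: algebra_simps)
    ultimately show ?thesis by (simp only: minus_divide_left)
  qed
  have ran': "v (- (x / t)) \<in> {0..rj}" if "0 < t" for x t using ran[OF that, of "- x"] by simp
  show ?thesis
    unfolding riemann_solution_def entropy_solution_def
    using m ran' K by simp
qed

lemma downstream_stationary_iff:
  fixes Q :: "real \<Rightarrow> real"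
  assumes Q: "continuous_on {0..rj} Q"
  shows "(\<exists>v. riemann_solution Q rj b a v) \<and>
     (\<forall>v. riemann_solution Q rj b a v \<longrightarrow> (AE \<xi> in lborel. \<xi> > 0 \<longrightarrow> v \<xi> = a))
   \<longleftrightarrow> upstream_stationary (\<lambda>r. - Q r) rj a b" (is "?down \<longleftrightarrow> ?up")
proof -
  have Q': "continuous_on {0..rj} (\<lambda>r. - Q r)" by (intro continuous_intros Q)
  have refl: "riemann_solution Q rj b a (\<lambda>\<xi>. v (- \<xi>))" if "riemann_solution (\<lambda>r. - Q r) rj a b v" for v
    using riemann_solution_reflect[OF Q' that] by simp
  have ae: "(AE \<xi> in lborel. - \<xi> < 0 \<longrightarrow> v (- \<xi>) = a)" if "AE \<xi> in lborel. \<xi> < 0 \<longrightarrow> v \<xi> = a" "v \<in> borel_measurable borel"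
    for v :: "real \<Rightarrow> real"
  proof -
    have "Measurable.pred borel (\<lambda>\<xi>. \<xi> < 0 \<longrightarrow> v \<xi> = a)" using that(2) by measurable
    from AE_borel_affine[OF _ this that(1), of "-1" 0] show ?thesis by simp
  qed
  have ae': "(AE \<xi> in lborel. - \<xi> > 0 \<longrightarrow> v (- \<xi>) = a)" if "AE \<xi> in lborel. \<xi> > 0 \<longrightarrow> v \<xi> = a" "v \<in> borel_measurable borel"
    for v :: "real \<Rightarrow> real"
  proof -
    have "Measurable.pred borel (\<lambda>\<xi>. \<xi> > 0 \<longrightarrow> v \<xi> = a)" using that(2) by measurable
    from AE_borel_affine[OF _ this that(1), of "-1" 0] show ?thesis by simp
  qed
  show ?thesis
  proof
    assume d: ?down
    show ?up
      unfolding upstream_stationary_def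
    proof (intro conjI allI impI)
      show "\<exists>v. riemann_solution (\<lambda>r. - Q r) rj a b v" using d riemann_solution_reflect[OF Q] by blast
      fix v assume v: "riemann_solution (\<lambda>r. - Q r) rj a b v"
      have "AE \<xi> in lborel. \<xi> > 0 \<longrightarrow> v (- \<xi>) = a" using d refl[OF v] by blast
      from ae'[OF this] riemann_solution_measurable[OF refl[OF v]]
      show "AE \<xi> in lborel. \<xi> < 0 \<longrightarrow> v \<xi> = a" by simp
    qed
  next
    assume u: ?up
    show ?down
    proof (intro conjI allI impI)
      show "\<exists>v. riemann_solution Q rj b a v" using u refl unfolding upstream_stationary_def by blast
      fix v assume v: "riemann_solution Q rj b a v"
      have "AE \<xi> in lborel. \<xi> < 0 \<longrightarrow> v (- \<xi>) = a"
        using u riemann_solution_reflect[OF Q v] unfolding upstream_stationary_def by blast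
      from ae[OF this] riemann_solution_measurable[OF riemann_solution_reflect[OF Q v]]
      show "AE \<xi> in lborel. \<xi> > 0 \<longrightarrow> v \<xi> = a" by simp
    qed
  qed
qed

section \<open>Unimodal fluxes\<close>

lemma fundamental_diagram_facts:
  assumes "fundamental_diagram Q rj rc"
  shows "0 \<le> rc" "rc \<le> rj" "continuous_on {0..rj} Q"
    and "\<And>x y. 0 \<le> x \<Longrightarrow> x < y \<Longrightarrow> y \<le> rc \<Longrightarrow> Q x < Q y"
    and "\<And>x y. rc \<le> x \<Longrightarrow> x < y \<Longrightarrow> y \<le> rj \<Longrightarrow> Q y < Q x"
proof -
  show "0 \<le> rc" "rc \<le> rj" "continuous_on {0..rj} Q"
    using assms by (auto simp: fundamental_diagram_def piecewise_C1_differentiable_on_def)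
  show "Q x < Q y" if "0 \<le> x" "x < y" "y \<le> rc" for x y
    using assms that by (auto simp: fundamental_diagram_def dest: monotone_onD[where x = x and y = y])
  show "Q y < Q x" if "rc \<le> x" "x < y" "y \<le> rj" for x y
    using assms that by (auto simp: fundamental_diagram_def dest: monotone_onD[where x = x and y = y])
qed

lemma density_of_state:
  assumes fd: "fundamental_diagram Q rj rc" and U: "(D, S) \<in> traffic_states Q rc"
  shows "density_of Q rj rc (D, S) \<in> {0..rj}"
    and "D = Q (min (density_of Q rj rc (D, S)) rc)" and "S = Q (max (density_of Q rj rc (D, S)) rc)"
proof -
  note b = bij_betw_state_of[OF fd]
  have im: "(D, S) \<in> state_of Q rc ` {0..rj}" using b U unfolding bij_betw_def by simp
  have inj: "inj_on (state_of Q rc) {0..rj}" using b unfolding bij_betw_def by simp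
  show "density_of Q rj rc (D, S) \<in> {0..rj}"
    unfolding density_of_def using the_inv_into_into[OF inj im] by blast
  have "state_of Q rc (density_of Q rj rc (D, S)) = (D, S)"
    unfolding density_of_def by (rule f_the_inv_into_f[OF inj im])
  then show "D = Q (min (density_of Q rj rc (D, S)) rc)" "S = Q (max (density_of Q rj rc (D, S)) rc)"
    by (simp_all add: state_of_def demand_of_def supply_of_def)
qed

text \<open>
  If \<open>a\<close> is congested, the flux exceeds \<open>Q a\<close> on states slightly below \<open>a\<close> and is smaller on all states
  above it, so that only \<open>b = a\<close> is possible. If \<open>a\<close> is free-flowing or critical, the flux is at most
  \<open>Q a\<close> below \<open>a\<close>, and by unimodality its minimum over \<open>{a..b}\<close> is attained at an end point.
\<close>

lemma admissible_upstream_iff: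
  assumes fd: "fundamental_diagram Q rj rc" and Um: "(Dm, Sm) \<in> traffic_states Q rc" and U: "(D, S) \<in> traffic_states Q rc"
  shows "admissible_upstream Q rj rc (Dm, Sm) (D, S) \<longleftrightarrow>
    (Sm < Dm \<longrightarrow> (D, S) = (Dm, Sm)) \<and> (Dm \<le> Sm \<longrightarrow> Dm \<le> S)"
proof -
  note F = fundamental_diagram_facts[OF fd]
  define a where "a = density_of Q rj rc (Dm, Sm)"
  define b where "b = density_of Q rj rc (D, S)"
  note A = density_of_state[OF fd Um, folded a_def] and B = density_of_state[OF fd U, folded b_def]
  have "admissible_upstream Q rj rc (Dm, Sm) (D, S) \<longleftrightarrow>
      (a \<le> b \<and> (\<forall>k\<in>{a..b}. Q a \<le> Q k)) \<or> (b \<le> a \<and> (\<forall>k\<in>{b..a}. Q k \<le> Q a))"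
    using upstream_stationary_iff[OF F(3) A(1) B(1)]
    unfolding admissible_upstream_def upstream_stationary_def a_def b_def .
  also have "\<dots> \<longleftrightarrow> (Sm < Dm \<longrightarrow> (D, S) = (Dm, Sm)) \<and> (Dm \<le> Sm \<longrightarrow> Dm \<le> S)"
  proof (cases "rc < a")
    case True
    have ab: "(D, S) = (Dm, Sm) \<longleftrightarrow> a = b"
    proof
      assume "a = b"
      then show "(D, S) = (Dm, Sm)" unfolding prod.inject by (metis A(2,3) B(2,3))
    qed (simp add: a_def b_def)
    have "Sm = Q a" "Dm = Q rc" using A True by (auto simp: max_def min_def)
    then have "Sm < Dm" using F(5)[of rc a] True A(1) by simp
    moreover have "\<not> (\<forall>k\<in>{a..b}. Q a \<le> Q k)" if "a < b"
    proof -
      have "Q b < Q a" "b \<in> {a..b}" using F(5)[of a b] that True B(1) by auto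
      then show ?thesis by (meson not_less)
    qed
    moreover have "\<not> (\<forall>k\<in>{b..a}. Q k \<le> Q a)" if "b < a"
    proof -
      have "Q a < Q (max b rc)" using F(5)[of "max b rc" a] that True A(1) by simp
      moreover have "max b rc \<in> {b..a}" using that True by auto
      ultimately show ?thesis by (meson not_less)
    qed
    ultimately show ?thesis
      unfolding ab by (cases a b rule: linorder_cases) auto
  next
    case False
    then have Dm: "Dm = Q a" and Sm: "Sm = Q rc" using A by (auto simp: max_def min_def)
    have "Dm \<le> Sm" using F(4)[of a rc] False A(1) unfolding Dm Sm by (cases "a = rc") auto
    moreover have "(a \<le> b \<and> (\<forall>k\<in>{a..b}. Q a \<le> Q k)) \<or> (b \<le> a \<and> (\<forall>k\<in>{b..a}. Q k \<le> Q a)) \<longleftrightarrow> Dm \<le> S"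
    proof (cases "rc < b")
      case True
      then have S: "S = Q b" using B by (auto simp: max_def)
      have "Q a \<le> Q k" if "Q a \<le> Q b" "a \<le> k" "k \<le> b" for k
      proof (cases "k \<le> rc")
        case True
        then show ?thesis using F(4)[of a k] that A(1) by (cases "a = k") auto
      next
        case False
        then show ?thesis using F(5)[of k b] that B(1) by (cases "k = b") auto
      qed
      then show ?thesis using True False unfolding S Dm by auto
    next
      case b: False
      then have S: "S = Q rc" using B by (auto simp: max_def)
      have "Q x \<le> Q y" if "0 \<le> x" "x \<le> y" "y \<le> rc" for x y
        using F(4)[of x y] that by (cases "x = y") auto
      then show ?thesis using False b A(1) B(1) unfolding S Dm by auto
    qed
    ultimately show ?thesis by auto
  qed
  finally show ?thesis .
qed

text \<open>
  The mirror image of the upstream case: the flux enters with the opposite sign and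
  the two branches of the diagram exchange their roles.
\<close>

lemma admissible_downstream_iff:
  assumes fd: "fundamental_diagram Q rj rc" and Up: "(Dp, Sp) \<in> traffic_states Q rc" and U: "(D, S) \<in> traffic_states Q rc"
  shows "admissible_downstream Q rj rc (D, S) (Dp, Sp) \<longleftrightarrow>
    (Dp < Sp \<longrightarrow> (D, S) = (Dp, Sp)) \<and> (Sp \<le> Dp \<longrightarrow> Sp \<le> D)"
proof -
  note F = fundamental_diagram_facts[OF fd]
  define a where "a = density_of Q rj rc (Dp, Sp)"
  define b where "b = density_of Q rj rc (D, S)"
  note A = density_of_state[OF fd Up, folded a_def] and B = density_of_state[OF fd U, folded b_def]
  have Q': "continuous_on {0..rj} (\<lambda>r. - Q r)" by (intro continuous_intros F(3))
  have "admissible_downstream Q rj rc (D, S) (Dp, Sp) \<longleftrightarrow>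
      (a \<le> b \<and> (\<forall>k\<in>{a..b}. Q k \<le> Q a)) \<or> (b \<le> a \<and> (\<forall>k\<in>{b..a}. Q a \<le> Q k))"
    using downstream_stationary_iff[OF F(3), of b a] upstream_stationary_iff[OF Q' A(1) B(1)]
    unfolding admissible_downstream_def a_def b_def by simp
  also have "\<dots> \<longleftrightarrow> (Dp < Sp \<longrightarrow> (D, S) = (Dp, Sp)) \<and> (Sp \<le> Dp \<longrightarrow> Sp \<le> D)"
  proof (cases "a < rc")
    case True
    have ab: "(D, S) = (Dp, Sp) \<longleftrightarrow> a = b"
    proof
      assume "a = b"
      then show "(D, S) = (Dp, Sp)" unfolding prod.inject by (metis A(2,3) B(2,3))
    qed (simp add: a_def b_def)
    have "Dp = Q a" "Sp = Q rc" using A True by (auto simp: max_def min_def)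
    then have "Dp < Sp" using F(4)[of a rc] True A(1) by simp
    moreover have "\<not> (\<forall>k\<in>{b..a}. Q a \<le> Q k)" if "b < a"
    proof -
      have "Q b < Q a" "b \<in> {b..a}" using F(4)[of b a] that True B(1) by auto
      then show ?thesis by (meson not_less)
    qed
    moreover have "\<not> (\<forall>k\<in>{a..b}. Q k \<le> Q a)" if "a < b"
    proof -
      have "Q a < Q (min b rc)" using F(4)[of a "min b rc"] that True A(1) by simp
      moreover have "min b rc \<in> {a..b}" using that True by auto
      ultimately show ?thesis by (meson not_less)
    qed
    ultimately show ?thesis
      unfolding ab by (cases a b rule: linorder_cases) auto
  next
    case False
    then have Sp: "Sp = Q a" and Dp: "Dp = Q rc" using A by (auto simp: max_def min_def)
    have "Sp \<le> Dp" using F(5)[of rc a] False A(1) unfolding Dp Sp by (cases "a = rc") auto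
    moreover have "(a \<le> b \<and> (\<forall>k\<in>{a..b}. Q k \<le> Q a)) \<or> (b \<le> a \<and> (\<forall>k\<in>{b..a}. Q a \<le> Q k)) \<longleftrightarrow> Sp \<le> D"
    proof (cases "b < rc")
      case True
      then have D: "D = Q b" using B by (auto simp: min_def)
      have "Q a \<le> Q k" if "Q a \<le> Q b" "b \<le> k" "k \<le> a" for k
      proof (cases "k \<le> rc")
        case True
        then show ?thesis using F(4)[of b k] that B(1) by (cases "b = k") auto
      next
        case False
        then show ?thesis using F(5)[of k a] that A(1) by (cases "k = a") auto
      qed
      then show ?thesis using True False unfolding D Sp by auto
    next
      case b: False
      then have D: "D = Q rc" using B by (auto simp: min_def)
      have "Q y \<le> Q x" if "rc \<le> x" "x \<le> y" "y \<le> rj" for x y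
        using F(5)[of x y] that by (cases "x = y") auto
      then show ?thesis using False b A(1) B(1) unfolding D Sp by auto
    qed
    ultimately show ?thesis by auto
  qed
  finally show ?thesis .
qed

theorem theorem2:
  fixes Q1 Q2 :: "real \<Rightarrow> real" and rj1 rc1 rj2 rc2 C1 C2 :: real
    and D1m S1m D2p S2p D1 S1 D2 S2 :: real
  assumes "fundamental_diagram Q1 rj1 rc1" and "fundamental_diagram Q2 rj2 rc2"
    and "C1 = capacity Q1 rc1" and "C2 = capacity Q2 rc2"
    and "(D1m, S1m) \<in> traffic_states Q1 rc1" and "(D2p, S2p) \<in> traffic_states Q2 rc2"
    and "(D1, S1) \<in> traffic_states Q1 rc1" and "(D2, S2) \<in> traffic_states Q2 rc2"
  shows "admissible_upstream Q1 rj1 rc1 (D1m, S1m) (D1, S1) \<and>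
         admissible_downstream Q2 rj2 rc2 (D2, S2) (D2p, S2p)
     \<longleftrightarrow>
         ((S1m < D1m \<and> D1m = C1 \<longrightarrow> (D1, S1) = (C1, S1m) \<and> (C1, S1m) = (D1m, S1m)) \<and>
          (D1m \<le> S1m \<and> S1m = C1 \<longrightarrow> S1 \<ge> D1m)) \<and>
         ((D2p < S2p \<and> S2p = C2 \<longrightarrow> (D2, S2) = (D2p, C2) \<and> (D2p, C2) = (D2p, S2p)) \<and>
          (S2p \<le> D2p \<and> D2p = C2 \<longrightarrow> D2 \<ge> S2p))"
proof -
  have C1: "max D1m S1m = C1" and C2: "max D2p S2p = C2"
    using assms(3-6) by (simp_all add: traffic_states_def)
  have "(S1m < D1m \<longrightarrow> (D1, S1) = (D1m, S1m)) \<and> (D1m \<le> S1m \<longrightarrow> D1m \<le> S1) \<longleftrightarrow>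
      (S1m < D1m \<and> D1m = C1 \<longrightarrow> (D1, S1) = (C1, S1m) \<and> (C1, S1m) = (D1m, S1m)) \<and>
      (D1m \<le> S1m \<and> S1m = C1 \<longrightarrow> S1 \<ge> D1m)"
    unfolding C1[symmetric] by (cases "S1m < D1m") (simp_all add: max_def)
  moreover have "(D2p < S2p \<longrightarrow> (D2, S2) = (D2p, S2p)) \<and> (S2p \<le> D2p \<longrightarrow> S2p \<le> D2) \<longleftrightarrow>
      (D2p < S2p \<and> S2p = C2 \<longrightarrow> (D2, S2) = (D2p, C2) \<and> (D2p, C2) = (D2p, S2p)) \<and>
      (S2p \<le> D2p \<and> D2p = C2 \<longrightarrow> D2 \<ge> S2p)"
    unfolding C2[symmetric] by (cases "D2p < S2p") (auto simp: max_def)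
  ultimately show ?thesis
    unfolding admissible_upstream_iff[OF assms(1,5,7)] admissible_downstream_iff[OF assms(2,6,8)] by argo
qed

end
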